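(* Let $\mathcal K$ be an admissible superreflexive Köthe function space over a non-atomic $\sigma$-finite measure space $(\Sigma,\mu)$. Then no $L_\infty$-centralizer on $\mathcal K$ is singular. More precisely, for every $L_\infty$-centralizer $\Omega$ on $\mathcal K$ there is a closed subspace $H\subset\mathcal K$ isomorphic to $\ell_2$ on which $\Omega$ is bounded, i.e. there is a constant $C$ such that $\Omega(x)\in\mathcal K$ and $\|\Omega(x)\|_{\mathcal K}\le C\|x\|_{\mathcal K}$ for all $x\in H$.
   Context: Let $(\Sigma,\mu)$ be a $\sigma$-finite measure space and $L_0$ the space of all measurable scalar functions on it. A Köthe function space $\mathcal K$ is a linear subspace of $L_0$ endowed with a quasi-norm such that whenever $|f|\le g$ and $g\in\mathcal K$ then $f\in\mathcal K$ and $\|f\|\le\|g\|$, and such that $1_A\in\mathcal K$ for every $A\subset\Sigma$ of finite measure. $\mathcal K$ is admissible if there are strictly positive functions $h,k\in L_0$ such that $\|hx\|_1\le\|x\|_{\mathcal K}\le\|kx\|_\infty$ for every $x\in\mathcal K$ (where $\|kx\|_\infty$ may be $+\infty$). An $L_\infty$-centralizer on $\mathcal K$ is a homogeneous map $\Omega:\mathcal K\to L_0$ for which there is a constant $C$ such that for every $f\in L_\infty$ and $x\in\mathcal K$ one has $\Omega(fx)-f\Omega(x)\in\mathcal K$ and $\|\Omega(fx)-f\Omega(x)\|_{\mathcal K}\le C\|f\|_\infty\|x\|_{\mathcal K}$. A centralizer is trivial on a subspace $H\subset\mathcal K$ if there is a linear (not necessarily continuous) map $L:H\to L_0$ such that $\Omega_{|H}-L$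 takes values in $\mathcal K$ and is bounded, i.e. $\sup\{\|\Omega x-Lx\|_{\mathcal K}:x\in H,\|x\|\le1\}<\infty$. It is singular if it is not trivial on any infinite-dimensional closed subspace of $\mathcal K$. *)

theory Defs
  imports "HOL-Probability.Essential_Supremum" "HOL-Library.Function_Algebras"
begin

text \<open>
  Scalars are a type of sorts \<^class>\<open>real_normed_field\<close> and \<^class>\<open>euclidean_space\<close>: up to
  isomorphism the only such fields are the real and the complex numbers, so every definition
  covers both scalar fields.

  The elements of $L_0$ are represented by measurable functions, and two of them are
  identified when they agree almost everywhere. Sums, differences and products of functions
  are the pointwise ones of \<^theory>\<open>HOL-Library.Function_Algebras\<close>.
\<close>

subsection \<open>Linear spaces of functions\<close>

definition fscale :: "'k::field \<Rightarrow> ('i \<Rightarrow> 'k) \<Rightarrow> 'i \<Rightarrow> 'k"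
  where "fscale c f = (\<lambda>s. c * f s)"

interpretation fun_vs: vector_space "fscale :: 'k::field \<Rightarrow> ('i \<Rightarrow> 'k) \<Rightarrow> 'i \<Rightarrow> 'k"
  by unfold_locales (auto simp: fscale_def fun_eq_iff algebra_simps)

definition seminorm_on :: "('i \<Rightarrow> 'k::real_normed_field) set \<Rightarrow> (('i \<Rightarrow> 'k) \<Rightarrow> real) \<Rightarrow> bool"
  where "seminorm_on V N \<longleftrightarrow> fun_vs.subspace V \<and>
    (\<forall>x\<in>V. 0 \<le> N x) \<and>
    (\<forall>c. \<forall>x\<in>V. N (fscale c x) = norm c * N x) \<and>
    (\<forall>x\<in>V. \<forall>y\<in>V. N (x + y) \<le> N x + N y)"

definition complete_on :: "('i \<Rightarrow> 'k::real_normed_field) set \<Rightarrow> (('i \<Rightarrow> 'k) \<Rightarrow> real) \<Rightarrow> bool"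
  where "complete_on V N \<longleftrightarrow>
    (\<forall>X :: nat \<Rightarrow> 'i \<Rightarrow> 'k. (\<forall>n. X n \<in> V) \<and>
        (\<forall>e>0. \<exists>n0. \<forall>m\<ge>n0. \<forall>n\<ge>n0. N (X m - X n) < e) \<longrightarrow>
      (\<exists>x\<in>V. (\<lambda>n. N (X n - x)) \<longlonglongrightarrow> 0))"

definition banach_on :: "('i \<Rightarrow> 'k::real_normed_field) set \<Rightarrow> (('i \<Rightarrow> 'k) \<Rightarrow> real) \<Rightarrow> bool"
  where "banach_on V N \<longleftrightarrow> seminorm_on V N \<and> (\<forall>x\<in>V. N x = 0 \<longrightarrow> x = 0) \<and> complete_on V N"

text \<open>
  Functionals are set to zero outside \<open>V\<close>, so that a functional on \<open>V\<close> is represented by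
  exactly one function. The dual is again a space of functions, and the construction can be
  iterated.
\<close>

definition dual_space ::
  "('i \<Rightarrow> 'k::real_normed_field) set \<Rightarrow> (('i \<Rightarrow> 'k) \<Rightarrow> real) \<Rightarrow> (('i \<Rightarrow> 'k) \<Rightarrow> 'k) set"
  where "dual_space V N = {\<phi>.
    (\<forall>x\<in>V. \<forall>y\<in>V. \<phi> (x + y) = \<phi> x + \<phi> y) \<and>
    (\<forall>c. \<forall>x\<in>V. \<phi> (fscale c x) = c * \<phi> x) \<and>
    (\<exists>C. \<forall>x\<in>V. norm (\<phi> x) \<le> C * N x) \<and>
    (\<forall>x. x \<notin> V \<longrightarrow> \<phi> x = 0)}"

definition dual_norm ::
  "('i \<Rightarrow> 'k::real_normed_field) set \<Rightarrow> (('i \<Rightarrow> 'k) \<Rightarrow> real) \<Rightarrow> (('i \<Rightarrow> 'k) \<Rightarrow> 'k) \<Rightarrow> real"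
  where "dual_norm V N \<phi> = (SUP x\<in>{x\<in>V. N x \<le> 1}. norm (\<phi> x))"

definition reflexive_on :: "('i \<Rightarrow> 'k::real_normed_field) set \<Rightarrow> (('i \<Rightarrow> 'k) \<Rightarrow> real) \<Rightarrow> bool"
  where "reflexive_on V N \<longleftrightarrow>
    (\<forall>\<Psi>\<in>dual_space (dual_space V N) (dual_norm V N).
      \<exists>x\<in>V. \<forall>\<phi>\<in>dual_space V N. \<Psi> \<phi> = \<phi> x)"

definition l2_space :: "(nat \<Rightarrow> 'k::real_normed_field) set"
  where "l2_space = {a. summable (\<lambda>n. (norm (a n))\<^sup>2)}"

definition l2_norm :: "(nat \<Rightarrow> 'k::real_normed_field) \<Rightarrow> real"
  where "l2_norm a = sqrt (\<Sum>n. (norm (a n))\<^sup>2)"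

subsection \<open>Koethe function spaces\<close>

definition nonatomic :: "'a measure \<Rightarrow> bool"
  where "nonatomic M \<longleftrightarrow> (\<forall>A\<in>sets M. 0 < emeasure M A \<longrightarrow>
    (\<exists>B\<in>sets M. B \<subseteq> A \<and> 0 < emeasure M B \<and> emeasure M B < emeasure M A))"

locale koethe_space = sigma_finite_measure M
  for M :: "'a measure" +
  fixes K :: "('a \<Rightarrow> 'k::{real_normed_field, euclidean_space}) set"
    and N :: "('a \<Rightarrow> 'k) \<Rightarrow> real"
  assumes measurable: "K \<subseteq> borel_measurable M"
    and subspace: "fun_vs.subspace K"
    and N_nonneg: "x \<in> K \<Longrightarrow> 0 \<le> N x"
    and N_eq_0_iff: "x \<in> K \<Longrightarrow> N x = 0 \<longleftrightarrow> (AE s in M. x s = 0)"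
    and N_scale: "x \<in> K \<Longrightarrow> N (fscale c x) = norm c * N x"
    and N_add: "\<exists>\<Delta>. \<forall>x\<in>K. \<forall>y\<in>K. N (x + y) \<le> \<Delta> * (N x + N y)"
    and solid: "f \<in> borel_measurable M \<Longrightarrow> g \<in> K \<Longrightarrow> AE s in M. norm (f s) \<le> norm (g s)
      \<Longrightarrow> f \<in> K \<and> N f \<le> N g"
    and indicator_mem: "A \<in> sets M \<Longrightarrow> emeasure M A < \<infinity> \<Longrightarrow> indicator A \<in> K"

definition Linf_norm :: "'a measure \<Rightarrow> ('a \<Rightarrow> 'k::{real_normed_field, euclidean_space}) \<Rightarrow> ennreal"
  where "Linf_norm M f = esssup M (\<lambda>s. ennreal (norm (f s)))"

definition Linf_space :: "'a measure \<Rightarrow> ('a \<Rightarrow> 'k::{real_normed_field, euclidean_space}) set"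
  where "Linf_space M = {f \<in> borel_measurable M. Linf_norm M f < \<infinity>}"

definition L1_norm :: "'a measure \<Rightarrow> ('a \<Rightarrow> 'k::{real_normed_field, euclidean_space}) \<Rightarrow> ennreal"
  where "L1_norm M f = (\<integral>\<^sup>+ s. ennreal (norm (f s)) \<partial>M)"

definition admissible ::
  "'a measure \<Rightarrow> ('a \<Rightarrow> 'k::{real_normed_field, euclidean_space}) set \<Rightarrow> (('a \<Rightarrow> 'k) \<Rightarrow> real) \<Rightarrow> bool"
  where "admissible M K N \<longleftrightarrow>
    (\<exists>h\<in>borel_measurable M. \<exists>k\<in>borel_measurable M.
      (AE s in M. 0 < (h s :: real)) \<and> (AE s in M. 0 < (k s :: real)) \<and>
      (\<forall>x\<in>K. L1_norm M (\<lambda>s. of_real (h s) * x s) \<le> ennreal (N x) \<and>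
              ennreal (N x) \<le> Linf_norm M (\<lambda>s. of_real (k s) * x s)))"

definition closed_subspace ::
  "('a \<Rightarrow> 'k::real_normed_field) set \<Rightarrow> (('a \<Rightarrow> 'k) \<Rightarrow> real) \<Rightarrow> ('a \<Rightarrow> 'k) set \<Rightarrow> bool"
  where "closed_subspace K N H \<longleftrightarrow> fun_vs.subspace H \<and> H \<subseteq> K \<and>
    (\<forall>X :: nat \<Rightarrow> 'a \<Rightarrow> 'k. \<forall>x\<in>K. (\<forall>n. X n \<in> H) \<and> (\<lambda>n. N (X n - x)) \<longlonglongrightarrow> 0 \<longrightarrow> x \<in> H)"

text \<open>Finite dimension of the space of classes modulo equality almost everywhere.\<close>

definition finite_dim_ae :: "'a measure \<Rightarrow> ('a \<Rightarrow> 'k::real_normed_field) set \<Rightarrow> bool"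
  where "finite_dim_ae M H \<longleftrightarrow>
    (\<exists>B. finite B \<and> B \<subseteq> H \<and> (\<forall>x\<in>H. \<exists>y\<in>fun_vs.span B. AE s in M. x s = y s))"

text \<open>Maps from \<open>V\<close> to $L_0$ that are linear after identifying functions equal almost everywhere.\<close>

definition linear_to_L0 ::
  "'a measure \<Rightarrow> ('i \<Rightarrow> 'k) set \<Rightarrow> (('i \<Rightarrow> 'k) \<Rightarrow> 'a \<Rightarrow> 'k::{real_normed_field, euclidean_space}) \<Rightarrow> bool"
  where "linear_to_L0 M V T \<longleftrightarrow>
    (\<forall>x\<in>V. T x \<in> borel_measurable M) \<and>
    (\<forall>x\<in>V. \<forall>y\<in>V. AE s in M. T (x + y) s = T x s + T y s) \<and>
    (\<forall>c. \<forall>x\<in>V. AE s in M. T (fscale c x) s = c * T x s)"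

definition respects_ae ::
  "'a measure \<Rightarrow> ('a \<Rightarrow> 'k) set \<Rightarrow> (('a \<Rightarrow> 'k) \<Rightarrow> 'a \<Rightarrow> 'k) \<Rightarrow> bool"
  where "respects_ae M V T \<longleftrightarrow>
    (\<forall>x\<in>V. \<forall>y\<in>V. (AE s in M. x s = y s) \<longrightarrow> (AE s in M. T x s = T y s))"

text \<open>Linear homeomorphism of a normed space \<open>(V, P)\<close> onto a subspace \<open>H\<close> of \<open>(K, N)\<close>.\<close>

definition isomorphic_onto ::
  "'a measure \<Rightarrow> ('i \<Rightarrow> 'k) set \<Rightarrow> (('i \<Rightarrow> 'k) \<Rightarrow> real)
    \<Rightarrow> ('a \<Rightarrow> 'k::{real_normed_field, euclidean_space}) set \<Rightarrow> (('a \<Rightarrow> 'k) \<Rightarrow> real) \<Rightarrow> bool"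
  where "isomorphic_onto M V P H N \<longleftrightarrow>
    (\<exists>T. linear_to_L0 M V T \<and> T ` V \<subseteq> H \<and>
      (\<forall>y\<in>H. \<exists>x\<in>V. AE s in M. T x s = y s) \<and>
      (\<exists>c>0. \<exists>C. \<forall>x\<in>V. c * P x \<le> N (T x) \<and> N (T x) \<le> C * P x))"

subsection \<open>Superreflexivity\<close>

text \<open>
  \<open>(W, P)\<close> is finitely representable in \<open>(K, N)\<close>: every finite-dimensional subspace of \<open>W\<close> has,
  for each \<open>\<epsilon>\<close>, a \<open>(1 + \<epsilon>)\<close>-isomorphic copy in \<open>K\<close>.
\<close>

definition finitely_representable ::
  "'a measure \<Rightarrow> ('i \<Rightarrow> 'k) set \<Rightarrow> (('i \<Rightarrow> 'k) \<Rightarrow> real)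
    \<Rightarrow> ('a \<Rightarrow> 'k::{real_normed_field, euclidean_space}) set \<Rightarrow> (('a \<Rightarrow> 'k) \<Rightarrow> real) \<Rightarrow> bool"
  where "finitely_representable M W P K N \<longleftrightarrow>
    (\<forall>B \<epsilon>. finite B \<and> B \<subseteq> W \<and> \<epsilon> > 0 \<longrightarrow>
      (\<exists>T. linear_to_L0 M (fun_vs.span B) T \<and> T ` fun_vs.span B \<subseteq> K \<and>
        (\<forall>x\<in>fun_vs.span B. P x \<le> N (T x) \<and> N (T x) \<le> (1 + \<epsilon>) * P x)))"

text \<open>
  James' definition: every Banach space finitely representable in the given one is reflexive.
  The test spaces \<open>(W, P)\<close> are the Banach spaces whose vectors are scalar sequences, with the
  coordinatewise operations and an arbitrary complete norm. Every separable Banach space has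
  such a form (via a norming sequence of functionals), and a Banach space all of whose separable
  closed subspaces are reflexive is itself reflexive, so no generality is lost; moreover, a space
  that is superreflexive with respect to all Banach spaces trivially satisfies the condition below.

  A quasi-normed space is called superreflexive if its quasi-norm is equivalent to a complete
  norm \<open>N'\<close> with this property; \<open>N'\<close> may be \<open>N\<close> itself if \<open>N\<close> is a norm. As a function
  on representatives, \<open>N'\<close> is a seminorm that vanishes exactly where \<open>N\<close> does.
\<close>

definition superreflexive ::
  "'a measure \<Rightarrow> ('a \<Rightarrow> 'k::{real_normed_field, euclidean_space}) set \<Rightarrow> (('a \<Rightarrow> 'k) \<Rightarrow> real) \<Rightarrow> bool"
  where "superreflexive M K N \<longleftrightarrow>
    (\<exists>N'. seminorm_on K N' \<and> complete_on K N' \<and>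
      (\<exists>c>0. \<exists>C. \<forall>x\<in>K. c * N x \<le> N' x \<and> N' x \<le> C * N x) \<and>
      (\<forall>(W :: (nat \<Rightarrow> 'k) set) P.
        banach_on W P \<and> finitely_representable M W P K N' \<longrightarrow> reflexive_on W P))"

subsection \<open>Centralizers\<close>

definition centralizer ::
  "'a measure \<Rightarrow> ('a \<Rightarrow> 'k::{real_normed_field, euclidean_space}) set \<Rightarrow> (('a \<Rightarrow> 'k) \<Rightarrow> real)
    \<Rightarrow> (('a \<Rightarrow> 'k) \<Rightarrow> 'a \<Rightarrow> 'k) \<Rightarrow> bool"
  where "centralizer M K N \<Omega> \<longleftrightarrow>
    (\<forall>x\<in>K. \<Omega> x \<in> borel_measurable M) \<and>
    respects_ae M K \<Omega> \<and>
    (\<forall>c. \<forall>x\<in>K. AE s in M. \<Omega> (fscale c x) s = c * \<Omega> x s) \<and>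
    (\<exists>C. \<forall>f\<in>Linf_space M. \<forall>x\<in>K.
      \<Omega> (f * x) - f * \<Omega> x \<in> K \<and>
      N (\<Omega> (f * x) - f * \<Omega> x) \<le> C * enn2real (Linf_norm M f) * N x)"

definition trivial_on ::
  "'a measure \<Rightarrow> ('a \<Rightarrow> 'k::{real_normed_field, euclidean_space}) set \<Rightarrow> (('a \<Rightarrow> 'k) \<Rightarrow> real)
    \<Rightarrow> (('a \<Rightarrow> 'k) \<Rightarrow> 'a \<Rightarrow> 'k) \<Rightarrow> ('a \<Rightarrow> 'k) set \<Rightarrow> bool"
  where "trivial_on M K N \<Omega> H \<longleftrightarrow>
    (\<exists>L. linear_to_L0 M H L \<and> respects_ae M H L \<and>
      (\<forall>x\<in>H. \<Omega> x - L x \<in> K) \<and>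
      bdd_above ((\<lambda>x. N (\<Omega> x - L x)) ` {x\<in>H. N x \<le> 1}))"

definition singular ::
  "'a measure \<Rightarrow> ('a \<Rightarrow> 'k::{real_normed_field, euclidean_space}) set \<Rightarrow> (('a \<Rightarrow> 'k) \<Rightarrow> real)
    \<Rightarrow> (('a \<Rightarrow> 'k) \<Rightarrow> 'a \<Rightarrow> 'k) \<Rightarrow> bool"
  where "singular M K N \<Omega> \<longleftrightarrow>
    (\<forall>H. closed_subspace K N H \<and> \<not> finite_dim_ae M H \<longrightarrow> \<not> trivial_on M K N \<Omega> H)"

definition bounded_on ::
  "('a \<Rightarrow> 'k::real_normed_field) set \<Rightarrow> (('a \<Rightarrow> 'k) \<Rightarrow> real)
    \<Rightarrow> (('a \<Rightarrow> 'k) \<Rightarrow> 'a \<Rightarrow> 'k) \<Rightarrow> ('a \<Rightarrow> 'k) set \<Rightarrow> bool"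
  where "bounded_on K N \<Omega> H \<longleftrightarrow> (\<exists>C. \<forall>x\<in>H. \<Omega> x \<in> K \<and> N (\<Omega> x) \<le> C * N x)"

end

theory Submission
  imports Defs
begin

text \<open>
  The copy of $\ell_2$ is spanned by the Rademacher functions on a carefully chosen set of positive
  measure. They are bounded, but their square-summable combinations need not be, and the point is to
  control \<open>\<Omega>\<close> on functions that are merely exponentially integrable.

  Superreflexivity enters through a single consequence: $d^j$ disjoint functions of norm at least
  $t$ have a sum of norm at least $c_0 2^j t$. Otherwise there are arbitrarily many vectors
  of norm at least one whose combinations with coefficients bounded by one hardly exceed one, and
  James' distortion argument makes $c_0$, which is not reflexive, finitely representable (\<open>not_outgrows_imp_c0_finitely_representable\<close>,
  \<open>superreflexive_imp_lower_estimate\<close>). The lower estimate gives two things: norm-bounded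
  increasing truncations converge (\<open>fatou\<close>), and disjoint families of large functions are
  small.

  The second point permits exhaustion arguments. A set is called bad if it violates a desired
  estimate; a maximal disjoint family of bad sets is finite and has little measure, and what is
  left contains no bad set (\<open>avoid_bad_subsets\<close>). In this way one finds a set of positive measure
  on whose subsets \<open>E\<close> the norm of the indicator decays like a power of the measure
  (\<open>indicator_norm_decay\<close>) and the norm of \<open>\<Omega>\<close> at the indicator, restricted to \<open>E\<close>, like a power of
  the norm of the indicator (\<open>Omega_indicator_decay\<close>). For the latter, one starts from a set where
  \<open>\<Omega>\<close> at a fixed indicator is bounded. The centralizer inequality bounds \<open>\<Omega>\<close> at the indicator of a
  union \<open>U\<close>, and it controls the differences between that function and \<open>\<Omega>\<close> at the indicators of
  the pieces of \<open>U\<close> by the norm of the indicator of \<open>U\<close>. Many disjoint pieces with too large a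
  value would force the value at \<open>U\<close> to be large as well (\<open>few_disjoint_large_sets\<close>).

  A function on this set whose tails decay exponentially is then cut into layers of nearly
  constant modulus, and both its norm and the norm of its image under \<open>\<Omega>\<close> are bounded by
  convergent series (\<open>Omega_layers\<close>, \<open>thin_tails_bounded\<close>). Square-summable Rademacher sums have such
  tails, uniformly (\<open>rad_sum_tail\<close>). Hence their norms are at most a multiple of the
  $\ell_2$ norm of the coefficients; admissibility and Khinchin's inequality give the converse
  estimate. So \<open>\<Omega>\<close> is bounded on the closed span, which is isomorphic to $\ell_2$; in particular
  \<open>\<Omega>\<close> is trivial there, with the linear map \<open>0\<close>.
\<close>

section \<open>The space of null sequences\<close>

lemma sum_fun_apply: "(\<Sum>i\<in>I. f i) s = (\<Sum>i\<in>I. f i s)"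
  for f :: "'b \<Rightarrow> 'i \<Rightarrow> 'k::comm_monoid_add"
  by (induction I rule: infinite_finite_induct) auto

lemma fscale_apply [simp]: "fscale c f s = c * f s"
  by (simp add: fscale_def)

lemma seminorm_onD:
  assumes "seminorm_on V P"
  shows "fun_vs.subspace V" "x \<in> V \<Longrightarrow> 0 \<le> P x" "x \<in> V \<Longrightarrow> P (fscale c x) = norm c * P x"
    "x \<in> V \<Longrightarrow> y \<in> V \<Longrightarrow> P (x + y) \<le> P x + P y"
  using assms unfolding seminorm_on_def by blast+

lemma dual_spaceI:
  assumes "\<And>x y. x \<in> V \<Longrightarrow> y \<in> V \<Longrightarrow> \<phi> (x + y) = \<phi> x + \<phi> y"
    and "\<And>c x. x \<in> V \<Longrightarrow> \<phi> (fscale c x) = c * \<phi> x"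
    and "\<And>x. x \<in> V \<Longrightarrow> norm (\<phi> x) \<le> C * P x" and "\<And>x. x \<notin> V \<Longrightarrow> \<phi> x = 0"
  shows "\<phi> \<in> dual_space V P"
  unfolding dual_space_def mem_Collect_eq
proof (intro conjI)
  show "\<exists>C. \<forall>x\<in>V. norm (\<phi> x) \<le> C * P x" using assms(3) by (intro exI[of _ C]) simp
qed (use assms in simp_all)

lemma dual_spaceD:
  assumes "\<phi> \<in> dual_space V P"
  shows "x \<in> V \<Longrightarrow> y \<in> V \<Longrightarrow> \<phi> (x + y) = \<phi> x + \<phi> y" "x \<in> V \<Longrightarrow> \<phi> (fscale c x) = c * \<phi> x"
    "x \<notin> V \<Longrightarrow> \<phi> x = 0"
  using assms by (simp_all add: dual_space_def)

lemma dual_space_bound: "\<phi> \<in> dual_space V P \<Longrightarrow> \<exists>C. \<forall>x\<in>V. norm (\<phi> x) \<le> C * P x"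
  by (simp add: dual_space_def)

definition c0_space :: "(nat \<Rightarrow> 'k::real_normed_field) set"
  where "c0_space = {a. a \<longlonglongrightarrow> 0}"

definition sup_norm :: "(nat \<Rightarrow> 'k::real_normed_field) \<Rightarrow> real"
  where "sup_norm a = (SUP n. norm (a n))"

lemma norm_le_sup_norm:
  assumes "a \<in> c0_space" shows "norm (a n) \<le> sup_norm a"
proof -
  have "Bseq a"
    using assms convergent_imp_Bseq convergentI unfolding c0_space_def by blast
  then obtain B where "\<And>n. norm (a n) \<le> B"
    unfolding Bseq_def by blast
  then show ?thesis
    unfolding sup_norm_def by (intro cSUP_upper) (auto intro!: bdd_aboveI)
qed

lemma sup_norm_le: "(\<And>n. norm (a n) \<le> B) \<Longrightarrow> sup_norm a \<le> B"
  unfolding sup_norm_def by (intro cSUP_least) auto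

lemma sup_norm_nonneg: "a \<in> c0_space \<Longrightarrow> 0 \<le> sup_norm a"
  using norm_le_sup_norm[of a 0] norm_ge_zero order_trans by blast

lemma subspace_c0: "fun_vs.subspace (c0_space :: (nat \<Rightarrow> 'k::real_normed_field) set)"
  unfolding fun_vs.subspace_def
proof (intro conjI allI ballI)
  show "(0 :: nat \<Rightarrow> 'k) \<in> c0_space"
    unfolding c0_space_def zero_fun_def by simp
next
  fix x y :: "nat \<Rightarrow> 'k" assume "x \<in> c0_space" "y \<in> c0_space"
  then show "x + y \<in> c0_space"
    unfolding c0_space_def plus_fun_def using tendsto_add[of x 0 _ y 0] by simp
next
  fix c and x :: "nat \<Rightarrow> 'k" assume "x \<in> c0_space"
  then show "fscale c x \<in> c0_space"
    unfolding c0_space_def fscale_def using tendsto_mult[OF tendsto_const, of x 0 _ c] by simp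
qed

lemma sup_norm_add:
  assumes "x \<in> c0_space" "y \<in> c0_space"
  shows "sup_norm (x + y) \<le> sup_norm x + sup_norm y"
proof (rule sup_norm_le)
  fix n
  have "norm ((x + y) n) \<le> norm (x n) + norm (y n)"
    by (simp add: norm_triangle_ineq)
  also have "\<dots> \<le> sup_norm x + sup_norm y"
    by (intro add_mono norm_le_sup_norm assms)
  finally show "norm ((x + y) n) \<le> sup_norm x + sup_norm y" .
qed

lemma sup_norm_scale:
  assumes x: "x \<in> c0_space" shows "sup_norm (fscale c x) = norm c * sup_norm x"
proof (rule antisym)
  show "sup_norm (fscale c x) \<le> norm c * sup_norm x"
    by (rule sup_norm_le) (simp add: norm_mult mult_left_mono norm_le_sup_norm[OF x])
  have m: "fscale c x \<in> c0_space"
    using x subspace_c0 fun_vs.subspace_scale by blast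
  show "norm c * sup_norm x \<le> sup_norm (fscale c x)"
  proof (cases "c = 0")
    case True
    then show ?thesis using sup_norm_nonneg[OF m] by simp
  next
    case False
    have "sup_norm x \<le> sup_norm (fscale c x) / norm c"
    proof (rule sup_norm_le)
      fix n
      show "norm (x n) \<le> sup_norm (fscale c x) / norm c"
        using norm_le_sup_norm[OF m, of n] False
        by (simp add: norm_mult field_simps)
    qed
    then show ?thesis using False by (simp add: field_simps)
  qed
qed

lemma complete_c0:
  "complete_on (c0_space :: (nat \<Rightarrow> 'k::{real_normed_field, euclidean_space}) set) sup_norm"
  unfolding complete_on_def
proof (intro allI impI, elim conjE)
  fix X :: "nat \<Rightarrow> nat \<Rightarrow> 'k"
  assume X: "\<forall>n. X n \<in> c0_space"
    and C: "\<forall>e>0. \<exists>n0. \<forall>m\<ge>n0. \<forall>n\<ge>n0. sup_norm (X m - X n) < e"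
  have D: "X m - X n \<in> c0_space" for m n
    using X subspace_c0 fun_vs.subspace_diff by blast
  have P: "norm (X m i - X n i) \<le> sup_norm (X m - X n)" for m n i
    using norm_le_sup_norm[OF D, of m n i] by simp
  have "Cauchy (\<lambda>m. X m i)" for i
    unfolding Cauchy_iff
  proof (intro allI impI)
    fix e :: real assume "e > 0"
    then obtain n0 where n0: "\<forall>m\<ge>n0. \<forall>n\<ge>n0. sup_norm (X m - X n) < e" using C by blast
    have "norm (X m i - X n i) < e" if "m \<ge> n0" "n \<ge> n0" for m n
      using P[of m i n] n0[rule_format, OF that] by linarith
    then show "\<exists>M. \<forall>m\<ge>M. \<forall>n\<ge>M. norm (X m i - X n i) < e" by blast
  qed
  then have "\<forall>i. \<exists>l. (\<lambda>m. X m i) \<longlonglongrightarrow> l"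
    by (simp add: Cauchy_convergent convergentD)
  then obtain x where x: "\<And>i. (\<lambda>m. X m i) \<longlonglongrightarrow> x i"
    by metis
  have unif: "\<exists>n0. \<forall>m\<ge>n0. \<forall>i. norm (X m i - x i) \<le> e" if e: "e > 0" for e
  proof -
    obtain n0 where n0: "\<And>m n. m \<ge> n0 \<Longrightarrow> n \<ge> n0 \<Longrightarrow> sup_norm (X m - X n) < e"
      using C e by blast
    have "norm (X m i - x i) \<le> e" if "m \<ge> n0" for m i
    proof (rule tendsto_upperbound)
      show "(\<lambda>n. norm (X m i - X n i)) \<longlonglongrightarrow> norm (X m i - x i)"
        by (intro tendsto_intros x)
      show "\<forall>\<^sub>F n in sequentially. norm (X m i - X n i) \<le> e"
        unfolding eventually_sequentially
      proof (intro exI allI impI)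
        fix n assume "n0 \<le> n"
        then show "norm (X m i - X n i) \<le> e" using n0[OF that, of n] P[of m i n] by linarith
      qed
    qed simp
    then show ?thesis by blast
  qed
  have "x \<longlonglongrightarrow> 0"
  proof (rule LIMSEQ_I)
    fix r :: real assume r: "0 < r"
    obtain m where m: "\<And>i. norm (X m i - x i) \<le> r / 2"
      using unif[of "r/2"] r by auto
    have "X m \<longlonglongrightarrow> 0" using X unfolding c0_space_def by auto
    then obtain n0 where n0: "\<And>n. n \<ge> n0 \<Longrightarrow> norm (X m n) < r / 2"
      using LIMSEQ_D[of "X m" 0 "r/2"] r by auto
    have "norm (x n - 0) < r" if "n \<ge> n0" for n
    proof -
      have "norm (x n) \<le> norm (X m n) + norm (X m n - x n)"
        by (metis add_diff_cancel_left' diff_add_cancel norm_minus_commute norm_triangle_sub)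
      then show ?thesis using m[of n] n0[OF that] by simp
    qed
    then show "\<exists>no. \<forall>n\<ge>no. norm (x n - 0) < r" by blast
  qed
  then have xc: "x \<in> c0_space" by (simp add: c0_space_def)
  have "(\<lambda>n. sup_norm (X n - x)) \<longlonglongrightarrow> 0"
  proof (rule LIMSEQ_I)
    fix r :: real assume r: "0 < r"
    obtain n0 where n0: "\<And>m i. m \<ge> n0 \<Longrightarrow> norm (X m i - x i) \<le> r / 2"
      using unif[of "r/2"] r by auto
    have "norm (sup_norm (X n - x) - 0) < r" if "n \<ge> n0" for n
    proof -
      have "X n - x \<in> c0_space"
        using X xc subspace_c0 fun_vs.subspace_diff by blast
      moreover have "sup_norm (X n - x) \<le> r/2"
        using n0[OF that] by (intro sup_norm_le) simp
      ultimately show ?thesis using sup_norm_nonneg[of "X n - x"] r by simp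
    qed
    then show "\<exists>no. \<forall>n\<ge>no. norm (sup_norm (X n - x) - 0) < r" by blast
  qed
  with xc show "\<exists>x\<in>c0_space. (\<lambda>n. sup_norm (X n - x)) \<longlonglongrightarrow> 0" by blast
qed

lemma banach_c0:
  "banach_on (c0_space :: (nat \<Rightarrow> 'k::{real_normed_field, euclidean_space}) set) sup_norm"
  unfolding banach_on_def seminorm_on_def
proof (intro conjI ballI allI impI)
  fix x :: "nat \<Rightarrow> 'k" assume x: "x \<in> c0_space" "sup_norm x = 0"
  show "x = 0"
  proof
    fix n show "x n = 0 n" using norm_le_sup_norm[OF x(1), of n] x(2) by simp
  qed
qed (auto simp: subspace_c0 sup_norm_nonneg sup_norm_scale sup_norm_add complete_c0)

text \<open>
  The functional that adds up the values on the unit vectors belongs to the bidual, and a vector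
  representing it would have all its coordinates equal to \<open>1\<close>.
\<close>

lemma c0_not_reflexive:
  "\<not> reflexive_on (c0_space :: (nat \<Rightarrow> 'k::{real_normed_field, euclidean_space}) set) sup_norm"
proof
  assume refl: "reflexive_on (c0_space :: (nat \<Rightarrow> 'k) set) sup_norm"
  define V where "V = (c0_space :: (nat \<Rightarrow> 'k) set)"
  define D where "D = dual_space V sup_norm"
  define u :: "nat \<Rightarrow> nat \<Rightarrow> 'k" where "u i = (\<lambda>n. if n = i then 1 else 0)" for i
  have V: "fun_vs.subspace V" unfolding V_def by (rule subspace_c0)
  have uV: "u i \<in> V" for i
  proof -
    have "\<forall>\<^sub>F n in sequentially. u i n = 0"
      unfolding eventually_sequentially u_def by (intro exI[of _ "Suc i"]) auto
    then show ?thesis unfolding V_def c0_space_def by (auto intro: tendsto_eventually)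
  qed
  have bdd: "bdd_above ((\<lambda>x. norm (\<phi> x)) ` {x\<in>V. sup_norm x \<le> 1})" if \<phi>: "\<phi> \<in> D" for \<phi> :: "(nat \<Rightarrow> 'k) \<Rightarrow> 'k"
  proof -
    obtain C where "\<forall>x\<in>V. norm (\<phi> x) \<le> C * sup_norm x"
      using dual_space_bound[OF \<phi>[unfolded D_def]] ..
    then have C: "norm (\<phi> x) \<le> C * sup_norm x" if "x \<in> V" for x using that ..
    have "norm (\<phi> x) \<le> \<bar>C\<bar>" if "x \<in> V" "sup_norm x \<le> 1" for x
    proof -
      have "norm (\<phi> x) \<le> \<bar>C\<bar> * sup_norm x"
        using C[OF that(1)] mult_right_mono[OF abs_ge_self[of C] sup_norm_nonneg[of x]] that(1)
        by (simp add: V_def)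
      also have "\<dots> \<le> \<bar>C\<bar>" using that(2) by (simp add: mult_left_le)
      finally show ?thesis .
    qed
    then show ?thesis by (intro bdd_aboveI) auto
  qed
  have D_add: "\<phi> (x + y) = \<phi> x + \<phi> y" if "\<phi> \<in> D" "x \<in> V" "y \<in> V" for \<phi> x y
    using that dual_spaceD(1) unfolding D_def by blast
  have D_scale: "\<phi> (fscale c x) = c * \<phi> x" if "\<phi> \<in> D" "x \<in> V" for \<phi> c x
    using that dual_spaceD(2) unfolding D_def by blast
  have lin: "\<phi> (\<Sum>i<m. fscale (a i) (u i)) = (\<Sum>i<m. a i * \<phi> (u i))" if "\<phi> \<in> D" for \<phi> a m
  proof (induction m)
    case 0
    have "\<phi> (fscale 0 (u 0)) = 0 * \<phi> (u 0)"
      using D_scale[OF that uV] .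
    moreover have "fscale 0 (u 0) = (0 :: nat \<Rightarrow> 'k)" by auto
    ultimately have "\<phi> 0 = 0" by (metis mult_zero_left)
    then show ?case by (simp only: lessThan_0 sum.empty)
  next
    case (Suc m)
    have "(\<Sum>i<m. fscale (a i) (u i)) \<in> V" "fscale (a m) (u m) \<in> V"
      using uV by (auto intro!: fun_vs.subspace_sum fun_vs.subspace_scale V)
    then have "\<phi> ((\<Sum>i<m. fscale (a i) (u i)) + fscale (a m) (u m))
        = \<phi> (\<Sum>i<m. fscale (a i) (u i)) + a m * \<phi> (u m)"
      using D_add[OF that] D_scale[OF that uV] by metis
    then show ?case by (simp only: sum.lessThan_Suc Suc)
  qed
  have abssum: "(\<Sum>i<m. norm (\<phi> (u i))) \<le> dual_norm V sup_norm \<phi>" if \<phi>: "\<phi> \<in> D" for \<phi> m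
  proof -
    define a where "a i = of_real (norm (\<phi> (u i))) / \<phi> (u i)" for i
    define x where "x = (\<Sum>i<m. fscale (a i) (u i))"
    have xV: "x \<in> V" unfolding x_def
      using uV by (auto intro!: fun_vs.subspace_sum fun_vs.subspace_scale V)
    have na: "norm (a i) \<le> 1" for i unfolding a_def by (simp add: norm_divide)
    have "x n = (if n < m then a n else 0)" for n
      unfolding x_def sum_fun_apply u_def by (simp add: if_distrib cong: if_cong)
    then have "sup_norm x \<le> 1" by (intro sup_norm_le) (simp add: na)
    then have "norm (\<phi> x) \<le> dual_norm V sup_norm \<phi>"
      unfolding dual_norm_def using xV by (intro cSUP_upper bdd \<phi>) auto
    moreover have "\<phi> x = (\<Sum>i<m. of_real (norm (\<phi> (u i))))"
      unfolding x_def lin[OF \<phi>] by (rule sum.cong) (auto simp: a_def)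
    then have "\<phi> x = of_real (\<Sum>i<m. norm (\<phi> (u i)))" by simp
    then have "norm (\<phi> x) = (\<Sum>i<m. norm (\<phi> (u i)))"
      by (simp only: norm_of_real) (simp add: sum_nonneg)
    ultimately show ?thesis by simp
  qed
  have summ: "summable (\<lambda>i. norm (\<phi> (u i)))" if "\<phi> \<in> D" for \<phi>
  proof (rule bounded_imp_summable)
    show "(\<Sum>i\<le>n. norm (\<phi> (u i))) \<le> dual_norm V sup_norm \<phi>" for n
      using abssum[OF that, of "Suc n"] by (simp only: lessThan_Suc_atMost)
  qed simp
  have summ': "summable (\<lambda>i. \<phi> (u i))" if "\<phi> \<in> D" for \<phi>
    by (rule summable_norm_cancel[OF summ[OF that]])
  note DD = dual_spaceD[where V = V and P = sup_norm, folded D_def]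
  have Dadd: "\<phi> + \<psi> \<in> D" if \<phi>\<psi>: "\<phi> \<in> D" "\<psi> \<in> D" for \<phi> \<psi>
  proof -
    obtain C1 where "\<forall>x\<in>V. norm (\<phi> x) \<le> C1 * sup_norm x"
      using dual_space_bound[OF \<phi>\<psi>(1)[unfolded D_def]] ..
    then have C1: "norm (\<phi> x) \<le> C1 * sup_norm x" if "x \<in> V" for x using that ..
    obtain C2 where "\<forall>x\<in>V. norm (\<psi> x) \<le> C2 * sup_norm x"
      using dual_space_bound[OF \<phi>\<psi>(2)[unfolded D_def]] ..
    then have C2: "norm (\<psi> x) \<le> C2 * sup_norm x" if "x \<in> V" for x using that ..
    show ?thesis unfolding D_def
    proof (rule dual_spaceI)
      show "norm ((\<phi> + \<psi>) x) \<le> (C1 + C2) * sup_norm x" if "x \<in> V" for x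
        using norm_triangle_le[OF add_mono[OF C1[OF that] C2[OF that]]] by (simp add: distrib_right)
    qed (simp_all add: DD[OF \<phi>\<psi>(1)] DD[OF \<phi>\<psi>(2)] distrib_left)
  qed
  have Dscale: "fscale c \<phi> \<in> D" if \<phi>: "\<phi> \<in> D" for c \<phi>
  proof -
    obtain C where "\<forall>x\<in>V. norm (\<phi> x) \<le> C * sup_norm x"
      using dual_space_bound[OF \<phi>[unfolded D_def]] ..
    then have C: "norm (\<phi> x) \<le> C * sup_norm x" if "x \<in> V" for x using that ..
    show ?thesis unfolding D_def
    proof (rule dual_spaceI)
      show "norm (fscale c \<phi> x) \<le> (norm c * C) * sup_norm x" if "x \<in> V" for x
        using C[OF that] by (simp add: norm_mult mult_left_mono mult.assoc)
    qed (simp_all add: DD[OF \<phi>] distrib_left)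
  qed
  define \<Psi> :: "((nat \<Rightarrow> 'k) \<Rightarrow> 'k) \<Rightarrow> 'k"
    where "\<Psi> \<phi> = (if \<phi> \<in> D then \<Sum>i. \<phi> (u i) else 0)" for \<phi>
  have "\<Psi> \<in> dual_space D (dual_norm V sup_norm)"
  proof (rule dual_spaceI)
    fix \<phi> \<psi> assume *: "\<phi> \<in> D" "\<psi> \<in> D"
    show "\<Psi> (\<phi> + \<psi>) = \<Psi> \<phi> + \<Psi> \<psi>"
      using suminf_add[OF summ'[OF *(1)] summ'[OF *(2)]] by (simp add: \<Psi>_def * Dadd[OF *])
  next
    fix c \<phi> assume *: "\<phi> \<in> D"
    show "\<Psi> (fscale c \<phi>) = c * \<Psi> \<phi>"
      using suminf_mult[OF summ'[OF *]] by (simp add: \<Psi>_def * Dscale[OF *])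
  next
    fix \<phi> assume \<phi>: "\<phi> \<in> D"
    have "norm (\<Psi> \<phi>) \<le> (\<Sum>i. norm (\<phi> (u i)))"
      using summable_norm[OF summ[OF \<phi>]] by (simp add: \<Psi>_def \<phi>)
    also have "\<dots> \<le> dual_norm V sup_norm \<phi>"
      by (rule suminf_le_const[OF summ[OF \<phi>] abssum[OF \<phi>]])
    finally show "norm (\<Psi> \<phi>) \<le> 1 * dual_norm V sup_norm \<phi>" by simp
  next
    fix \<phi> assume "\<phi> \<notin> D"
    then show "\<Psi> \<phi> = 0" unfolding \<Psi>_def by (rule if_not_P)
  qed
  with refl obtain x where xV: "x \<in> V" and x: "\<And>\<phi>. \<phi> \<in> D \<Longrightarrow> \<Psi> \<phi> = \<phi> x"
    unfolding reflexive_on_def V_def D_def by blast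
  have "x n = 1" for n
  proof -
    define \<phi> :: "(nat \<Rightarrow> 'k) \<Rightarrow> 'k" where "\<phi> y = (if y \<in> V then y n else 0)" for y
    have "\<phi> \<in> D" unfolding D_def
    proof (rule dual_spaceI)
      show "norm (\<phi> y) \<le> 1 * sup_norm y" if "y \<in> V" for y
        using norm_le_sup_norm[of y n] that by (simp add: \<phi>_def V_def)
    qed (use V in \<open>auto simp: \<phi>_def fun_vs.subspace_add fun_vs.subspace_scale\<close>)
    moreover have "\<phi> (u i) = (if i = n then 1 else 0)" for i
      using uV by (simp add: \<phi>_def u_def)
    then have "(\<Sum>i. \<phi> (u i)) = 1"
      using sums_single[of n "\<lambda>_. 1::'k"] by (simp add: sums_iff cong: if_cong)
    ultimately show ?thesis using x[of \<phi>] xV by (simp add: \<Psi>_def \<phi>_def)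
  qed
  then have "x = (\<lambda>n. 1)" by blast
  then have "(\<lambda>n::nat. 1::'k) \<longlonglongrightarrow> 0" using xV by (simp add: V_def c0_space_def)
  then have "(1::'k) = 0" using LIMSEQ_unique[OF tendsto_const] by blast
  then show False by simp
qed

text \<open>
  Gaussian elimination: on a finite-dimensional space of sequences all coordinates are controlled
  by finitely many of them.
\<close>

lemma finitely_many_coordinates_control:
  fixes b :: "nat \<Rightarrow> nat \<Rightarrow> 'k::real_normed_field"
  shows "\<exists>D\<ge>0. \<exists>m. \<forall>c Q. (\<forall>l<m. norm (\<Sum>j<n. c j * b j l) \<le> Q) \<longrightarrow>
    (\<forall>i. norm (\<Sum>j<n. c j * b j i) \<le> D * (\<Sum>j<n. norm (b j i)) * Q)"
proof (induction n arbitrary: b)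
  case 0
  show ?case by (rule exI[of _ 0]) auto
next
  case (Suc n)
  show ?case
  proof (cases "\<forall>i. b n i = 0")
    case True
    then show ?thesis using Suc[of b] by simp
  next
    case False
    then obtain p where p: "b n p \<noteq> 0" by blast
    define r where "r j = b j p / b n p" for j
    define b' where "b' j i = b j i - r j * b n i" for j i
    obtain D m where D: "D \<ge> 0" and m: "\<And>c Q i. (\<And>l. l < m \<Longrightarrow> norm (\<Sum>j<n. c j * b' j l) \<le> Q) \<Longrightarrow>
      norm (\<Sum>j<n. c j * b' j i) \<le> D * (\<Sum>j<n. norm (b' j i)) * Q"
      using Suc[of b'] by metis
    define m' where "m' = max m (Suc p)"
    define R where "R = (\<Sum>j<n. norm (r j))"
    define S where "S = (\<Sum>l<m. norm (b n l)) / norm (b n p)"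
    have arith: "Q / \<beta> * a + D * ((1 + R) * a) * ((1 + S) * Q)
        = (D * (1 + R) * (1 + S) + 1 / \<beta>) * a * Q" for Q a \<beta> :: real
      by (simp add: ring_distribs mult_ac)
    define D' where "D' = D * (1 + R) * (1 + S) + 1 / norm (b n p)"
    have RS: "R \<ge> 0" "S \<ge> 0" by (auto simp: R_def S_def sum_nonneg)
    have main: "norm (\<Sum>j<Suc n. c j * b j i) \<le> D' * (\<Sum>j<Suc n. norm (b j i)) * Q"
      if Q: "\<And>l. l < m' \<Longrightarrow> norm (\<Sum>j<Suc n. c j * b j l) \<le> Q" for c Q i
    proof -
      define x where "x l = (\<Sum>j<Suc n. c j * b j l)" for l
      define t where "t = x p / b n p"
      have xt: "x l = t * b n l + (\<Sum>j<n. c j * b' j l)" for l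
      proof -
        have "t = c n + (\<Sum>j<n. c j * r j)"
          using p by (simp add: t_def x_def r_def add_divide_distrib sum_divide_distrib)
        then show ?thesis
          by (simp add: x_def b'_def algebra_simps sum_subtractf sum_distrib_left)
      qed
      have Q0: "norm (x p) \<le> Q" using Q[of p] by (simp add: x_def m'_def)
      then have Qn: "0 \<le> Q" using norm_ge_zero order_trans by blast
      have t: "norm t \<le> Q / norm (b n p)"
        unfolding t_def using Q0 by (simp add: norm_divide divide_right_mono)
      have "norm (\<Sum>j<n. c j * b' j l) \<le> (1 + S) * Q" if l: "l < m" for l
      proof -
        have "(\<Sum>j<n. c j * b' j l) = x l - t * b n l" using xt[of l] by simp
        then have "norm (\<Sum>j<n. c j * b' j l) \<le> norm (x l) + norm t * norm (b n l)"
          by (metis norm_mult norm_triangle_ineq4)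
        also have "\<dots> \<le> Q + Q / norm (b n p) * (\<Sum>l<m. norm (b n l))"
          using Q[of l] l t by (intro add_mono mult_mono member_le_sum)
            (auto simp: x_def m'_def Qn)
        also have "\<dots> = (1 + S) * Q" by (simp add: S_def algebra_simps)
        finally show ?thesis .
      qed
      from m[OF this]
      have 1: "norm (\<Sum>j<n. c j * b' j i) \<le> D * (\<Sum>j<n. norm (b' j i)) * ((1 + S) * Q)" .
      have "(\<Sum>j<n. norm (b' j i)) \<le> (\<Sum>j<n. norm (b j i) + norm (r j) * norm (b n i))"
        unfolding b'_def by (intro sum_mono) (metis norm_mult norm_triangle_ineq4)
      also have "\<dots> = (\<Sum>j<n. norm (b j i)) + R * norm (b n i)"
        by (simp add: sum.distrib R_def sum_distrib_right)
      also have "\<dots> \<le> (1 + R) * (\<Sum>j<Suc n. norm (b j i))"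
        using RS sum_nonneg[of "{..<n}" "\<lambda>j. norm (b j i)"] by (simp add: algebra_simps)
      finally have 2: "(\<Sum>j<n. norm (b' j i)) \<le> (1 + R) * (\<Sum>j<Suc n. norm (b j i))" .
      have "norm (x i) \<le> norm t * norm (b n i) + norm (\<Sum>j<n. c j * b' j i)"
        unfolding xt[of i] by (metis norm_mult norm_triangle_ineq)
      also have "\<dots> \<le> Q / norm (b n p) * (\<Sum>j<Suc n. norm (b j i)) +
          D * ((1 + R) * (\<Sum>j<Suc n. norm (b j i))) * ((1 + S) * Q)"
      proof (intro add_mono mult_mono t order_trans[OF 1] mult_right_mono[where c = "(1 + S) * Q"]
          mult_left_mono[where c = D] 2)
        show "norm (b n i) \<le> (\<Sum>j<Suc n. norm (b j i))"
          by (rule member_le_sum) auto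
      qed (use Qn D RS in \<open>auto intro!: mult_nonneg_nonneg sum_nonneg add_nonneg_nonneg\<close>)
      also have "\<dots> = D' * (\<Sum>j<Suc n. norm (b j i)) * Q"
        unfolding D'_def by (rule arith)
      finally show ?thesis unfolding x_def .
    qed
    have "D' \<ge> 0" using D RS by (simp add: D'_def)
    then show ?thesis using main by blast
  qed
qed

text \<open>
  In a finite-dimensional space of null sequences, the coordinates after a certain one never
  contribute to the supremum norm: they tend to zero uniformly on the unit ball.
\<close>

lemma c0_span_norming_coordinates:
  fixes B :: "(nat \<Rightarrow> 'k::real_normed_field) set"
  assumes fin: "finite B" and B: "B \<subseteq> c0_space"
  shows "\<exists>m>0. \<forall>x\<in>fun_vs.span B. \<forall>Q. (\<forall>l<m. norm (x l) \<le> Q) \<longrightarrow> sup_norm x \<le> Q"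
proof -
  obtain b where b: "bij_betw b {..<card B} B"
    using ex_bij_betw_nat_finite[OF fin] by (auto simp: lessThan_atLeast0)
  define n where "n = card B"
  obtain D m where D: "D \<ge> 0" and m: "\<And>c Q i. (\<And>l. l < m \<Longrightarrow> norm (\<Sum>j<n. c j * b j l) \<le> Q) \<Longrightarrow>
      norm (\<Sum>j<n. c j * b j i) \<le> D * (\<Sum>j<n. norm (b j i)) * Q"
    using finitely_many_coordinates_control[where n = n and b = b] by metis
  have "(\<lambda>i. D * (\<Sum>j<n. norm (b j i))) \<longlonglongrightarrow> D * (\<Sum>j<n. 0)"
  proof (intro tendsto_intros)
    fix j assume "j \<in> {..<n}"
    then have "b j \<in> B" using b by (auto simp: n_def bij_betw_def)
    then show "(\<lambda>i. norm (b j i)) \<longlonglongrightarrow> 0"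
      using B by (auto simp: c0_space_def intro: tendsto_norm_zero)
  qed
  then have "\<forall>\<^sub>F i in sequentially. D * (\<Sum>j<n. norm (b j i)) < 1"
    by (rule order_tendstoD) simp
  then obtain m1 where m1: "\<And>i. i \<ge> m1 \<Longrightarrow> D * (\<Sum>j<n. norm (b j i)) < 1"
    unfolding eventually_sequentially by blast
  define m' where "m' = Suc (max m m1)"
  have "sup_norm x \<le> Q" if x: "x \<in> fun_vs.span B" and Q: "\<forall>l<m'. norm (x l) \<le> Q" for x Q
  proof (rule sup_norm_le)
    fix i
    obtain c where c: "x = (\<Sum>v\<in>B. fscale (c v) v)"
      using x fun_vs.span_finite[OF fin] by auto
    have xe: "x l = (\<Sum>j<n. c (b j) * b j l)" for l
      unfolding c sum_fun_apply fscale_apply n_def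
      using sum.reindex_bij_betw[OF b, of "\<lambda>v. c v * v l"] by simp
    have Q0: "0 \<le> Q" using Q norm_ge_zero[of "x 0"] unfolding m'_def
      by (meson order_trans zero_less_Suc)
    show "norm (x i) \<le> Q"
    proof (cases "i < m'")
      case True then show ?thesis using Q by blast
    next
      case False
      have "norm (x i) \<le> D * (\<Sum>j<n. norm (b j i)) * Q"
        using m[of "\<lambda>j. c (b j)" Q i] Q unfolding xe m'_def by auto
      also have "\<dots> \<le> 1 * Q"
        using m1[of i] False Q0 by (intro mult_right_mono less_imp_le[OF m1]) (auto simp: m'_def)
      finally show ?thesis by simp
    qed
  qed
  then show ?thesis unfolding m'_def by blast
qed

section \<open>James' distortion argument\<close>

text \<open>
  Bounding the norms of the vectors from below instead of fixing them makes this property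
  multiplicative. In $c_0$ the unit vectors violate it for all \<open>m\<close> and all \<open>s > 1\<close>, and any
  seminorm that violates it for all of these contains almost isometric copies of the
  finite-dimensional subspaces of $c_0$.
\<close>

definition outgrows ::
  "('a \<Rightarrow> 'k::real_normed_field) set \<Rightarrow> (('a \<Rightarrow> 'k) \<Rightarrow> real) \<Rightarrow> nat \<Rightarrow> real \<Rightarrow> bool"
  where "outgrows V P m s \<longleftrightarrow> (\<forall>y. (\<forall>i<m. y i \<in> V \<and> 1 \<le> P (y i)) \<longrightarrow>
    (\<exists>a. (\<forall>i<m. norm (a i) \<le> 1) \<and> s \<le> P (\<Sum>i<m. fscale (a i) (y i))))"

lemma sum_in_subspace:
  "fun_vs.subspace V \<Longrightarrow> (\<And>i. i \<in> I \<Longrightarrow> y i \<in> V) \<Longrightarrow> (\<Sum>i\<in>I. fscale (a i) (y i)) \<in> V"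
  by (intro fun_vs.subspace_sum fun_vs.subspace_scale) auto

text \<open>
  Grouping vectors into blocks: the sums of the blocks are again vectors of norm at least one
  after division by the growth within a block.
\<close>

lemma outgrows_mult:
  assumes P: "seminorm_on V P" and m: "outgrows V P m s" and n: "outgrows V P n t" and s: "s > 0"
  shows "outgrows V P (n * m) (s * t)"
  unfolding outgrows_def
proof (intro allI impI)
  note P = seminorm_onD[OF P]
  fix y assume y: "\<forall>i<n * m. y i \<in> V \<and> 1 \<le> P (y i)"
  have idx: "k * m + i < n * m" if "k < n" "i < m" for k i
  proof -
    have "k * m + i < Suc k * m" using that by simp
    also have "\<dots> \<le> n * m" using that by (intro mult_le_mono1) simp
    finally show ?thesis .
  qed
  have "\<exists>a. (\<forall>i<m. norm (a i) \<le> 1) \<and> s \<le> P (\<Sum>i<m. fscale (a i) (y (k * m + i)))"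
    if "k < n" for k
  proof -
    have "\<forall>i<m. y (k * m + i) \<in> V \<and> 1 \<le> P (y (k * m + i))"
      using y idx[OF that] by blast
    then show ?thesis
      using m[unfolded outgrows_def, rule_format, of "\<lambda>i. y (k * m + i)"] by blast
  qed
  then obtain a where a: "\<And>k i. k < n \<Longrightarrow> i < m \<Longrightarrow> norm (a k i) \<le> 1"
    and as: "\<And>k. k < n \<Longrightarrow> s \<le> P (\<Sum>i<m. fscale (a k i) (y (k * m + i)))"
    by metis
  define z where "z k = (\<Sum>i<m. fscale (a k i) (y (k * m + i)))" for k
  have z: "z k \<in> V" if "k < n" for k
    unfolding z_def using y idx[OF that] by (intro sum_in_subspace P(1)) auto
  define w where "w k = fscale (of_real (1 / s)) (z k)" for k
  have w: "w k \<in> V \<and> 1 \<le> P (w k)" if "k < n" for k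
  proof
    show "w k \<in> V" unfolding w_def by (intro fun_vs.subspace_scale P(1) z that)
    have "P (w k) = (1 / s) * P (z k)"
      unfolding w_def P(3)[OF z[OF that]] using s by (simp only: norm_of_real) simp
    then show "1 \<le> P (w k)" using as[OF that] s by (simp add: z_def)
  qed
  then obtain b where b: "\<And>k. k < n \<Longrightarrow> norm (b k) \<le> 1"
    and bt: "t \<le> P (\<Sum>k<n. fscale (b k) (w k))"
    using n[unfolded outgrows_def, rule_format, of w] by blast
  have wV: "(\<Sum>k<n. fscale (b k) (w k)) \<in> V"
    using w by (intro sum_in_subspace P(1)) auto
  define c where "c i = b (i div m) * a (i div m) (i mod m)" for i
  have "(\<Sum>i<n * m. fscale (c i) (y i)) = (\<Sum>k<n. \<Sum>i\<in>{k*m..<k*m+m}. fscale (c i) (y i))"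
    by (rule sum.nat_group[symmetric])
  also have "\<dots> = (\<Sum>k<n. fscale (b k) (z k))"
  proof (rule sum.cong[OF refl])
    fix k assume "k \<in> {..<n}"
    have "(\<Sum>i\<in>{k*m..<k*m+m}. fscale (c i) (y i)) = (\<Sum>i<m. fscale (c (k*m+i)) (y (k*m+i)))"
      using sum.shift_bounds_nat_ivl[of "\<lambda>i. fscale (c i) (y i)" 0 "k*m" m]
      by (simp add: lessThan_atLeast0 add.commute)
    also have "\<dots> = (\<Sum>i<m. fscale (b k) (fscale (a k i) (y (k*m+i))))"
      by (rule sum.cong) (auto simp: c_def)
    also have "\<dots> = fscale (b k) (z k)"
      unfolding z_def by (simp add: fun_vs.scale_sum_right)
    finally show "(\<Sum>i\<in>{k*m..<k*m+m}. fscale (c i) (y i)) = fscale (b k) (z k)" .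
  qed
  also have "\<dots> = fscale (of_real s) (\<Sum>k<n. fscale (b k) (w k))"
    unfolding fun_vs.scale_sum_right w_def
    by (rule sum.cong) (use s in \<open>auto simp: fun_eq_iff\<close>)
  finally have "P (\<Sum>i<n * m. fscale (c i) (y i)) = s * P (\<Sum>k<n. fscale (b k) (w k))"
    using P(3)[OF wV, of "of_real s"] s by simp
  then have "s * t \<le> P (\<Sum>i<n * m. fscale (c i) (y i))"
    using bt s by simp
  moreover have "norm (c i) \<le> 1" if "i < n * m" for i
  proof -
    have "i div m < n" "i mod m < m"
      using that by (auto simp: less_mult_imp_div_less intro!: mod_less_divisor gr0I)
    then have "norm (b (i div m)) * norm (a (i div m) (i mod m)) \<le> 1"
      by (intro mult_le_one a b) auto
    then show ?thesis by (simp add: c_def norm_mult)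
  qed
  ultimately show "\<exists>a. (\<forall>i<n * m. norm (a i) \<le> 1) \<and> s * t \<le> P (\<Sum>i<n * m. fscale (a i) (y i))"
    by (intro exI[of _ c] conjI) auto
qed

lemma outgrows_power:
  assumes P: "seminorm_on V P" and m: "outgrows V P m s" and s: "s > 0"
  shows "outgrows V P (m ^ Suc k) (s ^ Suc k)"
proof (induction k)
  case 0 then show ?case using m by simp
next
  case (Suc k)
  from outgrows_mult[OF P m Suc s] show ?case
    by (simp only: power_Suc2[of m "Suc k"] power_Suc[of s "Suc k"])
qed

text \<open>
  James' distortion argument. If sums never outgrow their terms, then for each \<open>\<eta>\<close> there are
  vectors \<open>y i\<close> of norm at least one all of whose combinations with coefficients bounded by one
  have norm at most \<open>1 + \<eta>\<close>. Reflecting a combination in its largest term bounds its norm from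
  below, so the \<open>y i\<close> span a nearly isometric copy of a finite-dimensional supremum-norm space.
\<close>

lemma not_outgrows_imp_c0_finitely_representable:
  fixes N' :: "('a \<Rightarrow> 'k::{real_normed_field, euclidean_space}) \<Rightarrow> real"
  assumes P: "seminorm_on K N'" and meas: "K \<subseteq> borel_measurable M"
    and no: "\<And>m s. 0 < m \<Longrightarrow> 1 < s \<Longrightarrow> \<not> outgrows K N' m s"
  shows "finitely_representable M c0_space sup_norm K N'"
  unfolding finitely_representable_def
proof (intro allI impI, elim conjE)
  note P = seminorm_onD[OF P]
  fix B :: "(nat \<Rightarrow> 'k) set" and \<epsilon> :: real
  assume B: "finite B" "B \<subseteq> c0_space" and \<epsilon>: "\<epsilon> > 0"
  obtain m where m0: "m > 0"
    and m: "\<And>x Q. x \<in> fun_vs.span B \<Longrightarrow> (\<And>l. l < m \<Longrightarrow> norm (x l) \<le> Q) \<Longrightarrow> sup_norm x \<le> Q"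
    using c0_span_norming_coordinates[OF B] by blast
  define \<eta> where "\<eta> = \<epsilon> / (2 + \<epsilon>)"
  have \<eta>: "0 < \<eta>" "\<eta> < 1" "(1 + \<eta>) / (1 - \<eta>) = 1 + \<epsilon>"
    using \<epsilon> by (auto simp: \<eta>_def field_simps)
  have "\<not> outgrows K N' m (1 + \<eta>)" using no m0 \<eta> by simp
  then obtain y where yK: "\<forall>i<m. y i \<in> K \<and> 1 \<le> N' (y i)"
    and ny: "\<not> (\<exists>a. (\<forall>i<m. norm (a i) \<le> 1) \<and> 1 + \<eta> \<le> N' (\<Sum>i<m. fscale (a i) (y i)))"
    unfolding outgrows_def not_all not_imp by (elim exE conjE)
  have y: "y i \<in> K" "1 \<le> N' (y i)" if "i < m" for i using yK that by auto
  have up: "N' (\<Sum>i<m. fscale (a i) (y i)) < 1 + \<eta>" if a: "\<And>i. i < m \<Longrightarrow> norm (a i) \<le> 1" for a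
  proof (rule ccontr)
    assume "\<not> ?thesis"
    then have "(\<forall>i<m. norm (a i) \<le> 1) \<and> 1 + \<eta> \<le> N' (\<Sum>i<m. fscale (a i) (y i))"
      using a by (intro conjI allI impI) (simp_all add: not_less)
    then have "\<exists>a. (\<forall>i<m. norm (a i) \<le> 1) \<and> 1 + \<eta> \<le> N' (\<Sum>i<m. fscale (a i) (y i))"
      by (rule exI[of _ a])
    with ny show False ..
  qed
  \<comment> \<open>a combination only involves the first \<open>m\<close> coordinates of \<open>x\<close>, which determine its norm\<close>
  define S where "S x = (\<Sum>i<m. fscale (x i) (y i))" for x
  have SK: "S x \<in> K" for x
    unfolding S_def using y by (intro sum_in_subspace P(1)) auto
  have Sscale: "S (fscale c x) = fscale c (S x)" for c x
    unfolding S_def fun_vs.scale_sum_right by (rule sum.cong) auto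
  have Sadd: "S (x + z) = S x + S z" for x z
    unfolding S_def sum.distrib[symmetric] by (rule sum.cong) (auto simp: fun_eq_iff algebra_simps)
  have upper: "N' (S x) \<le> (1 + \<eta>) * Q" if x: "\<And>l. l < m \<Longrightarrow> norm (x l) \<le> Q" and Q: "Q > 0" for x Q
  proof -
    have "N' (S (fscale (of_real (1/Q)) x)) < 1 + \<eta>"
      unfolding S_def by (rule up) (use x Q in \<open>auto simp: norm_mult norm_divide field_simps\<close>)
    then have "(1/Q) * N' (S x) < 1 + \<eta>"
      unfolding Sscale using P(3)[OF SK, of "of_real (1/Q)" x] Q by (simp add: norm_divide)
    then show ?thesis using Q by (simp add: field_simps)
  qed
  have lower: "(1 - \<eta>) * norm (x i) \<le> N' (S x)"
    if x: "\<And>l. l < m \<Longrightarrow> norm (x l) \<le> norm (x i)" and i: "i < m" and n0: "norm (x i) > 0" for x i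
  proof -
    \<comment> \<open>the reflection in the largest term, which adds up with \<open>x\<close> to twice that term\<close>
    define x' where "x' l = (if l = i then x i else - x l)" for l
    have "fscale (2 * x i) (y i) = S x + S x'"
    proof -
      have "S x + S x' = S (x + x')" by (simp add: Sadd)
      also have "\<dots> = (\<Sum>l<m. if l = i then fscale (2 * x i) (y i) else 0)"
        unfolding S_def by (rule sum.cong) (auto simp: x'_def fun_eq_iff)
      also have "\<dots> = fscale (2 * x i) (y i)" using i by simp
      finally show ?thesis by simp
    qed
    then have "2 * norm (x i) * N' (y i) \<le> N' (S x) + N' (S x')"
      using P(3)[OF y(1)[OF i], of "2 * x i"] P(4)[OF SK SK, of x x'] by (simp add: norm_mult)
    moreover have "N' (S x') \<le> (1 + \<eta>) * norm (x i)"
      by (rule upper) (use x n0 in \<open>auto simp: x'_def\<close>)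
    moreover have "2 * norm (x i) \<le> 2 * norm (x i) * N' (y i)"
      using y(2)[OF i] n0 by simp
    ultimately show ?thesis by (simp add: algebra_simps)
  qed
  define T where "T x = fscale (of_real (1 / (1 - \<eta>))) (S x)" for x
  have TK: "T x \<in> K" for x unfolding T_def by (intro fun_vs.subspace_scale P(1) SK)
  have NT: "N' (T x) = N' (S x) / (1 - \<eta>)" for x
    unfolding T_def P(3)[OF SK] norm_of_real using \<eta> by simp
  have est: "sup_norm x \<le> N' (T x) \<and> N' (T x) \<le> (1 + \<epsilon>) * sup_norm x" if x: "x \<in> fun_vs.span B" for x
  proof -
    have xc: "x \<in> c0_space" using x B(2) fun_vs.span_minimal[OF _ subspace_c0] by blast
    obtain i where i: "i < m" "\<And>l. l < m \<Longrightarrow> norm (x l) \<le> norm (x i)"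
    proof -
      have "Max ((\<lambda>l. norm (x l)) ` {..<m}) \<in> (\<lambda>l. norm (x l)) ` {..<m}"
        using m0 by (intro Max_in) auto
      then obtain i where "i < m" "Max ((\<lambda>l. norm (x l)) ` {..<m}) = norm (x i)" by auto
      then show ?thesis using that[of i] Max_ge[of "(\<lambda>l. norm (x l)) ` {..<m}"] by simp
    qed
    have eq: "sup_norm x = norm (x i)"
      using m[OF x i(2)] norm_le_sup_norm[OF xc, of i] by simp
    show ?thesis
    proof (cases "norm (x i) > 0")
      case True
      have "sup_norm x \<le> N' (T x)"
        using lower[of x i, OF i(2) i(1) True] \<eta> by (simp add: NT eq field_simps)
      moreover have "N' (T x) \<le> ((1 + \<eta>) / (1 - \<eta>)) * sup_norm x"
        using divide_right_mono[OF upper[of x "norm (x i)", OF i(2) True], of "1 - \<eta>"] \<eta>(1,2)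
        by (simp add: NT eq)
      ultimately show ?thesis using \<eta> by simp
    next
      case False
      then have "S x = fscale 0 (S x)" unfolding S_def using i(2)
        by (auto simp: fun_eq_iff sum_fun_apply intro!: sum.neutral)
      then have "N' (S x) = 0" using P(3)[OF SK, of 0 x] by simp
      then show ?thesis using False by (simp add: eq NT)
    qed
  qed
  have "linear_to_L0 M (fun_vs.span B) T"
    unfolding linear_to_L0_def
    using TK meas by (auto simp: T_def Sadd Sscale algebra_simps)
  then show "\<exists>T. linear_to_L0 M (fun_vs.span B) T \<and> T ` fun_vs.span B \<subseteq> K \<and>
        (\<forall>x\<in>fun_vs.span B. sup_norm x \<le> N' (T x) \<and> N' (T x) \<le> (1 + \<epsilon>) * sup_norm x)"
    using TK est by (intro exI[of _ T]) auto
qed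

section \<open>Function spaces with a lower estimate\<close>

definition cut :: "'a set \<Rightarrow> ('a \<Rightarrow> 'k::zero) \<Rightarrow> 'a \<Rightarrow> 'k"
  where "cut E x = (\<lambda>s. if s \<in> E then x s else 0)"

lemma cut_apply: "cut E x s = (if s \<in> E then x s else 0)"
  by (simp add: cut_def)

abbreviation ind :: "'a set \<Rightarrow> 'a \<Rightarrow> 'k::real_normed_field"
  where "ind E \<equiv> indicator E"

lemma cut_eq_mult: "cut E x = ind E * (x :: 'a \<Rightarrow> 'k::real_normed_field)"
  by (auto simp: cut_def fun_eq_iff)

lemma cut_ind: "cut E (ind F :: 'a \<Rightarrow> 'k::real_normed_field) = ind (E \<inter> F)"
  by (auto simp: cut_def fun_eq_iff indicator_def)

lemma cut_measurable [measurable]: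
  fixes x :: "'a \<Rightarrow> 'k::{real_normed_field, euclidean_space}"
  assumes "x \<in> borel_measurable M" "E \<in> sets M" shows "cut E x \<in> borel_measurable M"
  unfolding cut_eq_mult times_fun_def using assms by measurable

text \<open>
  The constant \<open>\<kappa>\<close> serves for sums of any number of terms, because the quasi-norm is equivalent to
  a norm; iterating the quasi-triangle inequality would lose a factor at each step. The lower
  estimate is the trace of superreflexivity that the rest of the proof relies on.
\<close>

locale koethe_lower_estimate = koethe_space M K N
  for M :: "'a measure"
    and K :: "('a \<Rightarrow> 'k::{real_normed_field, euclidean_space}) set"
    and N :: "('a \<Rightarrow> 'k) \<Rightarrow> real" +
  fixes \<kappa> c0 :: real and d :: nat
  assumes kappa: "1 \<le> \<kappa>"
    and N_sum: "finite I \<Longrightarrow> (\<And>i. i \<in> I \<Longrightarrow> x i \<in> K) \<Longrightarrow>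
      N (\<Sum>i\<in>I. x i) \<le> \<kappa> * (\<Sum>i\<in>I. N (x (i::nat)))"
    and d: "2 \<le> d" and c0: "0 < c0"
    and lower: "(\<And>i. i < d ^ j \<Longrightarrow> x i \<in> K \<and> t \<le> N (x i)) \<Longrightarrow>
      (\<And>i k s. i < d ^ j \<Longrightarrow> k < d ^ j \<Longrightarrow> i \<noteq> k \<Longrightarrow> x i s = 0 \<or> x k s = 0) \<Longrightarrow>
      0 \<le> t \<Longrightarrow> c0 * 2 ^ j * t \<le> N (\<Sum>i<d ^ j. x i)"
    and complete: "(\<And>n. X n \<in> K) \<Longrightarrow>
      (\<And>e. e > 0 \<Longrightarrow> \<exists>n0. \<forall>m\<ge>n0. \<forall>n\<ge>n0. N (X m - X n) < e) \<Longrightarrow>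
      \<exists>x\<in>K. (\<lambda>n. N (X n - x)) \<longlonglongrightarrow> 0"
begin

lemma K_measurable: "x \<in> K \<Longrightarrow> x \<in> borel_measurable M"
  using measurable by blast

lemmas K_add = fun_vs.subspace_add[OF subspace]
  and K_diff = fun_vs.subspace_diff[OF subspace]
  and K_scale = fun_vs.subspace_scale[OF subspace]
  and K_zero = fun_vs.subspace_0[OF subspace]
  and K_sum = fun_vs.subspace_sum[OF subspace]

lemma N_zero: "N 0 = 0"
proof -
  have "N (fscale 0 0) = 0" using N_scale[OF K_zero, of 0] by simp
  moreover have "fscale 0 0 = (0 :: 'a \<Rightarrow> 'k)" by auto
  ultimately show ?thesis by metis
qed

lemma N_add_le: "x \<in> K \<Longrightarrow> y \<in> K \<Longrightarrow> N (x + y) \<le> \<kappa> * (N x + N y)"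
  using N_sum[of "{0, 1}" "\<lambda>i. if i = 0 then x else y"] by simp

lemma N_minus: assumes "x \<in> K" shows "- x \<in> K" "N (- x) = N x"
proof -
  have "- x = fscale (- 1) x" by auto
  then show "- x \<in> K" "N (- x) = N x" using K_scale[OF assms, of "-1"] N_scale[OF assms, of "-1"] by auto
qed

lemma N_diff_le: "x \<in> K \<Longrightarrow> y \<in> K \<Longrightarrow> N (x - y) \<le> \<kappa> * (N x + N y)"
  using N_add_le[of x "- y"] N_minus[of y] by simp

lemma N_diff_commute: "x \<in> K \<Longrightarrow> y \<in> K \<Longrightarrow> N (x - y) = N (y - x)"
  using N_minus(2)[of "x - y"] K_diff by simp

lemma dominated:
  assumes "f \<in> borel_measurable M" "g \<in> K" "\<And>s. s \<in> space M \<Longrightarrow> norm (f s) \<le> b * norm (g s)" "0 \<le> b"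
  shows "f \<in> K" "N f \<le> b * N g"
proof -
  have "norm (f s) \<le> norm (fscale (of_real b) g s)" if "s \<in> space M" for s
    using assms that by (simp add: norm_mult)
  then have ae: "AE s in M. norm (f s) \<le> norm (fscale (of_real b) g s)"
    by (rule AE_I2)
  have eq: "N (fscale (of_real b) g) = b * N g"
    by (simp only: N_scale[OF assms(2)] norm_of_real abs_of_nonneg[OF assms(4)])
  show "f \<in> K" "N f \<le> b * N g"
    using solid[OF assms(1) K_scale[OF assms(2)] ae] unfolding eq by blast+
qed

lemma N_cong:
  assumes "f \<in> borel_measurable M" "g \<in> K" "AE s in M. f s = g s"
  shows "f \<in> K" "N f = N g"
proof -
  have 1: "AE s in M. norm (f s) \<le> norm (g s)" "AE s in M. norm (g s) \<le> norm (f s)"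
    using assms(3) by auto
  show f: "f \<in> K" using solid[OF assms(1,2) 1(1)] by blast
  show "N f = N g"
    using solid[OF assms(1,2) 1(1)] solid[OF K_measurable[OF assms(2)] f 1(2)] by linarith
qed

lemma cut_mem:
  assumes "E \<in> sets M" "x \<in> K" shows "cut E x \<in> K" "N (cut E x) \<le> N x"
  using dominated[of "cut E x" x 1] assms K_measurable by (auto simp: cut_apply)

lemma ind_mono:
  assumes "E \<in> sets M" "E \<subseteq> F" "ind F \<in> K" shows "ind E \<in> K" "N (ind E) \<le> N (ind F)"
  using cut_mem[OF assms(1,3)] assms(2) by (auto simp: cut_ind Int_absorb2)

text \<open>
  Along an increasing exhaustion, the truncations form a Cauchy sequence: otherwise there are
  infinitely many disjoint blocks of norm at least \<open>e\<close>, and by the lower estimate their sums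
  are unbounded.
\<close>

lemma fatou:
  assumes f: "f \<in> borel_measurable M" and B: "\<And>n. B n \<in> sets M" "incseq B"
    and ev: "AE s in M. \<exists>n. s \<in> B n"
    and cK: "\<And>n. cut (B n) f \<in> K" and R: "\<And>n. N (cut (B n) f) \<le> R"
  shows "f \<in> K" "N f \<le> \<kappa> * R"
proof -
  have Bmono: "B m \<subseteq> B n" if "m \<le> n" for m n using B(2) that by (auto simp: incseq_def)
  have dif: "cut (B m) f - cut (B n) f = cut (B m - B n) f" if "n \<le> m" for m n
    using Bmono[OF that] by (auto simp: fun_eq_iff cut_apply)
  have Cauchy: "\<exists>n0. \<forall>m\<ge>n0. \<forall>n\<ge>n0. N (cut (B m) f - cut (B n) f) < e" if e: "e > 0" for e
  proof (rule ccontr)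
    assume no: "\<not> ?thesis"
    have "\<exists>n m. n0 \<le> n \<and> n \<le> m \<and> e \<le> N (cut (B m - B n) f)" for n0
    proof -
      obtain m n where mn: "m \<ge> n0" "n \<ge> n0" "e \<le> N (cut (B m) f - cut (B n) f)"
        using no by (meson not_le)
      show ?thesis
      proof (cases "n \<le> m")
        case True then show ?thesis using mn dif[OF True] by auto
      next
        case False
        then have "e \<le> N (cut (B n - B m) f)"
          using mn(3) dif[of m n] N_diff_commute[OF cK cK, of m n] by simp
        then show ?thesis using mn False by (meson nat_le_linear)
      qed
    qed
    then obtain n m where nm: "\<And>n0. n0 \<le> n n0" "\<And>n0. n n0 \<le> m n0"
      "\<And>n0. e \<le> N (cut (B (m n0) - B (n n0)) f)"
      by metis
    \<comment> \<open>each block starts where the previous one has ended, so the blocks are disjoint\<close>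
    define a where "a = rec_nat 0 (\<lambda>_. m)"
    have a: "a (Suc k) = m (a k)" for k by (simp add: a_def)
    have "a k \<le> a (Suc k)" for k using nm(1,2)[of "a k"] a[of k] by linarith
    then have amono: "a k \<le> a l" if "k \<le> l" for k l using that lift_Suc_mono_le by blast
    define x where "x k = cut (B (m (a k)) - B (n (a k))) f" for k
    have disj: "x k s = 0 \<or> x l s = 0" if "k < l" for k l s
    proof -
      have "m (a k) \<le> n (a l)" using amono[of "Suc k" l] that a[of k] nm(1)[of "a l"] by simp
      then show ?thesis using Bmono[of "m (a k)" "n (a l)"] by (auto simp: x_def cut_apply)
    qed
    have xK: "x k \<in> K" for k
      unfolding x_def dif[OF nm(2), symmetric] by (intro K_diff cK)
    have le: "c0 * 2 ^ j * e \<le> R" for j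
    proof -
      have eq: "(\<Sum>k<d ^ j. x k) = cut (\<Union>k<d ^ j. B (m (a k)) - B (n (a k))) f"
      proof
        fix s
        show "(\<Sum>k<d ^ j. x k) s = cut (\<Union>k<d ^ j. B (m (a k)) - B (n (a k))) f s"
        proof (cases "\<exists>k<d ^ j. s \<in> B (m (a k)) - B (n (a k))")
          case True
          then obtain k where k: "k < d ^ j" "s \<in> B (m (a k)) - B (n (a k))" by blast
          have "x l s = (if l = k then f s else 0)" for l
          proof (cases "l = k")
            case True then show ?thesis using k by (simp add: x_def cut_apply)
          next
            case False
            have "s \<notin> B (m (a l)) - B (n (a l))"
            proof
              assume l: "s \<in> B (m (a l)) - B (n (a l))"
              have "l < k \<or> k < l" using False by linarith
              then show False
              proof
                assume "l < k"
                then have "m (a l) \<le> n (a k)" using amono[of "Suc l" k] a[of l] nm(1)[of "a k"] by simp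
                then show False using Bmono k l by blast
              next
                assume "k < l"
                then have "m (a k) \<le> n (a l)" using amono[of "Suc k" l] a[of k] nm(1)[of "a l"] by simp
                then show False using Bmono k l by blast
              qed
            qed
            then show ?thesis unfolding x_def cut_apply using False by (simp only: if_False)
          qed
          then have "(\<Sum>k<d ^ j. x k s) = f s" using k by simp
          moreover have "cut (\<Union>k<d ^ j. B (m (a k)) - B (n (a k))) f s = f s"
            using k by (auto simp: cut_apply)
          ultimately show ?thesis by (simp add: sum_fun_apply)
        next
          case False
          then show ?thesis by (auto simp: sum_fun_apply x_def cut_apply intro!: sum.neutral)
        qed
      qed
      have "(\<Union>k<d ^ j. B (m (a k)) - B (n (a k))) \<subseteq> B (a (d ^ j))"
      proof
        fix s assume "s \<in> (\<Union>k<d ^ j. B (m (a k)) - B (n (a k)))"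
        then obtain k where k: "k < d ^ j" "s \<in> B (m (a k))" by blast
        then have "m (a k) \<le> a (d ^ j)" using amono[of "Suc k" "d ^ j"] a[of k] by simp
        then show "s \<in> B (a (d ^ j))" using Bmono k(2) by blast
      qed
      then have "cut (\<Union>k<d ^ j. B (m (a k)) - B (n (a k))) f
          = cut (\<Union>k<d ^ j. B (m (a k)) - B (n (a k))) (cut (B (a (d ^ j))) f)"
        by (auto simp: fun_eq_iff cut_apply)
      then have "N (\<Sum>k<d ^ j. x k) \<le> N (cut (B (a (d ^ j))) f)"
        unfolding eq using cut_mem(2)[OF _ cK] B(1) by (metis (no_types, lifting) sets.Diff sets.finite_UN finite_lessThan)
      moreover have "c0 * 2 ^ j * e \<le> N (\<Sum>k<d ^ j. x k)"
      proof (rule lower)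
        show "x i \<in> K \<and> e \<le> N (x i)" for i using xK nm(3)[of "a i"] by (simp add: x_def)
        show "x i s = 0 \<or> x k s = 0" if "i \<noteq> k" for i k s
          using disj[of i k s] disj[of k i s] that by (metis nat_neq_iff)
      qed (use e in auto)
      ultimately show ?thesis using R[of "a (d ^ j)"] by linarith
    qed
    obtain j where "R / (c0 * e) < 2 ^ j"
      using real_arch_pow[of 2 "R / (c0 * e)"] by auto
    then have "R < c0 * 2 ^ j * e" using c0 e by (simp add: field_simps)
    then show False using le[of j] by simp
  qed
  obtain g where g: "g \<in> K" and lim: "(\<lambda>n. N (cut (B n) f - g)) \<longlonglongrightarrow> 0"
    using complete[of "\<lambda>n. cut (B n) f", OF cK Cauchy] by blast
  have "AE s in M. s \<in> B n \<longrightarrow> f s = g s" for n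
  proof -
    have eq: "cut (B n) (cut (B m) f - g) = cut (B n) f - cut (B n) g" if "n \<le> m" for m
      using Bmono[OF that] by (auto simp: fun_eq_iff cut_apply)
    have hK: "cut (B n) f - cut (B n) g \<in> K" by (intro K_diff cK cut_mem B g)
    have "N (cut (B n) f - cut (B n) g) \<le> 0"
    proof (rule tendsto_lowerbound[OF lim])
      show "\<forall>\<^sub>F m in sequentially. N (cut (B n) f - cut (B n) g) \<le> N (cut (B m) f - g)"
        using eq cut_mem(2)[OF B(1) K_diff[OF cK g], of n]
        unfolding eventually_sequentially by metis
    qed simp
    then have "N (cut (B n) f - cut (B n) g) = 0" using N_nonneg[OF hK] by simp
    then have "AE s in M. (cut (B n) f - cut (B n) g) s = 0" using N_eq_0_iff[OF hK] by blast
    then show ?thesis by eventually_elim (auto simp: cut_apply)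
  qed
  then have "AE s in M. \<forall>n. s \<in> B n \<longrightarrow> f s = g s"
    unfolding AE_all_countable by (rule allI)
  with ev have fg: "AE s in M. f s = g s" by eventually_elim auto
  show "f \<in> K" using N_cong[OF f g fg] by blast
  have "N g \<le> \<kappa> * (R + 0)"
  proof (rule tendsto_lowerbound)
    show "(\<lambda>n. \<kappa> * (R + N (cut (B n) f - g))) \<longlonglongrightarrow> \<kappa> * (R + 0)"
      by (intro tendsto_intros lim)
    have "N g \<le> \<kappa> * (R + N (cut (B n) f - g))" for n
    proof -
      have "N g = N (cut (B n) f - (cut (B n) f - g))" by simp
      also have "\<dots> \<le> \<kappa> * (N (cut (B n) f) + N (cut (B n) f - g))"
        by (intro N_diff_le cK K_diff g)
      also have "\<dots> \<le> \<kappa> * (R + N (cut (B n) f - g))"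
        using R[of n] kappa by (intro mult_left_mono) auto
      finally show ?thesis .
    qed
    then show "\<forall>\<^sub>F n in sequentially. N g \<le> \<kappa> * (R + N (cut (B n) f - g))" by simp
  qed simp
  then show "N f \<le> \<kappa> * R" using N_cong[OF f g fg] by simp
qed

end

locale koethe_centralizer = koethe_lower_estimate M K N \<kappa> c0 d
  for M :: "'a measure"
    and K :: "('a \<Rightarrow> 'k::{real_normed_field, euclidean_space}) set"
    and N :: "('a \<Rightarrow> 'k) \<Rightarrow> real" and \<kappa> c0 :: real and d :: nat +
  fixes \<Omega> :: "('a \<Rightarrow> 'k) \<Rightarrow> 'a \<Rightarrow> 'k" and C :: real
  assumes C: "0 \<le> C"
    and Omega_measurable: "x \<in> K \<Longrightarrow> \<Omega> x \<in> borel_measurable M"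
    and Omega_mult: "f \<in> Linf_space M \<Longrightarrow> x \<in> K \<Longrightarrow> \<Omega> (f * x) - f * \<Omega> x \<in> K \<and>
      N (\<Omega> (f * x) - f * \<Omega> x) \<le> C * enn2real (Linf_norm M f) * N x"
begin

lemma Omega_bounded_mult:
  assumes f: "f \<in> borel_measurable M" and b: "\<And>s. norm (f s) \<le> b" and x: "x \<in> K"
  shows "\<Omega> (f * x) - f * \<Omega> x \<in> K" "N (\<Omega> (f * x) - f * \<Omega> x) \<le> C * b * N x"
proof -
  have b0: "0 \<le> b" using b[of undefined] norm_ge_zero order_trans by blast
  have le: "Linf_norm M f \<le> ennreal b"
    unfolding Linf_norm_def using f b by (intro esssup_I) (auto intro!: AE_I2 ennreal_leI)
  then have L: "f \<in> Linf_space M" unfolding Linf_space_def using f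
    by (auto intro: le_less_trans)
  have "enn2real (Linf_norm M f) \<le> b" using enn2real_mono[OF le] b0 by simp
  then have "C * enn2real (Linf_norm M f) * N x \<le> C * b * N x"
    using C N_nonneg[OF x] by (intro mult_right_mono mult_left_mono) auto
  then show "\<Omega> (f * x) - f * \<Omega> x \<in> K" "N (\<Omega> (f * x) - f * \<Omega> x) \<le> C * b * N x"
    using Omega_mult[OF L x] by auto
qed

lemma Omega_cut:
  assumes E: "E \<in> sets M" and x: "x \<in> K"
  shows "\<Omega> (cut E x) - cut E (\<Omega> x) \<in> K" "N (\<Omega> (cut E x) - cut E (\<Omega> x)) \<le> C * N x"
proof -
  have "ind E \<in> borel_measurable M" "\<And>s. norm (ind E s :: 'k) \<le> 1"
    using E by (auto simp: indicator_def)
  from Omega_bounded_mult[OF this x] show "\<Omega> (cut E x) - cut E (\<Omega> x) \<in> K"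
    "N (\<Omega> (cut E x) - cut E (\<Omega> x)) \<le> C * N x" unfolding cut_eq_mult by auto
qed

text \<open>
  Cutting \<open>x\<close> along a decreasing sequence of sets, \<open>\<Omega>\<close> is recovered layer by layer, and the error
  of each step is controlled by the part of \<open>x\<close> that is still left rather than by all of \<open>x\<close>.
\<close>

lemma Omega_layers:
  assumes x: "x \<in> K" and S: "\<And>k. S k \<in> sets M" "decseq S" "AE s in M. \<exists>k. s \<notin> S k"
    and b: "\<And>k. cut (S k - S (Suc k)) (\<Omega> (cut (S k) x)) \<in> K"
      "\<And>k. N (cut (S k - S (Suc k)) (\<Omega> (cut (S k) x))) \<le> b k"
    and c: "\<And>k. N (cut (S k) x) \<le> c k"
    and R: "\<And>n. (\<Sum>k<n. b k + C * c k) \<le> R"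
  shows "cut (S 0) (\<Omega> (cut (S 0) x)) \<in> K" "N (cut (S 0) (\<Omega> (cut (S 0) x))) \<le> \<kappa> ^ 3 * R"
proof -
  define w where "w k = \<Omega> (cut (S k) x)" for k
  define e where "e k = cut (S (Suc k)) (w k) - cut (S (Suc k)) (w (Suc k))" for k
  define y where "y k = cut (S k - S (Suc k)) (w k) + e k" for k
  have Ssub: "S (Suc k) \<subseteq> S k" for k using S(2) by (simp add: decseq_Suc_iff)
  have xS: "cut (S k) x \<in> K" for k by (intro cut_mem S x)
  have wm: "w k \<in> borel_measurable M" for k unfolding w_def by (rule Omega_measurable[OF xS])
  have e: "e k \<in> K" "N (e k) \<le> C * c k" for k
  proof -
    define u where "u = \<Omega> (cut (S (Suc k)) (cut (S k) x)) - cut (S (Suc k)) (w k)"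
    have u: "u \<in> K" "N u \<le> C * N (cut (S k) x)"
      unfolding u_def w_def by (rule Omega_cut[OF S(1) xS])+
    have cc: "cut (S (Suc k)) (cut (S k) x) = cut (S (Suc k)) x"
      using Ssub[of k] by (auto simp: cut_apply fun_eq_iff)
    have eq: "e k = - cut (S (Suc k)) u"
      unfolding e_def u_def w_def cc by (auto simp: cut_apply fun_eq_iff)
    show "e k \<in> K" unfolding eq by (intro N_minus cut_mem S u)
    have "N (e k) \<le> N u" unfolding eq using N_minus(2)[OF cut_mem(1)[OF S(1) u(1)]] cut_mem(2)[OF S(1) u(1)] by simp
    also have "\<dots> \<le> C * c k" using u(2) c[of k] C by (meson mult_left_mono order_trans)
    finally show "N (e k) \<le> C * c k" .
  qed
  have yK: "y k \<in> K" for k unfolding y_def by (intro K_add e) (use b(1) in \<open>simp add: w_def\<close>)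
  have yN: "N (y k) \<le> \<kappa> * (b k + C * c k)" for k
  proof -
    have "N (y k) \<le> \<kappa> * (N (cut (S k - S (Suc k)) (w k)) + N (e k))"
      unfolding y_def by (intro N_add_le e) (use b(1) in \<open>simp add: w_def\<close>)
    also have "\<dots> \<le> \<kappa> * (b k + C * c k)"
      using b(2)[of k] e(2)[of k] kappa by (intro mult_left_mono add_mono) (auto simp: w_def)
    finally show ?thesis .
  qed
  have tele: "cut (S 0) (w 0) = (\<Sum>k<n. y k) + cut (S n) (w n)" for n
  proof (induction n)
    case 0 show ?case by simp
  next
    case (Suc n)
    have "cut (S n) (w n) = y n + cut (S (Suc n)) (w (Suc n))"
      using Ssub[of n] by (auto simp: y_def e_def fun_eq_iff cut_apply)
    then show ?case using Suc by (simp add: add.assoc)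
  qed
  define B where "B n = space M - S n" for n
  define f where "f = cut (S 0) (w 0)"
  have Bm: "B n \<in> sets M" for n unfolding B_def using S by auto
  have part: "cut (B n) f = cut (B n) (\<Sum>k<n. y k)" for n
    unfolding f_def tele[of n] by (auto simp: fun_eq_iff cut_apply B_def)
  have sumK: "(\<Sum>k<n. y k) \<in> K" for n by (intro K_sum yK)
  have partN: "N (cut (B n) f) \<le> \<kappa>\<^sup>2 * R" for n
  proof -
    have "N (cut (B n) f) \<le> N (\<Sum>k<n. y k)" unfolding part by (rule cut_mem(2)[OF Bm sumK])
    also have "\<dots> \<le> \<kappa> * (\<Sum>k<n. N (y k))" by (rule N_sum) (auto intro: yK)
    also have "\<dots> \<le> \<kappa> * (\<Sum>k<n. \<kappa> * (b k + C * c k))"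
      using kappa by (intro mult_left_mono sum_mono yN) auto
    also have "\<dots> = \<kappa>\<^sup>2 * (\<Sum>k<n. b k + C * c k)"
      by (simp add: sum_distrib_left power2_eq_square mult.assoc)
    also have "\<dots> \<le> \<kappa>\<^sup>2 * R" by (intro mult_left_mono R) auto
    finally show ?thesis .
  qed
  have inc: "incseq B" unfolding B_def incseq_def
    using S(2) by (auto simp: decseq_def)
  have ev: "AE s in M. \<exists>n. s \<in> B n"
    using S(3) by (rule AE_mp) (auto intro!: AE_I2 simp: B_def)
  have fm: "f \<in> borel_measurable M" unfolding f_def by (intro cut_measurable wm S)
  have "cut (B n) f \<in> K" for n unfolding part by (intro cut_mem Bm sumK)
  from fatou[OF fm Bm inc ev this partN]
  have "f \<in> K" "N f \<le> \<kappa> * (\<kappa>\<^sup>2 * R)" by auto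
  then show "cut (S 0) (\<Omega> (cut (S 0) x)) \<in> K" "N (cut (S 0) (\<Omega> (cut (S 0) x))) \<le> \<kappa> ^ 3 * R"
    unfolding f_def w_def by (auto simp: power3_eq_cube power2_eq_square mult.assoc)
qed

end

section \<open>Superreflexivity yields the lower estimate\<close>

lemma outgrows_mono:
  assumes P: "outgrows V P m s" and mn: "m \<le> n"
  shows "outgrows V P n s"
  unfolding outgrows_def
proof (intro allI impI)
  fix y assume "\<forall>i<n. y i \<in> V \<and> 1 \<le> P (y i)"
  then have "\<forall>i<m. y i \<in> V \<and> 1 \<le> P (y i)" using mn by auto
  then obtain a where a: "\<forall>i<m. norm (a i) \<le> 1" "s \<le> P (\<Sum>i<m. fscale (a i) (y i))"
    using P[unfolded outgrows_def, rule_format, of y] by blast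
  define b where "b i = (if i < m then a i else 0)" for i
  have "(\<Sum>i<n. fscale (b i) (y i)) = (\<Sum>i<m. fscale (a i) (y i))"
    using mn by (intro sum.mono_neutral_cong_right) (auto simp: b_def fun_eq_iff)
  then show "\<exists>a. (\<forall>i<n. norm (a i) \<le> 1) \<and> s \<le> P (\<Sum>i<n. fscale (a i) (y i))"
    using a by (intro exI[of _ b]) (simp add: b_def)
qed

text \<open>
  A large combination of disjoint functions with coefficients bounded by one is dominated by their
  plain sum, so growth of some combination becomes growth of the sum. The constants of the
  equivalence between the quasi-norm and the norm \<open>N'\<close> enter only once, whatever the power of \<open>d\<close>.
\<close>

lemma superreflexive_imp_lower_estimate:
  fixes M :: "'a measure" and K :: "('a \<Rightarrow> 'k::{real_normed_field, euclidean_space}) set"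
  assumes ks: "koethe_space M K N" and sr: "superreflexive M K N"
  obtains \<kappa> c0 d where "koethe_lower_estimate M K N \<kappa> c0 d"
proof -
  interpret koethe_space M K N by (rule ks)
  obtain N' c C where sn: "seminorm_on K N'" and cp: "complete_on K N'" and c: "c > 0"
    and eqv: "\<forall>x\<in>K. c * N x \<le> N' x \<and> N' x \<le> C * N x"
    and fr: "\<forall>(W :: (nat \<Rightarrow> 'k) set) P. banach_on W P \<and> finitely_representable M W P K N' \<longrightarrow> reflexive_on W P"
    using sr unfolding superreflexive_def by blast
  note P = seminorm_onD[OF sn]
  define C' where "C' = max C 1"
  have C': "C' > 0" by (simp add: C'_def)
  have lo: "c * N x \<le> N' x" if "x \<in> K" for x using eqv that by blast
  have hi: "N' x \<le> C' * N x" if "x \<in> K" for x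
  proof -
    have "N' x \<le> C * N x" using eqv that by blast
    also have "\<dots> \<le> C' * N x" using N_nonneg[OF that] by (intro mult_right_mono) (auto simp: C'_def)
    finally show ?thesis .
  qed
  have Ksum: "(\<Sum>i\<in>I. x i) \<in> K" if "\<And>i. i \<in> I \<Longrightarrow> x i \<in> K" for I :: "nat set" and x
    using that by (intro fun_vs.subspace_sum subspace)
  have N'0: "N' 0 = 0"
  proof -
    have "N' (fscale 0 0) = norm (0::'k) * N' 0" by (intro P(3) fun_vs.subspace_0 subspace)
    moreover have "fscale 0 0 = (0 :: 'a \<Rightarrow> 'k)" by auto
    ultimately show ?thesis by simp
  qed
  have N'sum: "N' (\<Sum>i\<in>I. x i) \<le> (\<Sum>i\<in>I. N' (x i))" if "finite I" "\<And>i. i \<in> I \<Longrightarrow> x i \<in> K"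
    for I :: "nat set" and x using that
  proof (induction I)
    case empty then show ?case by (simp only: sum.empty N'0 order_refl)
  next
    case (insert i I)
    have "N' (x i + (\<Sum>i\<in>I. x i)) \<le> N' (x i) + N' (\<Sum>i\<in>I. x i)"
      using insert by (intro P(4) Ksum) auto
    moreover have "N' (\<Sum>i\<in>I. x i) \<le> (\<Sum>i\<in>I. N' (x i))" using insert by auto
    ultimately show ?case unfolding sum.insert[OF insert(1,2)] by linarith
  qed
  have "\<exists>m s. 0 < m \<and> 1 < s \<and> outgrows K N' m s"
  proof (rule ccontr)
    assume no: "\<not> ?thesis"
    have "finitely_representable M c0_space sup_norm K N'"
      by (rule not_outgrows_imp_c0_finitely_representable[OF sn measurable]) (use no in blast)
    then have "reflexive_on (c0_space :: (nat \<Rightarrow> 'k) set) sup_norm" using fr banach_c0 by blast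
    then show False using c0_not_reflexive by blast
  qed
  then obtain m s where s: "1 < s" and og: "outgrows K N' m s" by blast
  obtain k where k: "2 < s ^ k" using real_arch_pow[OF s] by blast
  have "1 * 2 \<le> s * s ^ k" using s k by (intro mult_mono) auto
  then have k2: "2 \<le> s ^ Suc k" by simp
  define d where "d = (m + 2) ^ Suc k"
  define c0 where "c0 = min 1 (c / C')"
  have og': "outgrows K N' d (s ^ Suc k)"
    unfolding d_def by (rule outgrows_power[OF sn outgrows_mono[OF og]]) (use s in auto)
  have ogj: "outgrows K N' (d ^ Suc j) (2 ^ Suc j)" for j
  proof -
    have "outgrows K N' (d ^ Suc j) ((s ^ Suc k) ^ Suc j)" by (rule outgrows_power[OF sn og']) (use k2 in linarith)
    moreover have "(2::real) ^ Suc j \<le> (s ^ Suc k) ^ Suc j" using k2 by (intro power_mono) auto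
    ultimately show ?thesis unfolding outgrows_def by (blast intro: order_trans)
  qed
  have "koethe_lower_estimate M K N (max 1 (C' / c)) c0 d"
  proof
    show "1 \<le> max 1 (C' / c)" by simp
    have "2 ^ 1 \<le> (m + 2) ^ 1" by simp
    also have "\<dots> \<le> (m + 2) ^ Suc k" by (intro power_increasing) auto
    finally show "2 \<le> d" unfolding d_def by simp
    show "0 < c0" using c C' by (simp add: c0_def)
  next
    fix I :: "nat set" and x assume I: "finite I" and x: "\<And>i. i \<in> I \<Longrightarrow> x i \<in> K"
    have "c * N (\<Sum>i\<in>I. x i) \<le> N' (\<Sum>i\<in>I. x i)" by (rule lo[OF Ksum[OF x]])
    also have "\<dots> \<le> (\<Sum>i\<in>I. N' (x i))" by (rule N'sum[OF I x])
    also have "\<dots> \<le> (\<Sum>i\<in>I. C' * N (x i))" by (intro sum_mono hi x)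
    finally have "N (\<Sum>i\<in>I. x i) \<le> C' / c * (\<Sum>i\<in>I. N (x i))"
      using c by (simp add: sum_distrib_left[symmetric] field_simps)
    also have "\<dots> \<le> max 1 (C' / c) * (\<Sum>i\<in>I. N (x i))"
      using N_nonneg x by (intro mult_right_mono sum_nonneg) auto
    finally show "N (\<Sum>i\<in>I. x i) \<le> max 1 (C' / c) * (\<Sum>i\<in>I. N (x i))" .
  next
    fix j :: nat and x :: "nat \<Rightarrow> 'a \<Rightarrow> 'k" and t :: real
    assume x: "\<And>i. i < d ^ j \<Longrightarrow> x i \<in> K \<and> t \<le> N (x i)"
      and dj: "\<And>i k s. i < d ^ j \<Longrightarrow> k < d ^ j \<Longrightarrow> i \<noteq> k \<Longrightarrow> x i s = 0 \<or> x k s = 0" and t: "0 \<le> t"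
    have SK: "(\<Sum>i<d ^ j. x i) \<in> K" using x by (intro Ksum) auto
    show "c0 * 2 ^ j * t \<le> N (\<Sum>i<d ^ j. x i)"
    proof (cases "t = 0 \<or> j = 0")
      case True
      have "c0 * t \<le> 1 * t" using t by (intro mult_right_mono) (auto simp: c0_def)
      then show ?thesis using True N_nonneg[OF SK] x[of 0] by auto
    next
      case False
      then have t0: "t > 0" using t by simp
      obtain j' where j': "j = Suc j'" using False not0_implies_Suc by blast
      define u :: 'k where "u = of_real (1 / (c * t))"
      have u: "norm u = 1 / (c * t)" using c t0 by (simp add: u_def norm_divide norm_mult)
      define y where "y i = fscale u (x i)" for i
      have y: "y i \<in> K \<and> 1 \<le> N' (y i)" if "i < d ^ j" for i
      proof
        show "y i \<in> K" unfolding y_def using x[OF that] by (intro fun_vs.subspace_scale subspace) auto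
        have "c * t \<le> c * N (x i)" using x[OF that] c by (intro mult_left_mono) auto
        also have "\<dots> \<le> N' (x i)" using lo x[OF that] by blast
        finally have "1 \<le> 1 / (c * t) * N' (x i)" using c t0 by (simp add: field_simps)
        then show "1 \<le> N' (y i)" unfolding y_def using P(3)[of "x i" u] x[OF that] u by simp
      qed
      then obtain a where a: "\<forall>i<d ^ j. norm (a i) \<le> 1" and big: "2 ^ j \<le> N' (\<Sum>i<d ^ j. fscale (a i) (y i))"
        using ogj[of j', unfolded outgrows_def, rule_format, of y] unfolding j' by blast
      define z where "z = (\<Sum>i<d ^ j. fscale (a i) (x i))"
      have zK: "z \<in> K" unfolding z_def using x by (intro Ksum fun_vs.subspace_scale subspace) auto
      have "(\<Sum>i<d ^ j. fscale (a i) (y i)) = fscale u z"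
        unfolding z_def fun_vs.scale_sum_right y_def by (rule sum.cong) (auto simp: fun_eq_iff)
      then have "2 ^ j \<le> 1 / (c * t) * N' z" using big P(3)[OF zK, of u] u by simp
      then have "c * t * 2 ^ j \<le> N' z" using c t0 by (simp add: field_simps)
      also have "\<dots> \<le> C' * N z" by (rule hi[OF zK])
      also have "N z \<le> N (\<Sum>i<d ^ j. x i)"
      proof -
        have "norm (z s) \<le> norm ((\<Sum>i<d ^ j. x i) s)" for s
        proof (cases "\<exists>i<d ^ j. x i s \<noteq> 0")
          case True
          then obtain i where i: "i < d ^ j" "x i s \<noteq> 0" by blast
          have o: "x k s = 0" if "k < d ^ j" "k \<noteq> i" for k using dj[OF that(1) i(1) that(2), of s] i(2) by blast
          have "z s = (\<Sum>k<d ^ j. if k = i then a i * x i s else 0)"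
            unfolding z_def sum_fun_apply using o by (intro sum.cong) auto
          moreover have "(\<Sum>i<d ^ j. x i) s = (\<Sum>k<d ^ j. if k = i then x i s else 0)"
            unfolding sum_fun_apply using o by (intro sum.cong) auto
          moreover have "norm (a i * x i s) \<le> norm (x i s)" using a i by (simp add: norm_mult mult_left_le_one_le)
          ultimately show ?thesis using i(1) by simp
        next
          case False
          then have "z s = 0" unfolding z_def sum_fun_apply by (intro sum.neutral) auto
          then show ?thesis by simp
        qed
        then show ?thesis using solid[OF _ SK] zK measurable by blast
      qed
      finally have "c * t * 2 ^ j \<le> C' * N (\<Sum>i<d ^ j. x i)" using C' by simp
      then have "c / C' * (2 ^ j * t) \<le> N (\<Sum>i<d ^ j. x i)" using C' by (simp add: field_simps)
      moreover have "c0 * (2 ^ j * t) \<le> c / C' * (2 ^ j * t)" using t by (intro mult_right_mono) (auto simp: c0_def)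
      ultimately show ?thesis by (simp add: mult.assoc)
    qed
  next
    fix X :: "nat \<Rightarrow> 'a \<Rightarrow> 'k"
    assume X: "\<And>n. X n \<in> K" and Cy: "\<And>e. e > 0 \<Longrightarrow> \<exists>n0. \<forall>m\<ge>n0. \<forall>n\<ge>n0. N (X m - X n) < e"
    have D: "X m - X n \<in> K" for m n by (intro fun_vs.subspace_diff subspace X)
    have "\<exists>n0. \<forall>m\<ge>n0. \<forall>n\<ge>n0. N' (X m - X n) < e" if e: "e > 0" for e
    proof -
      have "e / C' > 0" using e C' by simp
      then obtain n0 where n0: "\<forall>m\<ge>n0. \<forall>n\<ge>n0. N (X m - X n) < e / C'" using Cy by blast
      have "N' (X m - X n) < e" if "m \<ge> n0" "n \<ge> n0" for m n
      proof -
        have "C' * N (X m - X n) < e" using n0[rule_format, OF that] C' by (simp add: field_simps)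
        then show ?thesis using hi[OF D, of m n] by linarith
      qed
      then show ?thesis by blast
    qed
    then obtain x where x: "x \<in> K" and lim: "(\<lambda>n. N' (X n - x)) \<longlonglongrightarrow> 0"
      using cp[unfolded complete_on_def, rule_format, of X] X by blast
    have XD: "X n - x \<in> K" for n by (intro fun_vs.subspace_diff subspace X x)
    have "(\<lambda>n. N (X n - x)) \<longlonglongrightarrow> 0"
    proof (rule tendsto_sandwich[OF _ _ tendsto_const])
      show "(\<lambda>n. 1 / c * N' (X n - x)) \<longlonglongrightarrow> 0" using tendsto_mult[OF tendsto_const lim, of "1 / c"] by simp
      have "N (X n - x) \<le> 1 / c * N' (X n - x)" for n using lo[OF XD, of n] c by (simp add: field_simps)
      then show "\<forall>\<^sub>F n in sequentially. N (X n - x) \<le> 1 / c * N' (X n - x)" by simp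
      show "\<forall>\<^sub>F n in sequentially. 0 \<le> N (X n - x)" using N_nonneg[OF XD] by simp
    qed
    with x show "\<exists>x\<in>K. (\<lambda>n. N (X n - x)) \<longlonglongrightarrow> 0" by blast
  qed
  then show ?thesis by (rule that)
qed

section \<open>Rademacher functions on a non-atomic measure space\<close>

text \<open>
  A set of positive measure splits into two subsets of positive measure, and the smaller one has
  at most half of the measure; this is iterated.
\<close>

lemma nonatomic_small_subset:
  assumes na: "nonatomic M" and A: "A \<in> sets M" "emeasure M A < \<infinity>" "0 < measure M A" and e: "0 < e"
  shows "\<exists>B\<in>sets M. B \<subseteq> A \<and> 0 < measure M B \<and> measure M B \<le> e"
proof -
  have "\<exists>B\<in>sets M. B \<subseteq> A \<and> 0 < measure M B \<and> measure M B \<le> measure M A / 2 ^ n" for n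
  proof (induction n)
    case 0 then show ?case using A by auto
  next
    case (Suc n)
    then obtain B where B: "B \<in> sets M" "B \<subseteq> A" "0 < measure M B" "measure M B \<le> measure M A / 2 ^ n"
      by blast
    have fB: "emeasure M B < \<infinity>" using emeasure_mono[OF B(2) A(1)] A(2) by (rule le_less_trans)
    have eB: "emeasure M B = ennreal (measure M B)" using fB by (simp add: emeasure_eq_ennreal_measure)
    have "0 < emeasure M B" using B(3) eB by simp
    then obtain D where D: "D \<in> sets M" "D \<subseteq> B" "0 < emeasure M D" "emeasure M D < emeasure M B"
      using na B(1) unfolding nonatomic_def by blast
    have eD: "emeasure M D = ennreal (measure M D)" using less_trans[OF D(4) fB] by (simp add: emeasure_eq_ennreal_measure)
    have m: "0 < measure M D" "measure M D < measure M B"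
      using D(3,4) unfolding eD eB by (auto simp: ennreal_less_iff)
    have df: "measure M (B - D) = measure M B - measure M D"
      using fB B D by (intro measure_Diff) auto
    have "measure M B / 2 \<le> (measure M A / 2 ^ n) / 2" using B(4) by (rule divide_right_mono) simp
    then have hv: "measure M B / 2 \<le> measure M A / 2 ^ Suc n" by simp
    show ?case
    proof (cases "measure M D \<le> measure M B / 2")
      case True
      then have "measure M D \<le> measure M A / 2 ^ Suc n" using hv by (rule order_trans)
      then show ?thesis using D m B(2) by blast
    next
      case False
      then have "measure M (B - D) \<le> measure M A / 2 ^ Suc n" using hv df by simp
      moreover have "0 < measure M (B - D)" using df m by simp
      ultimately show ?thesis using B D by (intro bexI[of _ "B - D"]) auto
    qed
  qed
  moreover obtain n where "measure M A / e < 2 ^ n" using real_arch_pow[of 2 "measure M A / e"] by auto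
  then have "measure M A / 2 ^ n \<le> e" using e by (simp add: field_simps)
  ultimately show ?thesis by (meson order_trans)
qed

text \<open>
  Sierpinski's theorem, by exhaustion: a set is enlarged step by step, each time by a subset whose
  measure is at least half of what is possible without exceeding \<open>t\<close>. If the union stayed below
  \<open>t\<close>, a small subset of the remainder would have been available at every step.
\<close>

lemma nonatomic_intermediate_value:
  assumes na: "nonatomic M" and A: "A \<in> sets M" "emeasure M A < \<infinity>" and t: "0 \<le> t" "t \<le> measure M A"
  shows "\<exists>B\<in>sets M. B \<subseteq> A \<and> measure M B = t"
proof -
  define adm where "adm B = {E \<in> sets M. E \<subseteq> A - B \<and> measure M B + measure M E \<le> t}" for B
  define sup where "sup B = Sup (measure M ` adm B)" for B
  have fin: "emeasure M B \<noteq> \<infinity>" if "B \<subseteq> A" for B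
    using emeasure_mono[OF that A(1)] A(2) by auto
  have bdd: "bdd_above (measure M ` adm B)" for B
    unfolding adm_def by (rule bdd_aboveI[of _ "t - measure M B"]) auto
  have "\<exists>E\<in>adm B. sup B / 2 \<le> measure M E" if "adm B \<noteq> {}" for B
  proof (cases "sup B > 0")
    case True
    then have "sup B / 2 < Sup (measure M ` adm B)" by (simp add: sup_def)
    then show ?thesis using less_cSUP_iff[OF that bdd] by (meson less_imp_le)
  next
    case False
    from that obtain E where "E \<in> adm B" by blast
    moreover have "sup B / 2 \<le> measure M E" using False measure_nonneg[of M E] by linarith
    ultimately show ?thesis by blast
  qed
  then obtain p where p: "\<And>B. adm B \<noteq> {} \<Longrightarrow> p B \<in> adm B \<and> sup B / 2 \<le> measure M (p B)"
    by metis
  define Q where "Q = rec_nat {} (\<lambda>_ B. B \<union> p B)"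
  have Q0: "Q 0 = {}" and QS: "Q (Suc n) = Q n \<union> p (Q n)" for n by (simp_all add: Q_def)
  have ne: "p (Q n) \<in> adm (Q n) \<and> sup (Q n) / 2 \<le> measure M (p (Q n))"
    if "measure M (Q n) \<le> t" for n
    by (rule p) (use that in \<open>auto simp: adm_def intro!: exI[of _ "{}"]\<close>)
  have Q: "Q n \<in> sets M \<and> Q n \<subseteq> A \<and> measure M (Q n) \<le> t" for n
  proof (induction n)
    case 0 then show ?case using t by (simp add: Q0)
  next
    case (Suc n)
    then have a: "p (Q n) \<in> adm (Q n)" using ne by blast
    have "measure M (Q (Suc n)) = measure M (Q n) + measure M (p (Q n))"
      unfolding QS using a Suc fin by (intro measure_Union) (auto simp: adm_def)
    then show ?case using a Suc by (auto simp: adm_def QS)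
  qed
  have pQ: "p (Q n) \<in> adm (Q n)" "sup (Q n) / 2 \<le> measure M (p (Q n))" for n
    using ne[of n] Q[of n] by auto
  have mS: "measure M (Q (Suc n)) = measure M (Q n) + measure M (p (Q n))" for n
    unfolding QS using pQ(1)[of n] Q[of n] fin by (intro measure_Union) (auto simp: adm_def)
  define D where "D = (\<Union>n. Q n)"
  have Dm: "D \<in> sets M" "D \<subseteq> A" unfolding D_def using Q by auto
  have inc: "incseq Q" by (rule incseq_SucI) (simp add: QS)
  have lim: "(\<lambda>n. measure M (Q n)) \<longlonglongrightarrow> measure M D"
    unfolding D_def using Q fin[OF Dm(2)] inc by (intro Lim_measure_incseq) (auto simp: D_def)
  have Dt: "measure M D \<le> t" by (rule LIMSEQ_le_const2[OF lim]) (use Q in auto)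
  have QD: "measure M (Q n) \<le> measure M D" for n
    using Q Dm fin[OF Dm(2)] by (intro measure_mono_fmeasurable) (auto simp: D_def fmeasurable_def less_top)
  show ?thesis
  proof (cases "measure M D = t")
    case True then show ?thesis using Dm by blast
  next
    case False
    then have lt: "measure M D < t" using Dt by simp
    have "measure M (A - D) = measure M A - measure M D"
      using A Dm by (intro measure_Diff) auto
    then have "0 < measure M (A - D)" using lt t by simp
    moreover have "emeasure M (A - D) < \<infinity>" using fin[of "A - D"] by (auto simp: less_top)
    ultimately obtain E where E: "E \<in> sets M" "E \<subseteq> A - D" "0 < measure M E" "measure M E \<le> t - measure M D"
      using nonatomic_small_subset[OF na, of "A - D" "t - measure M D"] lt A Dm by auto
    have "E \<in> adm (Q n)" for n unfolding adm_def using E QD[of n] by (auto simp: D_def)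
    then have "measure M E \<le> sup (Q n)" for n unfolding sup_def using bdd by (intro cSUP_upper)
    then have step: "measure M (Q n) + measure M E / 2 \<le> measure M (Q (Suc n))" for n
      using divide_right_mono[of _ _ 2] pQ(2)[of n] mS[of n] by (smt (verit))
    have "n * (measure M E / 2) \<le> measure M (Q n)" for n :: nat
    proof (induction n)
      case (Suc n)
      have "real (Suc n) * (measure M E / 2) = n * (measure M E / 2) + measure M E / 2"
        by (simp add: algebra_simps)
      then show ?case using step[of n] Suc by linarith
    qed (simp add: Q0)
    moreover obtain n :: nat where "t / (measure M E / 2) < n" using reals_Archimedean2 by blast
    then have "t < n * (measure M E / 2)" using E(3) by (simp add: field_simps)
    ultimately have False using Q[of n] by (smt (verit))
    then show ?thesis ..
  qed
qed

lemma sum_pairs: "(\<Sum>j<2 * m. f j) = (\<Sum>j<m. f (2 * j) + f (Suc (2 * j)))"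
  for f :: "nat \<Rightarrow> 'b::comm_monoid_add"
  by (induction m) (auto simp: add.assoc)

text \<open>
  The values of a signed sum \<open>\<Sum>i<n. \<plusminus> a i\<close>, listed by the binary number that encodes the signs.
\<close>

fun signed_sum :: "(nat \<Rightarrow> 'k::ab_group_add) \<Rightarrow> nat \<Rightarrow> nat \<Rightarrow> 'k" where
  "signed_sum a 0 j = 0"
| "signed_sum a (Suc n) j = signed_sum a n (j div 2) + (if odd j then a n else - a n)"

lemma sum_signed_sum_Suc:
  fixes F :: "'k::ab_group_add \<Rightarrow> real"
  shows "(\<Sum>j<2 ^ Suc n. F (signed_sum a (Suc n) j)) =
    (\<Sum>j<2 ^ n. F (signed_sum a n j - a n) + F (signed_sum a n j + a n))"
  using sum_pairs[of "\<lambda>j. F (signed_sum a (Suc n) j)" "2 ^ n"] by simp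

lemma signed_sum_square:
  fixes a :: "nat \<Rightarrow> 'k::euclidean_space"
  shows "(\<Sum>j<2 ^ n. (norm (signed_sum a n j))\<^sup>2) = 2 ^ n * (\<Sum>i<n. (norm (a i))\<^sup>2)"
proof (induction n)
  case (Suc n)
  have "(norm (x - y))\<^sup>2 + (norm (x + y))\<^sup>2 = 2 * (norm x)\<^sup>2 + 2 * (norm y)\<^sup>2" for x y :: 'k
    by (simp add: power2_norm_eq_inner inner_simps inner_commute)
  then have "(\<Sum>j<2 ^ Suc n. (norm (signed_sum a (Suc n) j))\<^sup>2)
      = (\<Sum>j<2 ^ n. 2 * (norm (signed_sum a n j))\<^sup>2 + 2 * (norm (a n))\<^sup>2)"
    unfolding sum_signed_sum_Suc[of "\<lambda>x. (norm x)\<^sup>2"] by simp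
  also have "\<dots> = 2 * (\<Sum>j<2 ^ n. (norm (signed_sum a n j))\<^sup>2) + 2 ^ Suc n * (norm (a n))\<^sup>2"
    by (simp add: sum.distrib sum_distrib_left)
  finally show ?case by (simp add: Suc algebra_simps)
qed simp

lemma exp_plus_exp_minus_le:
  fixes x :: real assumes "\<bar>x\<bar> \<le> 1" shows "exp x + exp (- x) \<le> 2 * exp (x\<^sup>2)"
proof -
  have pos: "exp x + exp (- x) \<le> 2 * exp (x\<^sup>2)" if x: "0 \<le> x" "x \<le> 1" for x :: real
  proof -
    have "1 \<le> (1 - x + x\<^sup>2) * (1 + x + x\<^sup>2 / 2)"
    proof -
      have "(1 - x + x\<^sup>2) * (1 + x + x\<^sup>2 / 2) = 1 + x\<^sup>2 / 2 + x ^ 3 / 2 + x ^ 4 / 2"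
        by (simp add: field_simps power2_eq_square power3_eq_cube power4_eq_xxxx)
      then show ?thesis using x by simp
    qed
    also have "\<dots> \<le> (1 - x + x\<^sup>2) * exp x"
      using x exp_lower_Taylor_quadratic[of x] by (intro mult_left_mono) auto
    finally have "exp (- x) \<le> 1 - x + x\<^sup>2" by (simp add: exp_minus field_simps)
    moreover have "exp x \<le> 1 + x + x\<^sup>2" using x by (intro exp_bound)
    moreover have "1 + x\<^sup>2 \<le> exp (x\<^sup>2)" by (rule exp_ge_add_one_self)
    ultimately show ?thesis by linarith
  qed
  show ?thesis
  proof (cases "0 \<le> x")
    case True then show ?thesis using pos[of x] assms by simp
  next
    case False then show ?thesis using pos[of "- x"] assms by simp
  qed
qed

lemma signed_sum_exp_inner:
  fixes a :: "nat \<Rightarrow> 'k::euclidean_space"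
  assumes a: "\<And>i. i < n \<Longrightarrow> norm (a i) \<le> 1" and u: "norm u = 1"
  shows "(\<Sum>j<2 ^ n. exp (signed_sum a n j \<bullet> u)) \<le> 2 ^ n * exp (\<Sum>i<n. (norm (a i))\<^sup>2)"
  using a
proof (induction n)
  case (Suc n)
  have "\<bar>a n \<bullet> u\<bar> \<le> norm (a n)" using Cauchy_Schwarz_ineq2[of "a n" u] u by simp
  then have "\<bar>a n \<bullet> u\<bar> \<le> 1" "(a n \<bullet> u)\<^sup>2 \<le> (norm (a n))\<^sup>2"
    using Suc.prems[of n] power_mono[of "\<bar>a n \<bullet> u\<bar>" "norm (a n)" 2] by auto
  then have e: "exp (a n \<bullet> u) + exp (- (a n \<bullet> u)) \<le> 2 * exp ((norm (a n))\<^sup>2)"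
    using exp_plus_exp_minus_le[of "a n \<bullet> u"] by (smt (verit) exp_le_cancel_iff)
  have "(\<Sum>j<2 ^ Suc n. exp (signed_sum a (Suc n) j \<bullet> u))
      = (\<Sum>j<2 ^ n. exp (signed_sum a n j \<bullet> u) * (exp (a n \<bullet> u) + exp (- (a n \<bullet> u))))"
    unfolding sum_signed_sum_Suc[of "\<lambda>x. exp (x \<bullet> u)"]
    by (rule sum.cong) (auto simp: inner_diff_left inner_add_left exp_add exp_diff exp_minus field_simps)
  also have "\<dots> = (\<Sum>j<2 ^ n. exp (signed_sum a n j \<bullet> u)) * (exp (a n \<bullet> u) + exp (- (a n \<bullet> u)))"
    by (rule sum_distrib_right[symmetric])
  also have "\<dots> \<le> (2 ^ n * exp (\<Sum>i<n. (norm (a i))\<^sup>2)) * (2 * exp ((norm (a n))\<^sup>2))"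
    using Suc by (intro mult_mono e Suc.IH) (auto intro!: mult_nonneg_nonneg add_nonneg_nonneg)
  finally show ?case by (simp add: exp_add)
qed simp

text \<open>
  Signed sums of square-summable coefficients are exponentially integrable, uniformly in the
  number of terms: this is applied to each coordinate, in both directions.
\<close>

lemma signed_sum_exp_norm:
  fixes a :: "nat \<Rightarrow> 'k::euclidean_space"
  assumes a: "(\<Sum>i<n. (norm (a i))\<^sup>2) \<le> 1"
  shows "(\<Sum>j<2 ^ n. exp (norm (signed_sum a n j) / DIM('k))) \<le> 2 ^ n * (2 * DIM('k) * exp 1)"
proof -
  have na: "norm (a i) \<le> 1" if "i < n" for i
  proof -
    have "(norm (a i))\<^sup>2 \<le> (\<Sum>i<n. (norm (a i))\<^sup>2)" using that by (intro member_le_sum) auto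
    then have "(norm (a i))\<^sup>2 \<le> 1\<^sup>2" using a by simp
    then show ?thesis by (rule power2_le_imp_le) simp
  qed
  have B: "exp (norm x / DIM('k)) \<le> (\<Sum>b\<in>Basis. exp (x \<bullet> b) + exp (x \<bullet> - b))" for x :: 'k
  proof -
    have "\<exists>b\<in>Basis. norm x / DIM('k) \<le> \<bar>x \<bullet> b\<bar>"
    proof (rule ccontr)
      assume "\<not> ?thesis"
      then have "(\<Sum>b\<in>Basis. \<bar>x \<bullet> b\<bar>) < (\<Sum>b\<in>(Basis::'k set). norm x / DIM('k))"
        by (intro sum_strict_mono) auto
      then show False using norm_le_l1[of x] by simp
    qed
    then obtain b where b: "b \<in> Basis" "norm x / DIM('k) \<le> \<bar>x \<bullet> b\<bar>" by blast
    have "exp (norm x / DIM('k)) \<le> exp \<bar>x \<bullet> b\<bar>" using b by simp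
    also have "\<dots> \<le> exp (x \<bullet> b) + exp (x \<bullet> - b)" by (simp add: abs_if)
    also have "\<dots> \<le> (\<Sum>b\<in>Basis. exp (x \<bullet> b) + exp (x \<bullet> - b))"
      using b(1) by (intro member_le_sum) auto
    finally show ?thesis .
  qed
  have E: "(\<Sum>j<2 ^ n. exp (signed_sum a n j \<bullet> u)) \<le> 2 ^ n * exp 1" if "norm u = 1" for u
  proof -
    have "(\<Sum>j<2 ^ n. exp (signed_sum a n j \<bullet> u)) \<le> 2 ^ n * exp (\<Sum>i<n. (norm (a i))\<^sup>2)"
      by (rule signed_sum_exp_inner[OF na that])
    also have "\<dots> \<le> 2 ^ n * exp 1" using a by simp
    finally show ?thesis .
  qed
  have "(\<Sum>j<2 ^ n. exp (norm (signed_sum a n j) / DIM('k)))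
      \<le> (\<Sum>j<2 ^ n. \<Sum>b\<in>Basis. exp (signed_sum a n j \<bullet> b) + exp (signed_sum a n j \<bullet> - b))"
    by (intro sum_mono B)
  also have "\<dots> = (\<Sum>b\<in>Basis. (\<Sum>j<2 ^ n. exp (signed_sum a n j \<bullet> b)) + (\<Sum>j<2 ^ n. exp (signed_sum a n j \<bullet> - b)))"
    by (subst sum.swap) (simp only: sum.distrib)
  also have "\<dots> \<le> (\<Sum>b\<in>(Basis::'k set). 2 ^ n * exp 1 + 2 ^ n * exp 1)"
    by (intro sum_mono add_mono E) auto
  finally show ?thesis by (simp add: algebra_simps)
qed

text \<open>
  Khinchin's inequality for the first moment. The second moment is the sum of the squares and the
  fourth one is bounded by the exponential moment, so not all of the second moment can come from
  the values above a fixed height \<open>\<alpha>\<close>.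
\<close>

lemma signed_sum_first_moment:
  shows "\<exists>c>0. \<forall>n (a :: nat \<Rightarrow> 'k::euclidean_space).
    2 ^ n * (c * sqrt (\<Sum>i<n. (norm (a i))\<^sup>2)) \<le> (\<Sum>j<2 ^ n. norm (signed_sum a n j))"
proof -
  define D :: real where "D = DIM('k)"
  have D: "D \<ge> 1" by (simp add: D_def Suc_leI)
  define Q where "Q = 256 * D ^ 4 * (2 * D * exp 1)"
  have Q: "Q > 0" using D by (simp add: Q_def)
  \<comment> \<open>chosen so that the values above \<open>\<alpha>\<close> account for at most half of the second moment\<close>
  define \<alpha> where "\<alpha> = sqrt (2 * Q)"
  have \<alpha>: "\<alpha> > 0" "\<alpha>\<^sup>2 = 2 * Q" using Q by (auto simp: \<alpha>_def)
  have pt: "t\<^sup>2 \<le> \<alpha> * t + t ^ 4 / \<alpha>\<^sup>2" if "t \<ge> 0" for t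
  proof (cases "t \<le> \<alpha>")
    case True
    then have "t * t \<le> \<alpha> * t" using that by (intro mult_right_mono)
    then show ?thesis using that by (simp add: power2_eq_square add_increasing2)
  next
    case False
    then have "\<alpha>\<^sup>2 * t\<^sup>2 \<le> t\<^sup>2 * t\<^sup>2" using \<alpha>(1) by (intro mult_right_mono power_mono) auto
    then have "t\<^sup>2 \<le> t ^ 4 / \<alpha>\<^sup>2" using \<alpha>(1) by (simp add: field_simps power_add[symmetric])
    then show ?thesis using that \<alpha>(1) by (simp add: add_increasing)
  qed
  have four: "t ^ 4 \<le> 256 * D ^ 4 * exp (t / D)" if "t \<ge> 0" for t
  proof -
    have "(1 + (t / D) / real 4) ^ 4 \<le> exp (t / D)"
      by (rule exp_ge_one_plus_x_over_n_power_n) (use that D in \<open>auto intro: order_trans[of _ 0]\<close>)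
    moreover have "(t / (4 * D)) ^ 4 \<le> (1 + (t / D) / real 4) ^ 4"
      using that D by (intro power_mono) auto
    ultimately have "(t / (4 * D)) ^ 4 \<le> exp (t / D)" by linarith
    then show ?thesis using D by (simp add: power_divide power_mult_distrib field_simps)
  qed
  have unit: "2 ^ n * (1 / (2 * \<alpha>)) \<le> (\<Sum>j<2 ^ n. norm (signed_sum a n j))"
    if a: "(\<Sum>i<n. (norm (a i))\<^sup>2) = 1" for n and a :: "nat \<Rightarrow> 'k"
  proof -
    let ?v = "\<lambda>j. norm (signed_sum a n j)"
    have "2 ^ n = (\<Sum>j<2 ^ n. (?v j)\<^sup>2)" by (simp add: signed_sum_square a)
    also have "\<dots> \<le> (\<Sum>j<2 ^ n. \<alpha> * ?v j + (?v j) ^ 4 / \<alpha>\<^sup>2)" by (intro sum_mono pt) simp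
    also have "\<dots> = \<alpha> * (\<Sum>j<2 ^ n. ?v j) + (\<Sum>j<2 ^ n. (?v j) ^ 4) / \<alpha>\<^sup>2"
      by (simp add: sum.distrib sum_distrib_left sum_divide_distrib)
    also have "(\<Sum>j<2 ^ n. (?v j) ^ 4) \<le> (\<Sum>j<2 ^ n. 256 * D ^ 4 * exp (?v j / D))"
      by (intro sum_mono four) simp
    also have "\<dots> = 256 * D ^ 4 * (\<Sum>j<2 ^ n. exp (?v j / D))" by (simp add: sum_distrib_left)
    also have "\<dots> \<le> 256 * D ^ 4 * (2 ^ n * (2 * D * exp 1))"
      using signed_sum_exp_norm[of a n] a D unfolding D_def by (intro mult_left_mono) auto
    also have "\<dots> = 2 ^ n * Q" by (simp add: Q_def)
    finally have "2 ^ n \<le> \<alpha> * (\<Sum>j<2 ^ n. ?v j) + 2 ^ n * Q / \<alpha>\<^sup>2"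
      using \<alpha>(1) by (auto simp: divide_right_mono)
    then have "2 ^ n \<le> \<alpha> * (\<Sum>j<2 ^ n. ?v j) + 2 ^ n / 2" using Q by (simp add: \<alpha>(2))
    then show ?thesis using \<alpha>(1) by (simp add: field_simps)
  qed
  have "2 ^ n * (1 / (2 * \<alpha>) * sqrt (\<Sum>i<n. (norm (a i))\<^sup>2)) \<le> (\<Sum>j<2 ^ n. norm (signed_sum a n j))"
    for n and a :: "nat \<Rightarrow> 'k"
  proof (cases "(\<Sum>i<n. (norm (a i))\<^sup>2) = 0")
    case True then show ?thesis by (simp add: sum_nonneg)
  next
    case False
    define r where "r = sqrt (\<Sum>i<n. (norm (a i))\<^sup>2)"
    have nn: "0 \<le> (\<Sum>i<n. (norm (a i))\<^sup>2)" by (intro sum_nonneg) auto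
    have r: "r > 0" "r\<^sup>2 = (\<Sum>i<n. (norm (a i))\<^sup>2)" using False nn by (auto simp: r_def)
    define b where "b i = a i /\<^sub>R r" for i
    have "signed_sum b n j = signed_sum a n j /\<^sub>R r" for j
      by (induction n arbitrary: j) (auto simp: b_def scaleR_add_right scaleR_diff_right)
    then have v: "norm (signed_sum b n j) = norm (signed_sum a n j) / r" for j
      using r by (simp add: divide_inverse)
    have "(\<Sum>i<n. (norm (b i))\<^sup>2) = (\<Sum>i<n. (norm (a i))\<^sup>2) / r\<^sup>2"
      unfolding sum_divide_distrib b_def using r(1)
      by (intro sum.cong) (auto simp: power_mult_distrib divide_inverse power_inverse)
    then have "(\<Sum>i<n. (norm (b i))\<^sup>2) = 1" using r False by simp
    from unit[OF this] have "2 ^ n * (1 / (2 * \<alpha>)) \<le> (\<Sum>j<2 ^ n. norm (signed_sum a n j)) / r"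
      unfolding v sum_divide_distrib .
    then show ?thesis using r(1) by (simp add: r_def[symmetric] field_simps)
  qed
  then show ?thesis using \<alpha>(1) by (intro exI[of _ "1 / (2 * \<alpha>)"]) auto
qed

text \<open>
  Starting from \<open>A\<close>, every cell is split by \<open>hf\<close> into two cells of half the measure. The binary
  digits of \<open>j\<close> tell which halves lead to \<open>cell n j\<close>, in the same way as they encode the signs in
  \<open>signed_sum a n j\<close>: that is the constant value of the Rademacher sum on this cell. Thus the
  distribution of Rademacher sums is expressed by finite sums over \<open>j\<close>.
\<close>

locale dyadic_partition =
  fixes M :: "'a measure" and A :: "'a set" and hf :: "'a set \<Rightarrow> 'a set"
  assumes A: "A \<in> sets M" "emeasure M A < \<infinity>"
    and hf: "B \<in> sets M \<Longrightarrow> B \<subseteq> A \<Longrightarrow> hf B \<in> sets M \<and> hf B \<subseteq> B \<and> measure M (hf B) = measure M B / 2"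
begin

fun cell :: "nat \<Rightarrow> nat \<Rightarrow> 'a set" where
  "cell 0 j = (if j = 0 then A else {})"
| "cell (Suc n) j = (if odd j then hf (cell n (j div 2)) else cell n (j div 2) - hf (cell n (j div 2)))"

definition rad :: "nat \<Rightarrow> 'a \<Rightarrow> 'k::real_normed_field"
  where "rad n s = (if s \<in> A then if \<exists>j. odd j \<and> s \<in> cell (Suc n) j then 1 else - 1 else 0)"

lemma cell_sets: "cell n j \<in> sets M" and cell_subset: "cell n j \<subseteq> A"
proof -
  have "cell n j \<in> sets M \<and> cell n j \<subseteq> A"
  proof (induction n arbitrary: j)
    case (Suc n)
    from Suc[of "j div 2"] hf[of "cell n (j div 2)"] show ?case by auto
  qed (use A in auto)
  then show "cell n j \<in> sets M" "cell n j \<subseteq> A" by auto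
qed

lemma cell_parent: "cell (Suc n) j \<subseteq> cell n (j div 2)"
  using hf[OF cell_sets cell_subset, of n "j div 2"] by auto

lemma cell_disjoint: "s \<in> cell n i \<Longrightarrow> s \<in> cell n j \<Longrightarrow> i = j"
proof (induction n arbitrary: i j)
  case (Suc n)
  have "i div 2 = j div 2"
    by (rule Suc.IH[OF subsetD[OF cell_parent Suc.prems(1)] subsetD[OF cell_parent Suc.prems(2)]])
  moreover have "odd i \<longleftrightarrow> odd j"
    using Suc.prems calculation by (auto split: if_splits)
  ultimately show ?case by (metis bit_eq_rec odd_iff_mod_2_eq_one)
qed (auto split: if_splits)

lemma cell_cover: "s \<in> A \<Longrightarrow> \<exists>j<2 ^ n. s \<in> cell n j"
proof (induction n)
  case (Suc n)
  then obtain j where j: "j < 2 ^ n" "s \<in> cell n j" by blast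
  show ?case
  proof (cases "s \<in> hf (cell n j)")
    case True
    then show ?thesis using j by (intro exI[of _ "Suc (2 * j)"]) auto
  next
    case False
    then show ?thesis using j by (intro exI[of _ "2 * j"]) auto
  qed
qed auto

lemma cell_measure: "j < 2 ^ n \<Longrightarrow> measure M (cell n j) = measure M A / 2 ^ n"
proof (induction n arbitrary: j)
  case (Suc n)
  let ?B = "cell n (j div 2)"
  have m: "measure M ?B = measure M A / 2 ^ n" using Suc by (auto intro!: Suc.IH)
  have h: "hf ?B \<in> sets M" "hf ?B \<subseteq> ?B" "measure M (hf ?B) = measure M ?B / 2"
    using hf[OF cell_sets cell_subset] by auto
  have "emeasure M ?B \<noteq> \<infinity>" using emeasure_mono[OF cell_subset A(1), of n "j div 2"] A(2) by auto
  then have "measure M (?B - hf ?B) = measure M ?B - measure M (hf ?B)"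
    using h cell_sets by (intro measure_Diff)
  then show ?case using m h(3) by simp
qed simp

lemma rad_eq:
  assumes s: "s \<in> cell (Suc n) j" shows "rad n s = (if odd j then 1 else - 1)"
proof -
  have "s \<in> A" using cell_subset s by (rule subsetD)
  moreover have "(\<exists>i. odd i \<and> s \<in> cell (Suc n) i) \<longleftrightarrow> odd j"
    using cell_disjoint[OF s] s by metis
  ultimately show ?thesis unfolding rad_def by (simp only: if_True)
qed

lemma rad_measurable: "(rad n :: 'a \<Rightarrow> 'k::{real_normed_field, euclidean_space}) \<in> borel_measurable M"
proof -
  have [measurable]: "A \<in> sets M" "(\<Union>j\<in>{j. odd j}. cell (Suc n) j) \<in> sets M"
    by (rule A, rule sets.countable_UN'', simp, rule cell_sets)
  have "rad n = (\<lambda>s. if s \<in> A then if s \<in> (\<Union>j\<in>{j. odd j}. cell (Suc n) j) then 1 else - 1 else 0 :: 'k)"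
  proof -
    have "(s \<in> (\<Union>j\<in>{j. odd j}. cell (Suc n) j)) = (\<exists>j. odd j \<and> s \<in> cell (Suc n) j)" for s by blast
    then show ?thesis unfolding rad_def by (simp only:)
  qed
  also have "\<dots> \<in> borel_measurable M" by measurable
  finally show ?thesis .
qed

lemma rad_sum:
  fixes a :: "nat \<Rightarrow> 'k::real_normed_field"
  shows "s \<in> cell n j \<Longrightarrow> (\<Sum>i<n. a i * rad i s) = signed_sum a n j"
proof (induction n arbitrary: j)
  case (Suc n)
  have "(\<Sum>i<n. a i * rad i s) = signed_sum a n (j div 2)"
    by (rule Suc.IH[OF subsetD[OF cell_parent Suc.prems]])
  then show ?case by (simp add: rad_eq[OF Suc.prems])
qed simp

lemma rad_sum_tail:
  fixes a :: "nat \<Rightarrow> 'k::{real_normed_field, euclidean_space}"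
  assumes a: "(\<Sum>i<n. (norm (a i))\<^sup>2) \<le> 1"
  shows "measure M {s \<in> A. t < norm (\<Sum>i<n. a i * rad i s)}
    \<le> measure M A * (2 * DIM('k) * exp 1) * exp (- t / DIM('k))"
proof -
  let ?v = "\<lambda>j. norm (signed_sum a n j)"
  define J where "J = {j. j < 2 ^ n \<and> t < ?v j}"
  have eq: "{s \<in> A. t < norm (\<Sum>i<n. a i * rad i s)} = (\<Union>j\<in>J. cell n j)"
  proof (intro equalityI subsetI)
    fix s assume s: "s \<in> {s \<in> A. t < norm (\<Sum>i<n. a i * rad i s)}"
    then obtain j where j: "j < 2 ^ n" "s \<in> cell n j" using cell_cover by blast
    then have "j \<in> J" using s rad_sum[OF j(2), of a] by (simp add: J_def)
    then show "s \<in> (\<Union>j\<in>J. cell n j)" using j by blast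
  next
    fix s assume "s \<in> (\<Union>j\<in>J. cell n j)"
    then obtain j where j: "j \<in> J" "s \<in> cell n j" by blast
    then show "s \<in> {s \<in> A. t < norm (\<Sum>i<n. a i * rad i s)}"
      using rad_sum[OF j(2), of a] cell_subset[of n j] by (auto simp: J_def)
  qed
  have J: "finite J" by (simp add: J_def)
  have one: "1 \<le> exp (?v j / DIM('k)) * exp (- t / DIM('k))" if "j \<in> J" for j
  proof -
    have "0 \<le> ?v j / DIM('k) + - t / DIM('k)" using that by (simp add: J_def divide_right_mono)
    then show ?thesis by (simp only: exp_add[symmetric] one_le_exp_iff)
  qed
  have "measure M (\<Union>j\<in>J. cell n j) \<le> (\<Sum>j\<in>J. measure M (cell n j))"
    by (rule measure_UNION_le[OF J cell_sets])
  also have "\<dots> = (\<Sum>j\<in>J. measure M A / 2 ^ n * 1)"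
    by (rule sum.cong) (auto simp: J_def cell_measure)
  also have "\<dots> \<le> (\<Sum>j\<in>J. measure M A / 2 ^ n * (exp (?v j / DIM('k)) * exp (- t / DIM('k))))"
    by (intro sum_mono mult_left_mono one) auto
  also have "\<dots> \<le> (\<Sum>j<2 ^ n. measure M A / 2 ^ n * (exp (?v j / DIM('k)) * exp (- t / DIM('k))))"
    by (intro sum_mono2) (auto simp: J_def)
  also have "\<dots> = measure M A / 2 ^ n * exp (- t / DIM('k)) * (\<Sum>j<2 ^ n. exp (?v j / DIM('k)))"
    by (simp add: sum_distrib_left mult_ac)
  also have "\<dots> \<le> measure M A / 2 ^ n * exp (- t / DIM('k)) * (2 ^ n * (2 * DIM('k) * exp 1))"
    by (intro mult_left_mono signed_sum_exp_norm a) auto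
  finally show ?thesis unfolding eq by (simp add: mult_ac)
qed

lemma rad_sum_integral:
  fixes a :: "nat \<Rightarrow> 'k::{real_normed_field, euclidean_space}"
  shows "(\<integral>\<^sup>+ s. ennreal (norm (\<Sum>i<n. a i * rad i s)) \<partial>M)
    = ennreal (measure M A / 2 ^ n * (\<Sum>j<2 ^ n. norm (signed_sum a n j)))"
proof -
  let ?v = "\<lambda>j. norm (signed_sum a n j)"
  have pt: "ennreal (norm (\<Sum>i<n. a i * rad i s)) = (\<Sum>j<2 ^ n. ennreal (?v j) * indicator (cell n j) s)" for s
  proof (cases "s \<in> A")
    case True
    then obtain j where j: "j < 2 ^ n" "s \<in> cell n j" using cell_cover by blast
    have I: "indicator (cell n k) s = (if k = j then 1 else 0 :: ennreal)" for k
    proof (cases "k = j")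
      case False
      then have "s \<notin> cell n k" using cell_disjoint[OF j(2), of k] by metis
      then show ?thesis using False by simp
    qed (use j in simp)
    have "(\<Sum>k<2 ^ n. ennreal (?v k) * indicator (cell n k) s)
        = (\<Sum>k<2 ^ n. if k = j then ennreal (?v j) else 0)"
      by (rule sum.cong) (auto simp: I)
    then show ?thesis using j(1) rad_sum[OF j(2), of a] by simp
  next
    case False
    then have "s \<notin> cell n j" for j using cell_subset by blast
    then show ?thesis using False by (simp add: rad_def)
  qed
  have "emeasure M (cell n j) = ennreal (measure M A / 2 ^ n)" if "j < 2 ^ n" for j
  proof -
    have "emeasure M (cell n j) \<noteq> \<infinity>" using emeasure_mono[OF cell_subset A(1), of n j] A(2) by auto
    then show ?thesis using cell_measure[OF that] by (simp add: emeasure_eq_ennreal_measure)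
  qed
  then have "(\<integral>\<^sup>+ s. ennreal (norm (\<Sum>i<n. a i * rad i s)) \<partial>M)
      = (\<Sum>j<2 ^ n. ennreal (?v j) * ennreal (measure M A / 2 ^ n))"
    unfolding pt using cell_sets by (subst nn_integral_sum) (auto simp: nn_integral_cmult_indicator)
  also have "\<dots> = ennreal (\<Sum>j<2 ^ n. ?v j * (measure M A / 2 ^ n))"
    by (simp add: ennreal_mult[symmetric] sum_nonneg del: times_divide_eq_right)
  finally show ?thesis by (simp add: sum_distrib_left mult.commute del: times_divide_eq_right)
qed

end

section \<open>Exhaustion by bad sets\<close>

text \<open>
  Removing a maximal disjoint family of bad sets leaves no bad subset: such a set could be added to
  the family. The families are finite, so little measure is lost if bad sets are small.
\<close>

lemma avoid_bad_subsets:
  fixes Bad :: "nat \<Rightarrow> 'a set \<Rightarrow> bool" and m :: "nat \<Rightarrow> nat" and \<epsilon> :: "nat \<Rightarrow> real"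
  assumes A: "A \<in> sets M" "emeasure M A < \<infinity>"
    and bad: "\<And>j E. Bad j E \<Longrightarrow> E \<in> sets M \<and> E \<subseteq> A \<and> measure M E \<le> \<epsilon> j"
    and few: "\<And>j E. (\<And>i. i < m j \<Longrightarrow> Bad j (E i)) \<Longrightarrow> disjoint_family_on E {..<m j} \<Longrightarrow> False"
    and \<epsilon>: "\<And>j. 0 \<le> \<epsilon> j" "summable (\<lambda>j. m j * \<epsilon> j)" "(\<Sum>j. m j * \<epsilon> j) < measure M A"
  shows "\<exists>B\<in>sets M. B \<subseteq> A \<and> 0 < measure M B \<and> (\<forall>j E. E \<subseteq> B \<longrightarrow> \<not> Bad j E)"
proof -
  have "\<exists>R\<in>sets M. R \<subseteq> A \<and> emeasure M R \<le> ennreal (m j * \<epsilon> j) \<and> (\<forall>E. Bad j E \<longrightarrow> E \<inter> R \<noteq> {})" for j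
  proof -
    define P where "P n \<longleftrightarrow> (\<exists>E. (\<forall>i<n. Bad j (E i)) \<and> disjoint_family_on E {..<n})" for n :: nat
    have nP: "\<not> P (m j)" using few unfolding P_def by blast
    have P0: "P 0" unfolding P_def by (auto simp: disjoint_family_on_def)
    define n where "n = (LEAST n. \<not> P (Suc n))"
    have ex: "\<exists>n. \<not> P (Suc n)"
    proof (rule ccontr)
      assume "\<not> ?thesis"
      then have "P n" for n using P0 by (cases n) auto
      then show False using nP by blast
    qed
    have n: "\<not> P (Suc n)" unfolding n_def using ex by (rule LeastI_ex)
    have Pk: "P k" if "k \<le> n" for k
    proof (cases k)
      case 0 then show ?thesis using P0 by simp
    next
      case (Suc l)
      then show ?thesis using not_less_Least[of l "\<lambda>n. \<not> P (Suc n)"] that unfolding n_def[symmetric] by simp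
    qed
    then obtain E where E: "\<And>i. i < n \<Longrightarrow> Bad j (E i)" and dj: "disjoint_family_on E {..<n}"
      unfolding P_def by blast
    have nm: "n < m j" using Pk[of "m j"] nP by (meson not_less)
    define R where "R = (\<Union>i<n. E i)"
    have Rm: "R \<in> sets M" unfolding R_def using E bad by auto
    have RA: "R \<subseteq> A" unfolding R_def using E bad by auto
    have fE: "emeasure M (E i) \<le> ennreal (\<epsilon> j)" if "i < n" for i
    proof -
      have "emeasure M (E i) \<le> emeasure M A" using bad[OF E[OF that]] A by (intro emeasure_mono) auto
      then have "emeasure M (E i) = ennreal (measure M (E i))" using A(2)
        by (intro emeasure_eq_ennreal_measure) auto
      then show ?thesis using bad[OF E[OF that]] by (simp add: ennreal_leI)
    qed
    have "emeasure M R \<le> (\<Sum>i<n. emeasure M (E i))"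
      unfolding R_def using E bad by (intro emeasure_subadditive_finite) auto
    also have "\<dots> \<le> (\<Sum>i<n. ennreal (\<epsilon> j))" by (intro sum_mono fE) auto
    also have "\<dots> = ennreal (n * \<epsilon> j)"
      using \<epsilon>(1)[of j] by (simp add: ennreal_mult ennreal_of_nat_eq_real_of_nat)
    also have "\<dots> \<le> ennreal (m j * \<epsilon> j)"
      using nm \<epsilon>(1)[of j] by (intro ennreal_leI mult_right_mono) auto
    finally have Re: "emeasure M R \<le> ennreal (m j * \<epsilon> j)" .
    have meet: "E' \<inter> R \<noteq> {}" if E': "Bad j E'" for E'
    proof
      assume "E' \<inter> R = {}"
      define F where "F i = (if i < n then E i else E')" for i
      have "disjoint_family_on F {..<Suc n}"
        unfolding disjoint_family_on_def
      proof (intro ballI impI)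
        fix i k assume ik: "i \<in> {..<Suc n}" "k \<in> {..<Suc n}" "i \<noteq> k"
        have 1: "E l \<inter> E' = {}" if "l < n" for l using \<open>E' \<inter> R = {}\<close> that by (auto simp: R_def)
        consider "i < n" "k < n" | "i < n" "k = n" | "i = n" "k < n" using ik by force
        then show "F i \<inter> F k = {}"
        proof cases
          case 1
          then show ?thesis using dj ik(3) unfolding F_def disjoint_family_on_def by auto
        qed (use 1[of i] 1[of k] in \<open>auto simp: F_def\<close>)
      qed
      moreover have "\<forall>i<Suc n. Bad j (F i)" using E E' by (simp add: F_def)
      ultimately show False using n unfolding P_def by blast
    qed
    then show ?thesis using Rm RA Re by blast
  qed
  then obtain R where R: "\<And>j. R j \<in> sets M" "\<And>j. R j \<subseteq> A" "\<And>j. emeasure M (R j) \<le> ennreal (m j * \<epsilon> j)"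
    "\<And>j E. Bad j E \<Longrightarrow> E \<inter> R j \<noteq> {}"
    by metis
  define B where "B = A - (\<Union>j. R j)"
  have Bm: "B \<in> sets M" unfolding B_def using A R(1) by auto
  have "emeasure M (\<Union>j. R j) \<le> (\<Sum>j. emeasure M (R j))"
    using R(1) by (intro emeasure_subadditive_countably) auto
  also have "\<dots> \<le> (\<Sum>j. ennreal (m j * \<epsilon> j))" by (intro suminf_le R(3)) auto
  also have "\<dots> = ennreal (\<Sum>j. m j * \<epsilon> j)" using \<epsilon> by (intro suminf_ennreal2) auto
  also have "\<dots> < ennreal (measure M A)"
    using \<epsilon>(3) by (intro ennreal_lessI) (auto intro: le_less_trans[OF suminf_nonneg[OF \<epsilon>(2)]] simp: \<epsilon>(1))
  also have "\<dots> = emeasure M A" using A(2) by (simp add: emeasure_eq_ennreal_measure)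
  finally have lt: "emeasure M (\<Union>j. R j) < emeasure M A" .
  have "emeasure M B \<noteq> 0"
  proof
    assume "emeasure M B = 0"
    have "emeasure M A \<le> emeasure M (B \<union> (\<Union>j. R j))"
      by (rule emeasure_mono) (auto simp: B_def intro!: sets.Un A(1) R(1))
    also have "\<dots> \<le> emeasure M B + emeasure M (\<Union>j. R j)"
      using Bm R(1) by (intro emeasure_subadditive) auto
    finally show False using lt \<open>emeasure M B = 0\<close> by simp
  qed
  moreover have "emeasure M B \<le> emeasure M A" by (intro emeasure_mono A) (auto simp: B_def)
  ultimately have "0 < measure M B" using A(2)
    by (simp add: measure_def enn2real_positive_iff zero_less_iff_neq_zero le_less_trans)
  moreover have "\<not> Bad j E" if "E \<subseteq> B" for j E
    using R(4)[of j E] that unfolding B_def by blast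
  ultimately show ?thesis using Bm by (intro bexI[of _ B]) (auto simp: B_def)
qed

context koethe_lower_estimate
begin

lemma sum_ind_disjoint:
  fixes E :: "nat \<Rightarrow> 'a set"
  assumes "disjoint_family_on E {..<n}"
  shows "(\<Sum>i<n. ind (E i)) = (ind (\<Union>i<n. E i) :: 'a \<Rightarrow> 'k)"
proof
  fix s
  show "(\<Sum>i<n. ind (E i)) s = (ind (\<Union>i<n. E i) s :: 'k)"
  proof (cases "\<exists>i<n. s \<in> E i")
    case True
    then obtain i where i: "i < n" "s \<in> E i" by blast
    have "(indicator (E k) s :: 'k) = (if k = i then 1 else 0)" if "k < n" for k
      using assms i that unfolding disjoint_family_on_def by (auto simp: indicator_def)
    then have "(\<Sum>k<n. indicator (E k) s :: 'k) = (\<Sum>k<n. if k = i then 1 else 0 :: 'k)"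
      by (intro sum.cong) auto
    also have "\<dots> = 1" using i by simp
    finally show ?thesis using i by (auto simp: sum_fun_apply indicator_eq_1_iff)
  qed (auto simp: sum_fun_apply indicator_def)
qed

lemma disjoint_inds_lower:
  assumes E: "\<And>i. i < d ^ j \<Longrightarrow> E i \<in> sets M" and fin: "\<And>i. i < d ^ j \<Longrightarrow> ind (E i) \<in> K"
    and t: "\<And>i. i < d ^ j \<Longrightarrow> t \<le> N (ind (E i))" "0 \<le> t"
    and dj: "disjoint_family_on E {..<d ^ j}"
  shows "c0 * 2 ^ j * t \<le> N (ind (\<Union>i<d ^ j. E i))"
  unfolding sum_ind_disjoint[OF dj, symmetric]
proof (rule lower)
  show "ind (E i) s = (0::'k) \<or> ind (E k) s = (0::'k)" if "i < d ^ j" "k < d ^ j" "i \<noteq> k" for i k s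
    using dj that unfolding disjoint_family_on_def by (auto simp: indicator_def)
qed (use fin t in auto)

text \<open>
  On a suitable subset the norms of indicators decay like a power of the measure: disjoint sets of
  small measure and large norm are few by the lower estimate.
\<close>

lemma indicator_norm_decay:
  assumes A: "A \<in> sets M" "emeasure M A < \<infinity>" "0 < measure M A"
  shows "\<exists>B\<in>sets M. B \<subseteq> A \<and> 0 < measure M B \<and> (\<exists>\<sigma>>0. \<exists>\<Gamma>>0. \<forall>E\<in>sets M. \<forall>j. E \<subseteq> B \<longrightarrow>
    measure M E \<le> \<sigma> * (1 / (4 * d)) ^ j \<longrightarrow> N (ind E) \<le> \<Gamma> * (1/2) ^ j)"
proof -
  define \<Gamma> where "\<Gamma> = (N (ind A) + 1) / c0"
  define \<sigma> where "\<sigma> = measure M A / 2"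
  define \<epsilon> where "\<epsilon> j = \<sigma> * (1 / (4 * d)) ^ j" for j
  define Bad where "Bad j E \<longleftrightarrow> E \<in> sets M \<and> E \<subseteq> A \<and> measure M E \<le> \<epsilon> j \<and> \<Gamma> * (1/2) ^ j < N (ind E)" for j E
  have AK: "ind A \<in> K" using A by (intro indicator_mem)
  have indK: "ind E \<in> K" "N (ind E) \<le> N (ind A)" if "E \<in> sets M" "E \<subseteq> A" for E
    using ind_mono[OF that AK] .
  have \<Gamma>: "\<Gamma> > 0" using N_nonneg[OF AK] c0 by (simp add: \<Gamma>_def)
  have "\<exists>B\<in>sets M. B \<subseteq> A \<and> 0 < measure M B \<and> (\<forall>j E. E \<subseteq> B \<longrightarrow> \<not> Bad j E)"
  proof (rule avoid_bad_subsets[where m = "\<lambda>j. d ^ j" and \<epsilon> = \<epsilon>])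
    fix j E assume bad: "\<And>i. i < d ^ j \<Longrightarrow> Bad j (E i)" and dj: "disjoint_family_on E {..<d ^ j}"
    have E: "E i \<in> sets M" "E i \<subseteq> A" "\<Gamma> * (1/2) ^ j \<le> N (ind (E i))" if "i < d ^ j" for i
      using bad[OF that] by (auto simp: Bad_def)
    have "c0 * 2 ^ j * (\<Gamma> * (1/2) ^ j) \<le> N (ind (\<Union>i<d ^ j. E i))"
      using E indK \<Gamma> by (intro disjoint_inds_lower dj) auto
    also have "\<dots> \<le> N (ind A)" using E by (intro indK) auto
    also have "c0 * 2 ^ j * (\<Gamma> * (1/2) ^ j) = N (ind A) + 1"
      using c0 by (simp add: \<Gamma>_def power_divide)
    finally show False by simp
  next
    have eq: "real (d ^ j) * \<epsilon> j = \<sigma> * (1/4) ^ j" for j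
      using d by (simp add: \<epsilon>_def power_divide power_mult_distrib)
    have s: "(\<lambda>j. \<sigma> * (1/4::real) ^ j) sums (\<sigma> * (1 / (1 - 1/4)))"
      by (intro sums_mult geometric_sums) simp
    show "summable (\<lambda>j. real (d ^ j) * \<epsilon> j)" unfolding eq using s by (rule sums_summable)
    show "(\<Sum>j. real (d ^ j) * \<epsilon> j) < measure M A"
      unfolding eq sums_unique[OF s, symmetric] using A(3) by (simp add: \<sigma>_def)
  qed (use A in \<open>auto simp: Bad_def \<epsilon>_def \<sigma>_def\<close>)
  then obtain B where B: "B \<in> sets M" "B \<subseteq> A" "0 < measure M B" "\<And>j E. E \<subseteq> B \<Longrightarrow> \<not> Bad j E"
    by blast
  have "N (ind E) \<le> \<Gamma> * (1/2) ^ j" if "E \<in> sets M" "E \<subseteq> B" "measure M E \<le> \<sigma> * (1 / (4 * d)) ^ j" for E j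
    using B(4)[OF that(2), of j] that B(2) unfolding Bad_def \<epsilon>_def by (meson not_le order_trans)
  moreover have "\<sigma> > 0" using A by (simp add: \<sigma>_def)
  ultimately show ?thesis using B \<Gamma> by (intro bexI[of _ B] conjI exI[of _ \<sigma>] exI[of _ \<Gamma>]) auto
qed

end

context koethe_centralizer
begin

text \<open>
  A set \<open>E i\<close> is bad if \<open>\<Omega> (ind (E i))\<close> exceeds \<open>h\<close> on a subset \<open>G i\<close> that carries half of its norm.
  Let \<open>U\<close> be the union of the \<open>G i\<close>. On \<open>G i\<close> the functions \<open>\<Omega> (ind (E i))\<close> and \<open>\<Omega> (ind U)\<close> both differ
  from \<open>\<Omega> (ind (G i))\<close>, in norm, by at most a multiple of \<open>N (ind U)\<close>. If \<open>h\<close> is large compared with the number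
  of sets, \<open>\<Omega> (ind U)\<close> therefore exceeds \<open>h / 2\<close> on most of \<open>U\<close>. Since \<open>N (ind U)\<close> is large by the lower
  estimate, this contradicts the bound for \<open>\<Omega> (ind U)\<close>.
\<close>

lemma few_disjoint_large_sets:
  assumes Am: "A \<in> sets M" "emeasure M A < \<infinity>"
    and C4: "\<And>E. E \<in> sets M \<Longrightarrow> E \<subseteq> A \<Longrightarrow> cut E (\<Omega> (ind E)) \<in> K \<and> N (cut E (\<Omega> (ind E))) \<le> C4"
    and h: "h > 0" "24 * \<kappa> ^ 3 * C * d ^ j \<le> h" "16 * \<kappa> * C4 < h * c0 * (2 ^ j * t)" and t: "t > 0"
    and E: "\<And>i. i < d ^ j \<Longrightarrow> E i \<in> sets M" "\<And>i. i < d ^ j \<Longrightarrow> E i \<subseteq> A"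
      "\<And>i. i < d ^ j \<Longrightarrow> t \<le> N (ind (E i))" "disjoint_family_on E {..<d ^ j}"
    and G: "\<And>i. i < d ^ j \<Longrightarrow> G i \<in> sets M" "\<And>i. i < d ^ j \<Longrightarrow> G i \<subseteq> E i"
      "\<And>i s. i < d ^ j \<Longrightarrow> s \<in> G i \<Longrightarrow> h < norm (\<Omega> (ind (E i)) s)"
      "\<And>i. i < d ^ j \<Longrightarrow> N (ind (E i)) \<le> 2 * N (ind (G i))"
  shows False
proof -
  have AK: "ind A \<in> K" using Am by (intro indicator_mem)
  have indK: "ind E \<in> K" if "E \<in> sets M" "E \<subseteq> A" for E
    using ind_mono[OF that AK] by blast
  have \<kappa>0: "\<kappa> > 0" using kappa by simp
  define U where "U = (\<Union>i<d ^ j. G i)"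
  have U: "U \<in> sets M" unfolding U_def using G(1) by auto
  have UA: "U \<subseteq> A" unfolding U_def using order_trans[OF G(2) E(2)] by (intro UN_least) auto
  note U = U UA
  have UK: "ind U \<in> K" by (rule indK[OF U])
  have GU: "G i \<subseteq> U" if "i < d ^ j" for i using that by (auto simp: U_def)
  have GA: "G i \<subseteq> A" if "i < d ^ j" for i using GU[OF that] U by blast
  have Gdj: "disjoint_family_on G {..<d ^ j}"
    using E(4) G(2) unfolding disjoint_family_on_def by (metis (no_types, lifting) Int_mono lessThan_iff subset_empty)
  have NU: "c0 * 2 ^ j * (t / 2) \<le> N (ind U)" unfolding U_def
  proof (rule disjoint_inds_lower[OF G(1) _ _ _ Gdj])
    show "t / 2 \<le> N (ind (G i))" if "i < d ^ j" for i using E(3)[OF that] G(4)[OF that] by linarith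
  qed (use t G GA indK in auto)
  have NU0: "N (ind U) > 0" using NU c0 t by (smt (verit) divide_pos_pos mult_pos_pos zero_less_power)
  \<comment> \<open>the exceptional set, where \<open>\<Omega> (ind U)\<close> is far from \<open>\<Omega> (ind (E i))\<close>\<close>
  define F where "F = {s \<in> U. norm (\<Omega> (ind U) s) \<le> h / 2}"
  have Om: "\<Omega> (ind U) \<in> borel_measurable M" by (rule Omega_measurable[OF UK])
  have "F = {s \<in> space M. norm (\<Omega> (ind U) s) \<le> h / 2} \<inter> U"
    unfolding F_def using sets.sets_into_space[OF U(1)] by auto
  then have F: "F \<in> sets M" using Om U by auto
  have part: "N (ind (F \<inter> G i)) \<le> 6 * \<kappa> * C / h * N (ind U)" if i: "i < d ^ j" for i
  proof -
    define u where "u = \<Omega> (cut (G i) (ind (E i))) - cut (G i) (\<Omega> (ind (E i)))"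
    define v where "v = \<Omega> (cut (G i) (ind U)) - cut (G i) (\<Omega> (ind U))"
    have EK: "ind (E i) \<in> K" using E i by (intro indK)
    have u: "u \<in> K" "N u \<le> C * N (ind (E i))" unfolding u_def by (rule Omega_cut[OF G(1)[OF i] EK])+
    have v: "v \<in> K" "N v \<le> C * N (ind U)" unfolding v_def by (rule Omega_cut[OF G(1)[OF i] UK])+
    have eq: "cut (G i) (ind (E i)) = (ind (G i) :: 'a \<Rightarrow> 'k)" "cut (G i) (ind U) = (ind (G i) :: 'a \<Rightarrow> 'k)"
      using G(2)[OF i] GU[OF i] by (simp_all add: cut_ind Int_absorb2)
    have vu: "(v - u) s = \<Omega> (ind (E i)) s - \<Omega> (ind U) s" if "s \<in> G i" for s
      using that by (simp add: u_def v_def eq cut_apply)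
    have big: "norm (ind (F \<inter> G i) s :: 'k) \<le> (2 / h) * norm ((v - u) s)" for s
    proof (cases "s \<in> F \<inter> G i")
      case True
      then have "h < norm (\<Omega> (ind (E i)) s)" "norm (\<Omega> (ind U) s) \<le> h / 2"
        using G(3)[OF i] by (auto simp: F_def)
      then have "h / 2 \<le> norm ((v - u) s)"
        using vu[of s] True norm_triangle_ineq2[of "\<Omega> (ind (E i)) s" "\<Omega> (ind U) s"] by simp
      then show ?thesis using True h(1) by (simp add: field_simps)
    qed (use h(1) in auto)
    have "N (ind (F \<inter> G i)) \<le> (2 / h) * N (v - u)"
      by (rule dominated(2)) (use F G(1)[OF i] big h(1) u v K_diff in auto)
    also have "\<dots> \<le> (2 / h) * (\<kappa> * (C * N (ind U) + C * (2 * N (ind U))))"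
    proof (intro mult_left_mono order_trans[OF N_diff_le[OF v(1) u(1)]] add_mono v(2) order_trans[OF u(2)])
      have "N (ind (G i)) \<le> N (ind U)" using ind_mono[OF G(1)[OF i] GU[OF i] UK] by blast
      then show "N (ind (E i)) \<le> 2 * N (ind U)" using G(4)[OF i] by linarith
    qed (use h(1) C \<kappa>0 in auto)
    also have "\<dots> = 6 * \<kappa> * C / h * N (ind U)" by (simp add: field_simps)
    finally show ?thesis .
  qed
  have FU: "F = (\<Union>i<d ^ j. F \<inter> G i)" by (auto simp: F_def U_def)
  have Fdj: "disjoint_family_on (\<lambda>i. F \<inter> G i) {..<d ^ j}"
    using Gdj unfolding disjoint_family_on_def by blast
  have "N (ind F) = N (\<Sum>i<d ^ j. ind (F \<inter> G i))"
    using sum_ind_disjoint[OF Fdj] FU by simp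
  also have "\<dots> \<le> \<kappa> * (\<Sum>i<d ^ j. N (ind (F \<inter> G i)))"
    by (rule N_sum) (use F G(1) GA in \<open>auto intro!: indK\<close>)
  also have "\<dots> \<le> \<kappa> * (\<Sum>i<d ^ j. 6 * \<kappa> * C / h * N (ind U))"
    using part \<kappa>0 by (intro mult_left_mono sum_mono) auto
  also have "\<dots> = (6 * \<kappa>\<^sup>2 * C * d ^ j / h) * N (ind U)"
    by (simp add: power2_eq_square)
  also have "\<dots> \<le> (1 / (4 * \<kappa>)) * N (ind U)"
  proof (intro mult_right_mono)
    show "6 * \<kappa>\<^sup>2 * C * d ^ j / h \<le> 1 / (4 * \<kappa>)"
      using h(1,2) \<kappa>0 by (simp add: field_simps power2_eq_square power3_eq_cube)
  qed (use NU0 in auto)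
  finally have NF: "N (ind F) \<le> (1 / (4 * \<kappa>)) * N (ind U)" .
  have UF: "U - F \<in> sets M" "U - F \<subseteq> A" using U F by auto
  have FK: "ind F \<in> K" by (rule indK[OF F]) (use U in \<open>auto simp: F_def\<close>)
  have "(ind U :: 'a \<Rightarrow> 'k) = ind F + ind (U - F)" by (auto simp: fun_eq_iff indicator_def F_def)
  then have "N (ind U) \<le> \<kappa> * (N (ind F) + N (ind (U - F)))"
    using N_add_le[OF FK indK[OF UF]] by simp
  also have "\<dots> \<le> \<kappa> * ((1 / (4 * \<kappa>)) * N (ind U) + N (ind (U - F)))"
    using NF \<kappa>0 by (intro mult_left_mono add_right_mono) auto
  finally have N1: "N (ind U) \<le> 2 * \<kappa> * N (ind (U - F))" using \<kappa>0 NU0 by (simp add: distrib_left)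
  have "N (ind (U - F)) \<le> (2 / h) * N (cut U (\<Omega> (ind U)))"
  proof (rule dominated(2))
    show "norm (ind (U - F) s :: 'k) \<le> (2 / h) * norm (cut U (\<Omega> (ind U)) s)" if "s \<in> space M" for s
    proof (cases "s \<in> U - F")
      case True
      then have "h / 2 \<le> norm (\<Omega> (ind U) s)" by (auto simp: F_def)
      then show ?thesis using True h(1) by (simp add: cut_apply field_simps)
    qed (use h(1) in auto)
  qed (use UF C4[OF U] h(1) in auto)
  also have "\<dots> \<le> (2 / h) * C4" using C4[OF U] h(1) by (intro mult_left_mono) auto
  finally have N2: "N (ind (U - F)) \<le> (2 / h) * C4" .
  have "c0 * 2 ^ j * (t / 2) \<le> 2 * \<kappa> * ((2 / h) * C4)"
    using NU N1 N2 \<kappa>0 by (smt (verit) mult_left_mono)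
  then have "h * (c0 * 2 ^ j * (t / 2)) \<le> h * (2 * \<kappa> * ((2 / h) * C4))" using h(1) by (intro mult_left_mono) auto
  then have "h * c0 * (2 ^ j * t) \<le> 8 * \<kappa> * C4" using h(1) by (simp add: field_simps)
  moreover have "0 \<le> C4" using C4[OF U] N_nonneg[of "cut U (\<Omega> (ind U))"] by linarith
  then have "8 * \<kappa> * C4 \<le> 16 * \<kappa> * C4" using \<kappa>0 by (intro mult_right_mono) auto
  ultimately show False using h(3) by linarith
qed

end

lemma powr_of_power: "0 \<le> x \<Longrightarrow> (x ^ i) powr a = (x powr a) ^ i" for x a :: real
  by (induction i) (auto simp: powr_mult)

context koethe_centralizer
begin

text \<open>
  Let \<open>\<beta> = 4 d\<close>. The bad sets are sorted by their norm: those of level \<open>i\<close> have norm about \<open>\<beta>\<close> to the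
  power \<open>- i\<close> and hence measure at most a multiple of that, while a disjoint family has fewer than
  \<open>d ^ i\<close> members. Their total measure is of the order \<open>(1/4) ^ i\<close>, so avoiding all levels from
  \<open>J0\<close> on costs little. The exponent \<open>\<alpha>\<close> is determined by \<open>\<beta> powr \<alpha> = 2\<close>: then the threshold
  \<open>H * N (ind E) powr (\<alpha> - 1)\<close> at level \<open>i\<close> is about \<open>(2 * d) ^ i\<close>, which is large enough
  compared with the number \<open>d ^ i\<close> of sets and, multiplied by the norm of their union, with the
  bound \<open>C4\<close>.

  For a set \<open>E\<close> without bad subsets, the part \<open>G E\<close> above the threshold has at most half the norm of
  \<open>E\<close>. Passing from \<open>E\<close> to \<open>G E\<close> again and again gives layers with geometrically decreasing
  contributions.
\<close>

lemma Omega_indicator_decay: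
  assumes A: "A \<in> sets M" "emeasure M A < \<infinity>" "0 < measure M A"
    and \<delta>: "0 < \<delta>" "\<And>E. E \<in> sets M \<Longrightarrow> E \<subseteq> A \<Longrightarrow> \<delta> * measure M E \<le> N (ind E)"
    and C4: "\<And>E. E \<in> sets M \<Longrightarrow> E \<subseteq> A \<Longrightarrow> cut E (\<Omega> (ind E)) \<in> K \<and> N (cut E (\<Omega> (ind E))) \<le> C4"
  shows "\<exists>B\<in>sets M. B \<subseteq> A \<and> 0 < measure M B \<and> (\<exists>\<alpha>. 0 < \<alpha> \<and> \<alpha> \<le> 1 \<and> (\<exists>\<Gamma>>0. \<forall>E\<in>sets M. E \<subseteq> B \<longrightarrow>
    N (cut E (\<Omega> (ind E))) \<le> \<Gamma> * N (ind E) powr \<alpha>))"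
proof -
  have AK: "ind A \<in> K" using A by (intro indicator_mem)
  have indK: "ind E \<in> K" if "E \<in> sets M" "E \<subseteq> A" for E
    using ind_mono[OF that AK] by blast
  have \<kappa>0: "\<kappa> > 0" using kappa by simp
  have C40: "0 \<le> C4" using C4[of A] A N_nonneg[of "cut A (\<Omega> (ind A))"] by force
  have d0: "real d \<ge> 2" using d by simp
  define \<beta> where "\<beta> = 4 * real d"
  have \<beta>: "\<beta> \<ge> 8" using d0 by (simp add: \<beta>_def)
  define \<alpha> where "\<alpha> = ln 2 / ln \<beta>"
  have lb: "ln \<beta> > 0" using \<beta> by simp
  have "ln 2 < ln \<beta>" using \<beta> by simp
  then have \<alpha>: "0 < \<alpha>" "\<alpha> < 1" using lb by (auto simp: \<alpha>_def)
  have \<beta>\<alpha>: "\<beta> powr \<alpha> = 2" using \<beta> lb by (simp add: powr_def \<alpha>_def)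
  define t where "t i = (1 / \<beta>) ^ i" for i :: nat
  have t0: "t i > 0" for i using \<beta> by (simp add: t_def)
  have tS: "t i = \<beta> * t (Suc i)" for i using \<beta> by (simp add: t_def)
  define H where "H = 48 * \<kappa> ^ 3 * C * d + 32 * \<kappa> * C4 * d / c0 + 1"
  have H: "H > 0" "48 * \<kappa> ^ 3 * C * d \<le> H" "32 * \<kappa> * C4 * d / c0 < H"
  proof -
    have "0 \<le> 48 * \<kappa> ^ 3 * C * d" "0 \<le> 32 * \<kappa> * C4 * d / c0" using \<kappa>0 C C40 c0 by auto
    then show "H > 0" "48 * \<kappa> ^ 3 * C * d \<le> H" "32 * \<kappa> * C4 * d / c0 < H" unfolding H_def by linarith+
  qed
  define h where "h i = H * (2 * d) ^ i / (2 * d)" for i :: nat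
  define G where "G E = {s \<in> E. H * N (ind E) powr (\<alpha> - 1) < norm (\<Omega> (ind E) s)}" for E
  have Gm: "G E \<in> sets M" if "E \<in> sets M" "E \<subseteq> A" for E
  proof -
    have "\<Omega> (ind E) \<in> borel_measurable M" by (rule Omega_measurable[OF indK[OF that]])
    moreover have "G E = {s \<in> space M. H * N (ind E) powr (\<alpha> - 1) < norm (\<Omega> (ind E) s)} \<inter> E"
      unfolding G_def using sets.sets_into_space[OF that(1)] by auto
    ultimately show ?thesis using that by auto
  qed
  have GE: "G E \<subseteq> E" for E by (auto simp: G_def)
  have hle: "h i \<le> H * n powr (\<alpha> - 1)" if "0 < n" "n \<le> \<beta> * t i" for n i
  proof -
    have bt: "\<beta> * t i > 0" using t0[of i] \<beta> by simp
    have b2: "(1 / \<beta>) powr \<alpha> = 1 / 2" using \<beta> by (simp add: powr_divide \<beta>\<alpha>)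
    have "t i powr \<alpha> = (1 / 2) ^ i"
      unfolding t_def b2[symmetric] using \<beta> by (intro powr_of_power) simp
    then have "(\<beta> * t i) powr \<alpha> = 2 * (1 / 2) ^ i"
      using \<beta> t0[of i] by (simp add: powr_mult \<beta>\<alpha>)
    moreover have "(\<beta> * t i) powr (\<alpha> - 1) = (\<beta> * t i) powr \<alpha> / (\<beta> * t i)"
      using bt by (simp add: powr_diff)
    ultimately have "(\<beta> * t i) powr (\<alpha> - 1) = 2 * (1 / 2) ^ i / (\<beta> * t i)" by simp
    also have "(1 / 2) ^ i = (2 * real d) ^ i * t i"
      unfolding t_def power_mult_distrib[symmetric] using d0 by (simp add: \<beta>_def)
    also have "2 * ((2 * real d) ^ i * t i) / (\<beta> * t i) = (2 * d) ^ i / (2 * d)"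
      using t0[of i] by (simp add: \<beta>_def)
    finally have eq: "(\<beta> * t i) powr (\<alpha> - 1) = (2 * d) ^ i / (2 * d)" .
    have "(\<beta> * t i) powr (\<alpha> - 1) \<le> n powr (\<alpha> - 1)"
      using that \<alpha> by (intro powr_mono2') auto
    then have "H * (\<beta> * t i) powr (\<alpha> - 1) \<le> H * n powr (\<alpha> - 1)"
      using H(1) by (intro mult_left_mono) auto
    then show ?thesis unfolding h_def eq by (simp only: times_divide_eq_right)
  qed
  obtain J where J: "(1/4::real) ^ J < measure M A / (\<beta> / \<delta> * 2)"
    using real_arch_pow_inv[of "measure M A / (\<beta> / \<delta> * 2)" "1/4"] A(3) \<beta> \<delta>(1) by auto
  \<comment> \<open>one more than \<open>J\<close>, so that from level \<open>J0\<close> on the indicators have norm at most one\<close>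
  define J0 where "J0 = Suc J"
  define Bad where "Bad j E \<longleftrightarrow> E \<in> sets M \<and> E \<subseteq> A \<and> t (J0 + j) \<le> N (ind E) \<and> N (ind E) \<le> \<beta> * t (J0 + j)
    \<and> N (ind E) \<le> 2 * N (ind (G E))" for j E
  define \<epsilon> where "\<epsilon> j = \<beta> * t (J0 + j) / \<delta>" for j
  have "\<exists>B\<in>sets M. B \<subseteq> A \<and> 0 < measure M B \<and> (\<forall>j E. E \<subseteq> B \<longrightarrow> \<not> Bad j E)"
  proof (rule avoid_bad_subsets[where m = "\<lambda>j. d ^ (J0 + j)" and \<epsilon> = \<epsilon>])
    fix j E assume bad: "\<And>i. i < d ^ (J0 + j) \<Longrightarrow> Bad j (E i)" and dj: "disjoint_family_on E {..<d ^ (J0 + j)}"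
    let ?i = "J0 + j"
    have E: "E i \<in> sets M" "E i \<subseteq> A" "t ?i \<le> N (ind (E i))" "N (ind (E i)) \<le> \<beta> * t ?i"
      "N (ind (E i)) \<le> 2 * N (ind (G (E i)))" if "i < d ^ ?i" for i
      using bad[OF that] by (auto simp: Bad_def)
    show False
    proof (rule few_disjoint_large_sets[OF A(1,2) C4, of "h ?i" ?i "t ?i" E "\<lambda>i. G (E i)"])
      show "0 < h ?i" using H(1) d0 by (simp add: h_def)
      have "24 * \<kappa> ^ 3 * C * d ^ ?i = 48 * \<kappa> ^ 3 * C * d * (d ^ ?i / (2 * d))" using d0 by simp
      also have "\<dots> \<le> H * ((2 * d) ^ ?i / (2 * d))"
        using H d0 \<kappa>0 C by (intro mult_mono divide_right_mono power_mono) auto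
      finally show "24 * \<kappa> ^ 3 * C * real (d ^ ?i) \<le> h ?i"
        unfolding h_def by (simp only: times_divide_eq_right of_nat_power)
      have "(2 * real d) ^ ?i * (2 ^ ?i * t ?i) = 1"
        unfolding t_def power_mult_distrib[symmetric] using d0 by (simp add: \<beta>_def)
      then have "H * c0 / (2 * d) * ((2 * real d) ^ ?i * (2 ^ ?i * t ?i)) = H * c0 / (2 * d)"
        by (simp only: mult_1_right)
      moreover have "h ?i * c0 * (2 ^ ?i * t ?i) = H * c0 / (2 * d) * ((2 * real d) ^ ?i * (2 ^ ?i * t ?i))"
        by (simp add: h_def)
      ultimately have "h ?i * c0 * (2 ^ ?i * t ?i) = H * c0 / (2 * d)" by (simp only:)
      moreover have "16 * \<kappa> * C4 < H * c0 / (2 * d)"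
      proof -
        have "32 * \<kappa> * C4 * d < H * c0" using H(3) c0 by (simp only: pos_divide_less_eq)
        then show ?thesis using d0 by (simp add: pos_less_divide_eq)
      qed
      ultimately show "16 * \<kappa> * C4 < h ?i * c0 * (2 ^ ?i * t ?i)" by simp
      show "0 < t ?i" by (rule t0)
      show "h ?i < norm (\<Omega> (ind (E i)) s)" if "i < d ^ ?i" "s \<in> G (E i)" for i s
      proof -
        have "0 < N (ind (E i))" using E(3)[OF that(1)] t0[of ?i] by linarith
        from hle[OF this E(4)[OF that(1)]] show ?thesis using that(2) by (auto simp: G_def)
      qed
      show "G (E i) \<in> sets M" if "i < d ^ ?i" for i using Gm E that by blast
    qed (use E GE dj in auto)
  next
    have eq: "real (d ^ (J0 + j)) * \<epsilon> j = (\<beta> / \<delta>) * (1/4) ^ J0 * (1/4) ^ j" for j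
    proof -
      have "real (d ^ (J0 + j)) * \<epsilon> j = (\<beta> / \<delta>) * (d * (1 / \<beta>)) ^ (J0 + j)"
        unfolding \<epsilon>_def t_def power_mult_distrib by simp
      also have "d * (1 / \<beta>) = 1 / 4" using d0 by (simp add: \<beta>_def)
      finally show ?thesis by (simp only: power_add mult.assoc)
    qed
    have s: "(\<lambda>j. (\<beta> / \<delta>) * (1/4) ^ J0 * (1/4::real) ^ j) sums ((\<beta> / \<delta>) * (1/4) ^ J0 * (1 / (1 - 1/4)))"
      by (intro sums_mult geometric_sums) simp
    show "summable (\<lambda>j. real (d ^ (J0 + j)) * \<epsilon> j)" unfolding eq using s by (rule sums_summable)
    have pos: "\<beta> / \<delta> > 0" using \<beta> \<delta>(1) by simp
    have gen: "r * (1/4) ^ Suc J * (1 / (1 - 1/4)) \<le> r * 2 * (1/4) ^ J" if "r > 0" for r :: real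
    proof -
      have "0 \<le> r * (1/4) ^ J" using that by simp
      then show ?thesis by (simp add: mult_ac)
    qed
    have "(\<beta> / \<delta>) * (1/4) ^ J0 * (1 / (1 - 1/4)) \<le> (\<beta> / \<delta> * 2) * (1/4) ^ J"
      unfolding J0_def by (rule gen[OF pos])
    also have "\<dots> < measure M A" 
    proof -
      have "0 < \<beta> / \<delta> * 2" using pos by (rule mult_pos_pos) simp
      from J[unfolded pos_less_divide_eq[OF this]] show ?thesis by (simp only: mult.commute)
    qed
    finally show "(\<Sum>j. real (d ^ (J0 + j)) * \<epsilon> j) < measure M A"
      unfolding eq sums_unique[OF s, symmetric] .
    show "0 \<le> \<epsilon> j" for j using t0[of "J0 + j"] \<beta> \<delta>(1) by (simp add: \<epsilon>_def)
    show "E \<in> sets M \<and> E \<subseteq> A \<and> measure M E \<le> \<epsilon> j" if "Bad j E" for j E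
    proof -
      have E: "E \<in> sets M" "E \<subseteq> A" "N (ind E) \<le> \<beta> * t (J0 + j)" using that by (auto simp: Bad_def)
      then have "\<delta> * measure M E \<le> \<beta> * t (J0 + j)" using \<delta>(2)[OF E(1,2)] by linarith
      then show ?thesis using E \<delta>(1) by (simp add: \<epsilon>_def field_simps)
    qed
  qed (use A in auto)
  then obtain B where B: "B \<in> sets M" "B \<subseteq> A" "0 < measure M B" "\<And>j E. E \<subseteq> B \<Longrightarrow> \<not> Bad j E"
    by blast
  define n0 where "n0 = \<beta> * t J0"
  have n0: "0 < n0" "n0 \<le> 1"
  proof -
    show "0 < n0" unfolding n0_def using t0[of J0] \<beta> by simp
    have "n0 = t J" unfolding n0_def J0_def using tS[of J] by simp
    then show "n0 \<le> 1" using \<beta> by (simp add: t_def power_le_one)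
  qed
  have half: "N (ind (G E)) \<le> N (ind E) / 2" if E: "E \<in> sets M" "E \<subseteq> B" "N (ind E) \<le> n0" for E
  proof (cases "N (ind E) = 0")
    case True
    have EA: "E \<subseteq> A" using E B by blast
    show ?thesis using ind_mono(2)[OF Gm[OF E(1) EA] GE indK[OF E(1) EA]] True by simp
  next
    case False
    have EA: "E \<subseteq> A" using E B by blast
    have pos: "0 < N (ind E)" using False N_nonneg[OF indK[OF E(1) EA]] by simp
    define j where "j = (LEAST j. t (J0 + j) \<le> N (ind E))"
    have "\<exists>j. t (J0 + j) \<le> N (ind E)"
    proof -
      obtain j where "(1 / \<beta>) ^ j < N (ind E)" using real_arch_pow_inv[OF pos, of "1 / \<beta>"] \<beta> by auto
      moreover have "t (J0 + j) \<le> (1 / \<beta>) ^ j" unfolding t_def using \<beta> by (intro power_decreasing) auto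
      ultimately show ?thesis by (intro exI[of _ j]) linarith
    qed
    then have j: "t (J0 + j) \<le> N (ind E)" unfolding j_def by (rule LeastI_ex)
    have "N (ind E) \<le> \<beta> * t (J0 + j)"
    proof (cases j)
      case 0 then show ?thesis using E(3) by (simp add: n0_def)
    next
      case (Suc k)
      then have "\<not> t (J0 + k) \<le> N (ind E)" using not_less_Least[of k "\<lambda>j. t (J0 + j) \<le> N (ind E)"]
        unfolding j_def[symmetric] by simp
      then show ?thesis using tS[of "J0 + k"] Suc by simp
    qed
    then have "\<not> N (ind E) \<le> 2 * N (ind (G E))" using B(4)[OF E(2), of j] j E(1) EA unfolding Bad_def by blast
    then show ?thesis by linarith
  qed
  define q where "q = (1/2::real) powr \<alpha>"
  have q: "0 < q" "q < 1"
  proof -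
    show "0 < q" by (simp add: q_def)
    have "(1/2::real) powr \<alpha> < (1/2) powr 0" using \<alpha> by (intro powr_less_mono') auto
    then show "q < 1" by (simp add: q_def)
  qed
  have small: "N (cut E (\<Omega> (ind E))) \<le> \<kappa> ^ 3 * (H / (1 - q) + 2 * C) * N (ind E) powr \<alpha>"
    if E: "E \<in> sets M" "E \<subseteq> B" "N (ind E) \<le> n0" for E
  proof -
    define n where "n = N (ind E)"
    have EA: "E \<subseteq> A" using E B by blast
    have n: "0 \<le> n" "n \<le> n0" using N_nonneg[OF indK[OF E(1) EA]] E(3) by (auto simp: n_def)
    define S where "S = rec_nat E (\<lambda>_. G)"
    have S0: "S 0 = E" and SS: "S (Suc k) = G (S k)" for k by (simp_all add: S_def)
    have SE: "S k \<in> sets M \<and> S k \<subseteq> E" for k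
    proof (induction k)
      case 0 then show ?case using E S0 by simp
    next
      case (Suc k)
      then have "S k \<subseteq> A" using EA by blast
      then show ?case using Suc Gm[of "S k"] GE[of "S k"] by (auto simp: SS)
    qed
    have SK: "ind (S k) \<in> K" for k using SE[of k] EA by (intro indK) auto
    have Sn: "N (ind (S k)) \<le> (1/2) ^ k * n" for k
    proof (induction k)
      case 0 then show ?case by (simp add: S0 n_def)
    next
      case (Suc k)
      have "(1/2) ^ k * n \<le> 1 * n" using n by (intro mult_right_mono power_le_one) auto
      then have "N (ind (S k)) \<le> n0" using Suc n by linarith
      then have "N (ind (S (Suc k))) \<le> N (ind (S k)) / 2"
        unfolding SS using SE[of k] E(2) by (intro half) auto
      then show ?case using Suc by simp
    qed
    have cutS: "cut (S k) (ind E) = (ind (S k) :: 'a \<Rightarrow> 'k)" for k using SE[of k] by (simp add: cut_ind Int_absorb2)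
    have dec: "decseq S" by (intro decseq_SucI) (simp add: SS GE)
    have null: "AE s in M. \<exists>k. s \<notin> S k"
    proof -
      define I where "I = (\<Inter>k. S k)"
      have "I \<subseteq> S 0" by (auto simp: I_def)
      then have IA: "I \<subseteq> A" using S0 EA by blast
      have Im: "I \<in> sets M" unfolding I_def using SE by (intro sets.countable_INT) auto
      note I = Im IA
      have "N (ind I) \<le> 0"
      proof (rule LIMSEQ_le_const)
        have "(\<lambda>k. (1/2::real) ^ k * n) \<longlonglongrightarrow> 0 * n" by (intro tendsto_mult LIMSEQ_power_zero tendsto_const) simp
        then show "(\<lambda>k. (1/2::real) ^ k * n) \<longlonglongrightarrow> 0" by simp
        have "N (ind I) \<le> (1/2) ^ k * n" for k
          using ind_mono(2)[OF I(1) _ SK[of k]] Sn[of k] by (force simp: I_def)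
        then show "\<exists>M. \<forall>k\<ge>M. N (ind I) \<le> (1/2) ^ k * n" by blast
      qed
      then have "N (ind I) = 0" using N_nonneg[OF indK[OF I]] by simp
      then have "AE s in M. (indicator I s :: 'k) = 0" using N_eq_0_iff[OF indK[OF I]] by simp
      then show ?thesis by eventually_elim (auto simp: I_def indicator_def split: if_splits)
    qed
    define b where "b k = H * (n powr \<alpha> * q ^ k)" for k
    have bk: "cut (S k - S (Suc k)) (\<Omega> (cut (S k) (ind E))) \<in> K \<and>
        N (cut (S k - S (Suc k)) (\<Omega> (cut (S k) (ind E)))) \<le> b k" for k
    proof -
      let ?m = "N (ind (S k))"
      have m0: "0 \<le> ?m" by (rule N_nonneg[OF SK])
      have D: "S k - S (Suc k) \<in> sets M" using SE by auto
      have dom: "norm (cut (S k - S (Suc k)) (\<Omega> (ind (S k))) s) \<le> (H * ?m powr (\<alpha> - 1)) * norm (ind (S k) s :: 'k)" for s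
        using H(1) by (auto simp: cut_apply SS G_def intro!: mult_nonneg_nonneg)
      have Hm: "0 \<le> H * ?m powr (\<alpha> - 1)" using H(1) by simp
      note dd = dominated[OF cut_measurable[OF Omega_measurable[OF SK] D] SK dom Hm]
      have "N (cut (S k - S (Suc k)) (\<Omega> (ind (S k)))) \<le> H * ?m powr (\<alpha> - 1) * ?m" by (rule dd(2))
      also have "\<dots> = H * ?m powr \<alpha>" using m0 by (cases "?m = 0") (auto simp: powr_diff)
      also have "\<dots> \<le> H * ((1/2) ^ k * n) powr \<alpha>"
        using H(1) m0 Sn[of k] \<alpha> by (intro mult_left_mono powr_mono2) auto
      also have "((1/2) ^ k * n) powr \<alpha> = n powr \<alpha> * q ^ k"
      proof -
        have "((1/2::real) ^ k) powr \<alpha> = q ^ k"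
          unfolding q_def by (rule powr_of_power) simp
        then show ?thesis using n by (simp add: powr_mult)
      qed
      finally show ?thesis unfolding cutS b_def using dd(1) by simp
    qed
    have sum: "(\<Sum>k<m. b k + C * ((1/2) ^ k * n)) \<le> (H / (1 - q) + 2 * C) * n powr \<alpha>" for m
    proof -
      have g: "(\<Sum>k<m. r ^ k) \<le> 1 / (1 - r)" if "0 \<le> r" "r < 1" for r :: real
        using sum_le_suminf[OF summable_geometric, of r "{..<m}"] suminf_geometric[of r] that by simp
      have "(\<Sum>k<m. b k + C * ((1/2) ^ k * n)) = H * n powr \<alpha> * (\<Sum>k<m. q ^ k) + C * n * (\<Sum>k<m. (1/2) ^ k)"
        by (simp add: b_def sum.distrib sum_distrib_left mult_ac)
      also have "\<dots> \<le> H * n powr \<alpha> * (1 / (1 - q)) + C * n * (1 / (1 - 1/2))"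
        using H(1) C n q by (intro add_mono mult_left_mono g) auto
      also have "\<dots> \<le> H * n powr \<alpha> * (1 / (1 - q)) + C * n powr \<alpha> * 2"
      proof -
        have "n powr 1 \<le> n powr \<alpha>" using n n0 \<alpha> by (intro powr_mono') auto
        then have "n \<le> n powr \<alpha>" using n by simp
        then show ?thesis using C by (simp add: mult_left_mono)
      qed
      finally show ?thesis by (simp add: algebra_simps)
    qed
    have "N (cut (S 0) (\<Omega> (cut (S 0) (ind E)))) \<le> \<kappa> ^ 3 * ((H / (1 - q) + 2 * C) * n powr \<alpha>)"
    proof (rule Omega_layers(2)[where b = b and c = "\<lambda>k. (1/2) ^ k * n", OF indK[OF E(1) EA] _ dec null])
      show "N (cut (S k) (ind E)) \<le> (1/2) ^ k * n" for k unfolding cutS by (rule Sn)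
      show "S k \<in> sets M" for k using SE by blast
      show "cut (S k - S (Suc k)) (\<Omega> (cut (S k) (ind E))) \<in> K"
        "N (cut (S k - S (Suc k)) (\<Omega> (cut (S k) (ind E)))) \<le> b k" for k using bk by auto
      show "(\<Sum>k<m. b k + C * ((1/2) ^ k * n)) \<le> (H / (1 - q) + 2 * C) * n powr \<alpha>" for m by (rule sum)
    qed
    then show ?thesis unfolding cutS unfolding S0 n_def by (simp only: mult.assoc)
  qed
  define \<Gamma> where "\<Gamma> = \<kappa> ^ 3 * (H / (1 - q) + 2 * C) + C4 / n0 powr \<alpha> + 1"
  have p1: "0 \<le> \<kappa> ^ 3 * (H / (1 - q) + 2 * C)" using \<kappa>0 H(1) q C by simp
  have p2: "0 \<le> C4 / n0 powr \<alpha>" using C40 by simp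
  have "N (cut E (\<Omega> (ind E))) \<le> \<Gamma> * N (ind E) powr \<alpha>" if E: "E \<in> sets M" "E \<subseteq> B" for E
  proof (cases "N (ind E) \<le> n0")
    case True
    have "N (cut E (\<Omega> (ind E))) \<le> \<kappa> ^ 3 * (H / (1 - q) + 2 * C) * N (ind E) powr \<alpha>"
      by (rule small[OF E True])
    also have "\<dots> \<le> \<Gamma> * N (ind E) powr \<alpha>" using p2 by (intro mult_right_mono) (auto simp: \<Gamma>_def)
    finally show ?thesis .
  next
    case False
    have "N (cut E (\<Omega> (ind E))) \<le> C4" using C4[of E] E B by auto
    also have "\<dots> = C4 / n0 powr \<alpha> * n0 powr \<alpha>" using n0 by simp
    also have "\<dots> \<le> \<Gamma> * N (ind E) powr \<alpha>"
      using False n0 \<alpha> p1 p2 by (intro mult_mono powr_mono2) (auto simp: \<Gamma>_def)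
    finally show ?thesis .
  qed
  moreover have "\<Gamma> > 0" using p1 p2 by (simp add: \<Gamma>_def)
  ultimately have ex: "\<exists>\<Gamma>>0. \<forall>E\<in>sets M. E \<subseteq> B \<longrightarrow> N (cut E (\<Omega> (ind E))) \<le> \<Gamma> * N (ind E) powr \<alpha>"
    by (intro exI[of _ \<Gamma>]) simp
  have "0 < \<alpha> \<and> \<alpha> \<le> 1" using \<alpha> by simp
  with ex have "\<exists>\<alpha>. 0 < \<alpha> \<and> \<alpha> \<le> 1 \<and> (\<exists>\<Gamma>>0. \<forall>E\<in>sets M. E \<subseteq> B \<longrightarrow>
    N (cut E (\<Omega> (ind E))) \<le> \<Gamma> * N (ind E) powr \<alpha>)" by blast
  with B(1-3) show ?thesis by blast
qed

text \<open>
  The two kinds of decay combined. Shrinking the set once more, to measure at most \<open>\<sigma>\<close>, puts all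
  subsets under the case \<open>j = 0\<close>; so the same inequality can be required of all layers of a function.
\<close>

lemma regular_subset:
  assumes na: "nonatomic M"
    and A: "A \<in> sets M" "emeasure M A < \<infinity>" "0 < measure M A"
    and \<delta>: "0 < \<delta>" "\<And>E. E \<in> sets M \<Longrightarrow> E \<subseteq> A \<Longrightarrow> \<delta> * measure M E \<le> N (ind E)"
    and C4: "\<And>E. E \<in> sets M \<Longrightarrow> E \<subseteq> A \<Longrightarrow> cut E (\<Omega> (ind E)) \<in> K \<and> N (cut E (\<Omega> (ind E))) \<le> C4"
  obtains B \<sigma> \<Gamma> q where "B \<in> sets M" "B \<subseteq> A" "0 < measure M B" "measure M B \<le> \<sigma>" "0 < \<Gamma>" "0 < q" "q < 1"
    "\<And>E j. E \<in> sets M \<Longrightarrow> E \<subseteq> B \<Longrightarrow> measure M E \<le> \<sigma> * (1 / (4 * d)) ^ j \<Longrightarrow>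
      N (ind E) \<le> \<Gamma> * q ^ j \<and> N (cut E (\<Omega> (ind E))) \<le> \<Gamma> * q ^ j"
proof -
  obtain B1 \<alpha> \<Gamma>1 where B1: "B1 \<in> sets M" "B1 \<subseteq> A" "0 < measure M B1" and \<alpha>: "0 < \<alpha>" "\<alpha> \<le> 1" and \<Gamma>1: "\<Gamma>1 > 0"
    and D1: "\<forall>E\<in>sets M. E \<subseteq> B1 \<longrightarrow> N (cut E (\<Omega> (ind E))) \<le> \<Gamma>1 * N (ind E) powr \<alpha>"
    using Omega_indicator_decay[OF A \<delta> C4] by blast
  have fB1: "emeasure M B1 < \<infinity>" using emeasure_mono[OF B1(2) A(1)] A(2) by (rule le_less_trans)
  obtain B2 \<sigma> \<Gamma>2 where B2: "B2 \<in> sets M" "B2 \<subseteq> B1" "0 < measure M B2" and \<sigma>: "\<sigma> > 0" and \<Gamma>2: "\<Gamma>2 > 0"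
    and D2: "\<forall>E\<in>sets M. \<forall>j. E \<subseteq> B2 \<longrightarrow> measure M E \<le> \<sigma> * (1 / (4 * d)) ^ j \<longrightarrow> N (ind E) \<le> \<Gamma>2 * (1/2) ^ j"
    using indicator_norm_decay[OF B1(1) fB1 B1(3)] by blast
  have fB2: "emeasure M B2 < \<infinity>" using emeasure_mono[OF B2(2) B1(1)] fB1 by (rule le_less_trans)
  obtain B where B: "B \<in> sets M" "B \<subseteq> B2" "0 < measure M B" "measure M B \<le> \<sigma>"
    using nonatomic_small_subset[OF na B2(1) fB2 B2(3) \<sigma>] by blast
  define q where "q = (1/2::real) powr \<alpha>"
  have q: "0 < q" "q < 1" "1/2 \<le> q"
  proof -
    show "0 < q" by (simp add: q_def)
    have "(1/2::real) powr \<alpha> < (1/2) powr 0" using \<alpha> by (intro powr_less_mono') auto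
    then show "q < 1" by (simp add: q_def)
    have "(1/2::real) powr 1 \<le> (1/2) powr \<alpha>" using \<alpha> by (intro powr_mono') auto
    then show "1/2 \<le> q" by (simp add: q_def)
  qed
  have qk: "((1/2::real) ^ k) powr \<alpha> = q ^ k" for k
    unfolding q_def by (rule powr_of_power) simp
  define \<Gamma> where "\<Gamma> = \<Gamma>2 + \<Gamma>1 * \<Gamma>2 powr \<alpha>"
  have \<Gamma>: "\<Gamma> > 0" using \<Gamma>1 \<Gamma>2 by (simp add: \<Gamma>_def add_pos_pos)
  show ?thesis
  proof (rule that[of B \<sigma> \<Gamma> q])
    fix E j assume E: "E \<in> sets M" "E \<subseteq> B" "measure M E \<le> \<sigma> * (1 / (4 * d)) ^ j"
    have EB: "E \<subseteq> B2" "E \<subseteq> B1" "E \<subseteq> A" using E(2) B(2) B2(2) B1(2) by auto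
    have EK: "ind E \<in> K" using ind_mono[OF E(1) EB(3) indicator_mem[OF A(1,2)]] by blast
    have n: "N (ind E) \<le> \<Gamma>2 * (1/2) ^ j" using D2 E EB by blast
    also have "\<dots> \<le> \<Gamma> * q ^ j"
      using \<Gamma>2 \<Gamma>1 q by (intro mult_mono power_mono) (auto simp: \<Gamma>_def)
    finally have 1: "N (ind E) \<le> \<Gamma> * q ^ j" .
    have "N (cut E (\<Omega> (ind E))) \<le> \<Gamma>1 * N (ind E) powr \<alpha>" using D1 E EB by blast
    also have "\<dots> \<le> \<Gamma>1 * (\<Gamma>2 * (1/2) ^ j) powr \<alpha>"
      using n \<Gamma>1 \<alpha> N_nonneg[OF EK] by (intro mult_left_mono powr_mono2) auto
    also have "\<dots> = \<Gamma>1 * \<Gamma>2 powr \<alpha> * q ^ j" using \<Gamma>2 qk[of j] by (simp add: powr_mult)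
    also have "\<dots> \<le> \<Gamma> * q ^ j" using \<Gamma>2 q by (intro mult_right_mono) (auto simp: \<Gamma>_def)
    finally show "N (ind E) \<le> \<Gamma> * q ^ j \<and> N (cut E (\<Omega> (ind E))) \<le> \<Gamma> * q ^ j" using 1 by simp
  qed (use B B2 B1 \<Gamma> q in auto)
qed

end

section \<open>Functions with thin tails\<close>

lemma linear_times_geometric_le_geometric:
  fixes q :: real assumes q: "0 < q" "q < 1"
  obtains p c where "0 < p" "p < 1" "0 < c" "\<And>j. (real j + 1) * q ^ j \<le> c * p ^ j"
proof -
  define p where "p = (1 + q) / 2"
  define r where "r = q / p"
  have p: "0 < p" "p < 1" "q < p" using q by (auto simp: p_def)
  have r: "0 < r" "r < 1" using p q by (auto simp: r_def)
  have "(real j + 1) * q ^ j \<le> 1 / (1 - r) * p ^ j" for j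
  proof -
    have "(real j + 1) * r ^ j = (\<Sum>i<Suc j. r ^ j)" by simp
    also have "\<dots> \<le> (\<Sum>i<Suc j. r ^ i)" using r by (intro sum_mono power_decreasing) auto
    also have "\<dots> \<le> (\<Sum>i. r ^ i)" using r by (intro sum_le_suminf summable_geometric) auto
    also have "\<dots> = 1 / (1 - r)" using r by (intro suminf_geometric) auto
    finally have "(real j + 1) * r ^ j * p ^ j \<le> 1 / (1 - r) * p ^ j"
      using p by (intro mult_right_mono) auto
    moreover have "r ^ j * p ^ j = q ^ j" using p by (simp add: r_def power_divide)
    ultimately show ?thesis by (simp add: mult.assoc)
  qed
  moreover have "0 < 1 / (1 - r)" using r by simp
  ultimately show ?thesis using that p by blast
qed

context koethe_centralizer
begin

text \<open>
  A function on \<open>B\<close> with sufficiently thin tails is cut into the layers where its modulus lies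
  between \<open>k * L\<close> and \<open>(k + 1) * L\<close>. On a layer, \<open>\<Omega>\<close> is compared with its value on the indicator
  of the layer, and the decay on indicators beats the growth of the levels.
\<close>

lemma thin_tails_bounded:
  assumes B: "B \<in> sets M" "emeasure M B < \<infinity>" and \<Gamma>: "0 < \<Gamma>" and q: "0 < q" "q < 1" and L: "0 < L"
    and est: "\<And>E j. E \<in> sets M \<Longrightarrow> E \<subseteq> B \<Longrightarrow> measure M E \<le> \<sigma> * \<tau> ^ j \<Longrightarrow>
      N (ind E) \<le> \<Gamma> * q ^ j \<and> N (cut E (\<Omega> (ind E))) \<le> \<Gamma> * q ^ j"
    and CK: "\<And>E. E \<in> sets M \<Longrightarrow> E \<subseteq> B \<Longrightarrow> cut E (\<Omega> (ind E)) \<in> K"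
  shows "\<exists>R. \<forall>x\<in>borel_measurable M. (\<forall>s. s \<notin> B \<longrightarrow> x s = 0) \<longrightarrow>
    (\<forall>k. measure M {s \<in> B. real k * L < norm (x s)} \<le> \<sigma> * \<tau> ^ k) \<longrightarrow>
    x \<in> K \<and> N x \<le> R \<and> \<Omega> x \<in> K \<and> N (\<Omega> x) \<le> R"
proof -
  have \<kappa>0: "\<kappa> > 0" using kappa by simp
  have BK: "ind B \<in> K" using B by (intro indicator_mem)
  have indK: "ind E \<in> K" if "E \<in> sets M" "E \<subseteq> B" for E using ind_mono[OF that BK] by blast
  obtain p c where p: "0 < p" "p < 1" and c: "0 < c" and pc: "\<And>j. (real j + 1) * q ^ j \<le> c * p ^ j"
    using linear_times_geometric_le_geometric[OF q] by blast
  define g where "g = L * \<Gamma> * c"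
  have g: "g > 0" using L \<Gamma> c by (simp add: g_def)
  have gk: "(real k + 1) * L * (\<Gamma> * q ^ k) \<le> g * p ^ k" for k
  proof -
    have "(real k + 1) * L * (\<Gamma> * q ^ k) = L * \<Gamma> * ((real k + 1) * q ^ k)" by (simp add: mult_ac)
    also have "\<dots> \<le> L * \<Gamma> * (c * p ^ k)" using L \<Gamma> pc[of k] by (intro mult_left_mono) auto
    finally show ?thesis by (simp add: g_def mult.assoc)
  qed
  define e where "e = \<kappa> * (\<kappa> * (g / (1 - p)))"
  have e: "e \<ge> 0" using \<kappa>0 g p by (simp add: e_def)
  define b where "b = \<kappa> * (\<kappa> * (C * g + g) + C * e)"
  define R1 where "R1 = \<kappa> ^ 3 * ((b + C * e) / (1 - p))"
  define R where "R = e + \<kappa> * (R1 + C * e)"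
  have b: "b \<ge> 0" using \<kappa>0 g C e by (simp add: b_def)
  have R1: "R1 \<ge> 0" using \<kappa>0 b C e p by (simp add: R1_def)
  have main: "x \<in> K \<and> N x \<le> R \<and> \<Omega> x \<in> K \<and> N (\<Omega> x) \<le> R"
    if xm: "x \<in> borel_measurable M" and x0: "\<forall>s. s \<notin> B \<longrightarrow> x s = 0"
      and tail: "\<forall>k. measure M {s \<in> B. real k * L < norm (x s)} \<le> \<sigma> * \<tau> ^ k" for x
  proof -
    define S where "S k = {s \<in> B. real k * L < norm (x s)}" for k :: nat
    define D where "D k = S k - S (Suc k)" for k
    have "S k = {s \<in> space M. real k * L < norm (x s)} \<inter> B" for k
      unfolding S_def using sets.sets_into_space[OF B(1)] by auto
    then have Sm: "S k \<in> sets M" for k using xm B(1) by auto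
    have SB: "S k \<subseteq> B" for k by (auto simp: S_def)
    have Dm: "D k \<in> sets M" "D k \<subseteq> B" for k unfolding D_def using Sm SB by auto
    have mono: "S (Suc k) \<subseteq> S k" for k
    proof
      fix s assume "s \<in> S (Suc k)"
      then have "s \<in> B" "real (Suc k) * L < norm (x s)" by (auto simp: S_def)
      moreover have "real k * L \<le> real (Suc k) * L" using L by (intro mult_right_mono) auto
      ultimately show "s \<in> S k" by (simp add: S_def)
    qed
    have dec: "decseq S" by (intro decseq_SucI mono)
    have ev: "\<exists>k. s \<notin> S k" for s
    proof -
      obtain k :: nat where "norm (x s) / L < k" using reals_Archimedean2 by blast
      then have "norm (x s) < k * L" using L by (simp add: field_simps)
      then show ?thesis by (intro exI[of _ k]) (auto simp: S_def)
    qed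
    have mS: "measure M (D k) \<le> \<sigma> * \<tau> ^ k" for k
    proof -
      have "S k \<in> fmeasurable M"
        using Sm emeasure_mono[OF SB B(1), of k] B(2) by (auto simp: fmeasurable_def le_less_trans)
      then have "measure M (D k) \<le> measure M (S k)"
        using Dm by (intro measure_mono_fmeasurable) (auto simp: D_def)
      also have "\<dots> \<le> \<sigma> * \<tau> ^ k" using tail by (simp add: S_def)
      finally show ?thesis .
    qed
    have eD: "N (ind (D k)) \<le> \<Gamma> * q ^ k" "N (cut (D k) (\<Omega> (ind (D k)))) \<le> \<Gamma> * q ^ k" for k
      using est[OF Dm mS] by auto
    have bd: "norm (x s) \<le> (real k + 1) * L" if "s \<in> D k" for k s
      using that by (auto simp: D_def S_def not_less algebra_simps)
    define y where "y k = cut (D k) x" for k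
    have yb: "norm (y k s) \<le> (real k + 1) * L" for k s
      using bd[of s k] L by (auto simp: y_def cut_apply)
    have ym: "y k \<in> borel_measurable M" for k unfolding y_def by (intro cut_measurable xm Dm)
    have kL: "0 \<le> (real k + 1) * L" for k :: nat using L by simp
    have yind: "y k * ind (D k) = y k" for k by (auto simp: y_def cut_apply fun_eq_iff)
    have ydom: "norm (y k s) \<le> (real k + 1) * L * norm (ind (D k) s :: 'k)" for k s
      using yb[of k s] by (auto simp: y_def cut_apply)
    note yd = dominated[OF ym indK[OF Dm] ydom kL]
    have yK: "y k \<in> K" and yN: "N (y k) \<le> g * p ^ k" for k
    proof -
      show "y k \<in> K" by (rule yd(1))
      have "N (y k) \<le> (real k + 1) * L * N (ind (D k))" by (rule yd(2))
      also have "\<dots> \<le> (real k + 1) * L * (\<Gamma> * q ^ k)" by (intro mult_left_mono eD kL)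
      also have "\<dots> \<le> g * p ^ k" by (rule gk)
      finally show "N (y k) \<le> g * p ^ k" .
    qed
    have part: "cut (space M - S n) (cut (S k) x) = (\<Sum>j\<in>{k..<n}. y j)" for k n
    proof (induction n)
      case 0
      have "S k \<subseteq> S 0" using dec by (simp add: decseq_def)
      then show ?case by (auto simp: cut_apply fun_eq_iff)
    next
      case (Suc n)
      show ?case
      proof (cases "k \<le> n")
        case True
        have "S n \<subseteq> S k" using dec True by (simp add: decseq_def)
        then have "cut (space M - S (Suc n)) (cut (S k) x) = cut (space M - S n) (cut (S k) x) + y n"
          using mono[of n] SB[of n] sets.sets_into_space[OF B(1)]
          by (auto simp: cut_apply fun_eq_iff y_def D_def)
        then show ?thesis using Suc True by simp
      next
        case False
        then have "S k \<subseteq> S (Suc n)" using dec by (simp add: decseq_def)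
        then show ?thesis using False by (auto simp: cut_apply fun_eq_iff)
      qed
    qed
    have SK: "cut (S k) x \<in> K" and SN: "N (cut (S k) x) \<le> e * p ^ k" for k
    proof -
      have inc: "incseq (\<lambda>n. space M - S n)" using dec by (auto simp: incseq_def decseq_def)
      have cK: "cut (space M - S n) (cut (S k) x) \<in> K" for n unfolding part by (intro K_sum yK)
      have cN: "N (cut (space M - S n) (cut (S k) x)) \<le> \<kappa> * (g / (1 - p) * p ^ k)" for n
      proof -
        have "N (cut (space M - S n) (cut (S k) x)) \<le> \<kappa> * (\<Sum>j\<in>{k..<n}. N (y j))"
          unfolding part by (rule N_sum) (auto intro: yK)
        also have "(\<Sum>j\<in>{k..<n}. N (y j)) \<le> (\<Sum>j\<in>{k..<n}. g * p ^ j)" by (intro sum_mono yN)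
        also have "\<dots> \<le> (\<Sum>j\<in>(\<lambda>i. i + k) ` {..<n}. g * p ^ j)"
        proof (rule sum_mono2)
          show "{k..<n} \<subseteq> (\<lambda>i. i + k) ` {..<n}"
          proof
            fix j assume "j \<in> {k..<n}"
            then have "j = j - k + k" "j - k < n" by auto
            then show "j \<in> (\<lambda>i. i + k) ` {..<n}" by blast
          qed
        qed (use g p in auto)
        also have "\<dots> = g * p ^ k * (\<Sum>i<n. p ^ i)"
          by (subst sum.reindex) (auto simp: sum_distrib_left power_add mult_ac)
        also have "(\<Sum>i<n. p ^ i) \<le> (\<Sum>i. p ^ i)" using p by (intro sum_le_suminf summable_geometric) auto
        also have "\<dots> = 1 / (1 - p)" using p by (intro suminf_geometric) auto
        finally show ?thesis using \<kappa>0 g p by (simp add: mult_ac mult_left_mono)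
      qed
      have AE: "AE s in M. \<exists>n. s \<in> space M - S n" using ev by (intro AE_I2) auto
      have Bn: "space M - S n \<in> sets M" for n using Sm by auto
      note F = fatou[OF cut_measurable[OF xm Sm] Bn inc AE cK cN]
      show "cut (S k) x \<in> K" by (rule F(1))
      show "N (cut (S k) x) \<le> e * p ^ k" using F(2) by (simp add: e_def mult.assoc)
    qed
    have lay: "\<Omega> (y k) \<in> K" "N (\<Omega> (y k)) \<le> \<kappa> * (C * g + g) * p ^ k" for k
    proof -
      define u where "u = \<Omega> (y k * ind (D k)) - y k * \<Omega> (ind (D k))"
      define v where "v = y k * \<Omega> (ind (D k))"
      have u: "u \<in> K" "N u \<le> C * ((real k + 1) * L) * N (ind (D k))"
        unfolding u_def by (rule Omega_bounded_mult[OF ym yb indK[OF Dm]])+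
      have vm: "v \<in> borel_measurable M" unfolding v_def times_fun_def
        using ym Omega_measurable[OF indK[OF Dm]] by (intro borel_measurable_times)
      have vdom: "norm (v s) \<le> (real k + 1) * L * norm (cut (D k) (\<Omega> (ind (D k))) s)" for s
        using yb[of k s] by (auto simp: v_def norm_mult cut_apply y_def intro!: mult_right_mono)
      note vd = dominated[OF vm CK[OF Dm] vdom kL]
      have eq: "\<Omega> (y k) = u + v" by (simp add: u_def v_def yind)
      show "\<Omega> (y k) \<in> K" unfolding eq by (intro K_add u vd)
      have "N u \<le> C * ((real k + 1) * L * (\<Gamma> * q ^ k))"
        using u(2) mult_left_mono[OF eD(1) kL, of k k] mult_left_mono[OF _ C] by (smt (verit) mult.assoc)
      also have "\<dots> \<le> C * (g * p ^ k)" using gk C by (intro mult_left_mono)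
      finally have uN: "N u \<le> C * (g * p ^ k)" .
      have "N v \<le> (real k + 1) * L * (\<Gamma> * q ^ k)" using vd(2) mult_left_mono[OF eD(2) kL, of k k] by linarith
      then have vN: "N v \<le> g * p ^ k" using gk[of k] by linarith
      have "N (\<Omega> (y k)) \<le> \<kappa> * (N u + N v)" unfolding eq by (rule N_add_le[OF u(1) vd(1)])
      also have "\<dots> \<le> \<kappa> * (C * (g * p ^ k) + g * p ^ k)"
        using uN vN \<kappa>0 by (intro mult_left_mono add_mono) auto
      finally show "N (\<Omega> (y k)) \<le> \<kappa> * (C * g + g) * p ^ k" by (simp add: algebra_simps)
    qed
    have bl: "cut (S k - S (Suc k)) (\<Omega> (cut (S k) x)) \<in> K \<and>
        N (cut (S k - S (Suc k)) (\<Omega> (cut (S k) x))) \<le> b * p ^ k" for k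
    proof -
      define w where "w = \<Omega> (cut (D k) (cut (S k) x)) - cut (D k) (\<Omega> (cut (S k) x))"
      have w: "w \<in> K" "N w \<le> C * N (cut (S k) x)" unfolding w_def by (rule Omega_cut[OF Dm(1) SK])+
      have cc: "cut (D k) (cut (S k) x) = y k" by (auto simp: y_def D_def cut_apply fun_eq_iff)
      have eq: "cut (S k - S (Suc k)) (\<Omega> (cut (S k) x)) = \<Omega> (y k) - w"
        unfolding w_def cc by (simp add: D_def)
      have "N (\<Omega> (y k) - w) \<le> \<kappa> * (N (\<Omega> (y k)) + N w)" by (rule N_diff_le[OF lay(1) w(1)])
      also have "\<dots> \<le> \<kappa> * (\<kappa> * (C * g + g) * p ^ k + C * (e * p ^ k))"
        using lay(2)[of k] order_trans[OF w(2) mult_left_mono[OF SN C]] \<kappa>0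
        by (intro mult_left_mono add_mono) auto
      also have "\<dots> = b * p ^ k" by (simp add: b_def algebra_simps)
      finally show ?thesis unfolding eq using K_diff[OF lay(1) w(1)] by simp
    qed
    have S0: "cut (S 0) x = x" using x0 by (auto simp: cut_apply fun_eq_iff S_def)
    have xK: "x \<in> K" using SK[of 0] S0 by simp
    have xN: "N x \<le> e" using SN[of 0] S0 by simp
    have sum: "(\<Sum>k<n. b * p ^ k + C * (e * p ^ k)) \<le> (b + C * e) / (1 - p)" for n
    proof -
      have "(\<Sum>k<n. b * p ^ k + C * (e * p ^ k)) = (b + C * e) * (\<Sum>k<n. p ^ k)"
        by (simp add: sum_distrib_left algebra_simps sum.distrib)
      also have "(\<Sum>i<n. p ^ i) \<le> (\<Sum>i. p ^ i)" using p by (intro sum_le_suminf summable_geometric) auto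
      also have "\<dots> = 1 / (1 - p)" using p by (intro suminf_geometric) auto
      finally show ?thesis using b C e by (simp add: mult_left_mono)
    qed
    have AE: "AE s in M. \<exists>k. s \<notin> S k" using ev by (intro AE_I2) auto
    have OL: "cut (S 0) (\<Omega> (cut (S 0) x)) \<in> K" "N (cut (S 0) (\<Omega> (cut (S 0) x))) \<le> R1"
      unfolding R1_def
      by (rule Omega_layers[where b = "\<lambda>k. b * p ^ k" and c = "\<lambda>k. e * p ^ k", OF xK Sm dec AE _ _ SN sum];
          use bl in blast)+
    define z where "z = \<Omega> (cut (S 0) x) - cut (S 0) (\<Omega> x)"
    have z: "z \<in> K" "N z \<le> C * N x" unfolding z_def by (rule Omega_cut[OF Sm xK])+
    have eq: "\<Omega> x = cut (S 0) (\<Omega> (cut (S 0) x)) + z" by (simp add: z_def S0)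
    have "\<Omega> x \<in> K" by (subst eq) (intro K_add OL z)
    moreover have "N (\<Omega> x) \<le> \<kappa> * (N (cut (S 0) (\<Omega> (cut (S 0) x))) + N z)"
      by (subst eq) (rule N_add_le[OF OL(1) z(1)])
    then have "N (\<Omega> x) \<le> \<kappa> * (R1 + C * e)"
      using OL(2) order_trans[OF z(2) mult_left_mono[OF xN C]] \<kappa>0
      by (smt (verit) mult_left_mono)
    ultimately show ?thesis using xK xN e R1 C \<kappa>0 unfolding R_def by (auto intro: add_increasing add_increasing2)
  qed
  then show ?thesis by blast
qed

end

section \<open>Copies of the sequence space l2\<close>

lemma subspace_l2: "fun_vs.subspace (l2_space :: (nat \<Rightarrow> 'k::real_normed_field) set)"
  unfolding fun_vs.subspace_def
proof (intro conjI allI ballI)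
  show "(0 :: nat \<Rightarrow> 'k) \<in> l2_space" by (simp add: l2_space_def)
next
  fix x y :: "nat \<Rightarrow> 'k" assume "x \<in> l2_space" "y \<in> l2_space"
  then have s: "summable (\<lambda>n. 2 * (norm (x n))\<^sup>2 + 2 * (norm (y n))\<^sup>2)"
    unfolding l2_space_def by (intro summable_add summable_mult) auto
  have "(norm (x n + y n))\<^sup>2 \<le> 2 * (norm (x n))\<^sup>2 + 2 * (norm (y n))\<^sup>2" for n
  proof -
    have "(norm (x n + y n))\<^sup>2 \<le> (norm (x n) + norm (y n))\<^sup>2"
      by (intro power_mono norm_triangle_ineq) simp
    also have "\<dots> \<le> 2 * (norm (x n))\<^sup>2 + 2 * (norm (y n))\<^sup>2"
      using zero_le_power2[of "norm (x n) - norm (y n)"] by (simp add: power2_eq_square algebra_simps)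
    finally show ?thesis .
  qed
  then have "summable (\<lambda>n. (norm (x n + y n))\<^sup>2)"
    by (intro summable_comparison_test'[OF s, of 0]) simp
  then show "x + y \<in> l2_space" by (simp add: l2_space_def)
next
  fix c :: 'k and x :: "nat \<Rightarrow> 'k" assume "x \<in> l2_space"
  then have "summable (\<lambda>n. (norm c)\<^sup>2 * (norm (x n))\<^sup>2)"
    unfolding l2_space_def by (intro summable_mult) auto
  then show "fscale c x \<in> l2_space" by (simp add: l2_space_def norm_mult power_mult_distrib)
qed

lemma l2_partial_le:
  assumes "a \<in> l2_space" shows "sqrt (\<Sum>i<n. (norm (a i))\<^sup>2) \<le> l2_norm a"
  using assms unfolding l2_norm_def l2_space_def
  by (intro real_sqrt_le_mono sum_le_suminf) auto

lemma l2_bounded_partial: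
  assumes "\<And>n. (\<Sum>i<n. (norm (a i))\<^sup>2) \<le> e\<^sup>2" "0 \<le> e"
  shows "a \<in> l2_space" "l2_norm a \<le> e"
proof -
  have s: "summable (\<lambda>i. (norm (a i))\<^sup>2)"
    using assms(1) by (intro summableI_nonneg_bounded) auto
  then show "a \<in> l2_space" by (simp add: l2_space_def)
  have "(\<Sum>i. (norm (a i))\<^sup>2) \<le> e\<^sup>2" by (intro suminf_le_const s assms(1))
  then show "l2_norm a \<le> e" unfolding l2_norm_def using assms(2) by (simp add: real_le_lsqrt)
qed

lemma l2_partial_tendsto:
  assumes "a \<in> l2_space" shows "(\<lambda>n. sqrt (\<Sum>i<n. (norm (a i))\<^sup>2)) \<longlonglongrightarrow> l2_norm a"
  using assms unfolding l2_norm_def l2_space_def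
  by (intro tendsto_real_sqrt summable_LIMSEQ) auto

lemma norm_le_l2_norm:
  assumes "a \<in> l2_space" shows "norm (a i) \<le> l2_norm a"
proof -
  have "(norm (a i))\<^sup>2 \<le> (\<Sum>i<Suc i. (norm (a i))\<^sup>2)" by (intro member_le_sum) auto
  then have "norm (a i) \<le> sqrt (\<Sum>i<Suc i. (norm (a i))\<^sup>2)" by (rule real_le_rsqrt)
  then show ?thesis using l2_partial_le[OF assms, of "Suc i"] by linarith
qed

lemma l2_complete:
  fixes a :: "nat \<Rightarrow> nat \<Rightarrow> 'k::{real_normed_field, euclidean_space}"
  assumes a: "\<And>k. a k \<in> l2_space"
    and C: "\<And>e. e > 0 \<Longrightarrow> \<exists>n0. \<forall>m\<ge>n0. \<forall>n\<ge>n0. l2_norm (a m - a n) < e"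
  shows "\<exists>b\<in>l2_space. (\<lambda>k. l2_norm (a k - b)) \<longlonglongrightarrow> 0"
proof -
  have D: "a m - a n \<in> l2_space" for m n by (intro fun_vs.subspace_diff subspace_l2 a)
  have P: "norm (a m i - a n i) \<le> l2_norm (a m - a n)" for m n i
    using norm_le_l2_norm[OF D, of m n i] by simp
  have "Cauchy (\<lambda>m. a m i)" for i
    unfolding Cauchy_iff
  proof (intro allI impI)
    fix e :: real assume "e > 0"
    then obtain n0 where n0: "\<forall>m\<ge>n0. \<forall>n\<ge>n0. l2_norm (a m - a n) < e" using C by blast
    have "norm (a m i - a n i) < e" if "m \<ge> n0" "n \<ge> n0" for m n
      using P[of m i n] n0[rule_format, OF that] by linarith
    then show "\<exists>M. \<forall>m\<ge>M. \<forall>n\<ge>M. norm (a m i - a n i) < e" by blast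
  qed
  then have "\<forall>i. \<exists>l. (\<lambda>m. a m i) \<longlonglongrightarrow> l" by (simp add: Cauchy_convergent convergentD)
  then obtain b where b: "\<And>i. (\<lambda>m. a m i) \<longlonglongrightarrow> b i" by metis
  have unif: "\<exists>n0. \<forall>m\<ge>n0. a m - b \<in> l2_space \<and> l2_norm (a m - b) \<le> e" if e: "e > 0" for e
  proof -
    obtain n0 where n0: "\<forall>m\<ge>n0. \<forall>n\<ge>n0. l2_norm (a m - a n) < e" using C[OF e] by blast
    have "(\<Sum>i<n. (norm ((a m - b) i))\<^sup>2) \<le> e\<^sup>2" if m: "m \<ge> n0" for m n
    proof (rule tendsto_upperbound)
      show "(\<lambda>k. \<Sum>i<n. (norm (a m i - a k i))\<^sup>2) \<longlonglongrightarrow> (\<Sum>i<n. (norm ((a m - b) i))\<^sup>2)"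
        unfolding fun_diff_def by (intro tendsto_intros b)
      have "(\<Sum>i<n. (norm (a m i - a k i))\<^sup>2) \<le> e\<^sup>2" if k: "k \<ge> n0" for k
      proof -
        have "sqrt (\<Sum>i<n. (norm ((a m - a k) i))\<^sup>2) \<le> e"
          using l2_partial_le[OF D[of m k], of n] n0[rule_format, OF m k] by linarith
        then show ?thesis using e by (simp add: sqrt_le_D)
      qed
      then show "\<forall>\<^sub>F k in sequentially. (\<Sum>i<n. (norm (a m i - a k i))\<^sup>2) \<le> e\<^sup>2"
        unfolding eventually_sequentially by blast
    qed simp
    then show ?thesis using e by (intro exI[of _ n0] allI impI conjI l2_bounded_partial) auto
  qed
  obtain n1 where "a n1 - b \<in> l2_space" using unif[of 1] by auto
  with a have "a n1 - (a n1 - b) \<in> l2_space" by (rule fun_vs.subspace_diff[OF subspace_l2])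
  then have bl: "b \<in> l2_space" by simp
  have "(\<lambda>k. l2_norm (a k - b)) \<longlonglongrightarrow> 0"
  proof (rule LIMSEQ_I)
    fix r :: real assume r: "0 < r"
    obtain n0 where n0: "\<forall>m\<ge>n0. a m - b \<in> l2_space \<and> l2_norm (a m - b) \<le> r/2" using unif[of "r/2"] r by auto
    have "norm (l2_norm (a m - b) - 0) < r" if "m \<ge> n0" for m
    proof -
      have l: "l2_norm (a m - b) \<le> r/2" "a m - b \<in> l2_space" using n0 that by auto
      have "0 \<le> l2_norm (a m - b)" using norm_le_l2_norm[OF l(2), of 0] norm_ge_zero order_trans by blast
      then show ?thesis using l(1) r by simp
    qed
    then show "\<exists>no. \<forall>n\<ge>no. norm (l2_norm (a n - b) - 0) < r" by blast
  qed
  with bl show ?thesis by blast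
qed

context koethe_lower_estimate
begin

lemma N_limit_unique:
  assumes "\<And>n. X n \<in> K" "f \<in> K" "g \<in> K" "(\<lambda>n. N (X n - f)) \<longlonglongrightarrow> 0" "(\<lambda>n. N (X n - g)) \<longlonglongrightarrow> 0"
  shows "AE s in M. f s = g s"
proof -
  have D: "f - g \<in> K" using assms by (intro K_diff)
  have "N (f - g) \<le> 0"
  proof (rule tendsto_lowerbound)
    show "(\<lambda>n. \<kappa> * (N (X n - g) + N (X n - f))) \<longlonglongrightarrow> 0"
      using tendsto_mult[OF tendsto_const tendsto_add[OF assms(5,4)], of \<kappa>] by simp
    have "N (f - g) \<le> \<kappa> * (N (X n - g) + N (X n - f))" for n
      using N_diff_le[of "X n - g" "X n - f"] assms K_diff by simp
    then show "\<forall>\<^sub>F n in sequentially. N (f - g) \<le> \<kappa> * (N (X n - g) + N (X n - f))" by simp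
  qed simp
  then have "N (f - g) = 0" using N_nonneg[OF D] by simp
  then have "AE s in M. (f - g) s = 0" using N_eq_0_iff[OF D] by blast
  then show ?thesis by eventually_elim simp
qed

lemma N_limit_add:
  assumes "\<And>n. X n \<in> K" "\<And>n. Y n \<in> K" "f \<in> K" "g \<in> K"
    "(\<lambda>n. N (X n - f)) \<longlonglongrightarrow> 0" "(\<lambda>n. N (Y n - g)) \<longlonglongrightarrow> 0"
  shows "(\<lambda>n. N (X n + Y n - (f + g))) \<longlonglongrightarrow> 0"
proof (rule tendsto_sandwich[OF _ _ tendsto_const])
  show "(\<lambda>n. \<kappa> * (N (X n - f) + N (Y n - g))) \<longlonglongrightarrow> 0"
    using tendsto_mult[OF tendsto_const tendsto_add[OF assms(5,6)], of \<kappa>] by simp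
  have eq: "X n + Y n - (f + g) = (X n - f) + (Y n - g)" for n by simp
  have "N (X n + Y n - (f + g)) \<le> \<kappa> * (N (X n - f) + N (Y n - g))" for n
    unfolding eq using assms by (intro N_add_le K_diff)
  then show "\<forall>\<^sub>F n in sequentially. N (X n + Y n - (f + g)) \<le> \<kappa> * (N (X n - f) + N (Y n - g))" by simp
  have "0 \<le> N (X n + Y n - (f + g))" for n using assms by (intro N_nonneg K_diff K_add)
  then show "\<forall>\<^sub>F n in sequentially. 0 \<le> N (X n + Y n - (f + g))" by simp
qed

lemma N_limit_scale:
  assumes "\<And>n. X n \<in> K" "f \<in> K" "(\<lambda>n. N (X n - f)) \<longlonglongrightarrow> 0"
  shows "(\<lambda>n. N (fscale c (X n) - fscale c f)) \<longlonglongrightarrow> 0"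
proof -
  have "N (fscale c (X n) - fscale c f) = norm c * N (X n - f)" for n
    unfolding fun_vs.scale_right_diff_distrib[symmetric] using assms by (intro N_scale K_diff)
  then show ?thesis using tendsto_mult[OF tendsto_const assms(3), of "norm c"] by simp
qed

text \<open>
  A sequence equivalent to the unit vector basis of l2 spans a closed copy of l2. The closed span
  consists of the limits of the series with square-summable coefficients.
\<close>

lemma l2_basis_spans_l2:
  fixes r :: "nat \<Rightarrow> 'a \<Rightarrow> 'k"
  assumes r: "\<And>i. r i \<in> K" and c1: "c1 > 0"
    and low: "\<And>a n. c1 * sqrt (\<Sum>i<n. (norm (a i))\<^sup>2) \<le> N (\<Sum>i<n. fscale (a i) (r i))"
    and up: "\<And>a n. N (\<Sum>i<n. fscale (a i) (r i)) \<le> C1 * sqrt (\<Sum>i<n. (norm (a i))\<^sup>2)"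
  obtains H T where "closed_subspace K N H" "isomorphic_onto M l2_space l2_norm H N" "\<not> finite_dim_ae M H"
    "\<And>y. y \<in> H \<Longrightarrow> \<exists>a\<in>l2_space. AE s in M. T a s = y s"
    "\<And>a. a \<in> l2_space \<Longrightarrow> T a \<in> K"
    "\<And>a. a \<in> l2_space \<Longrightarrow> (\<lambda>n. N ((\<Sum>i<n. fscale (a i) (r i)) - T a)) \<longlonglongrightarrow> 0"
    "\<And>a. a \<in> l2_space \<Longrightarrow> c1 * l2_norm a \<le> \<kappa> * N (T a)"
proof -
  have \<kappa>0: "\<kappa> > 0" using kappa by simp
  define part where "part a n = (\<Sum>i<n. fscale (a i) (r i))" for a n
  have pK: "part a n \<in> K" for a n unfolding part_def by (intro K_sum K_scale r)
  have padd: "part (a + b) n = part a n + part b n" for a b n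
    unfolding part_def sum.distrib[symmetric] by (rule sum.cong) (auto simp: fun_eq_iff algebra_simps)
  have pscale: "part (fscale c a) n = fscale c (part a n)" for c a n
    unfolding part_def fun_vs.scale_sum_right by (rule sum.cong) (auto simp: fun_eq_iff)
  have pdiff: "part a m - part a n = part (\<lambda>i. if i < n then 0 else a i) m" if "n \<le> m" for a m n
  proof -
    have "part a m = part a n + (\<Sum>i\<in>{n..<m}. fscale (a i) (r i))"
      unfolding part_def using sum.atLeastLessThan_concat[of 0 n m "\<lambda>i. fscale (a i) (r i)"] that
      by (simp add: lessThan_atLeast0)
    moreover have "part (\<lambda>i. if i < n then 0 else a i) m = (\<Sum>i\<in>{n..<m}. fscale (a i) (r i))"
      unfolding part_def by (rule sum.mono_neutral_cong_right) (auto simp: fun_eq_iff)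
    ultimately show ?thesis by simp
  qed
  have C10: "C1 \<ge> 0"
  proof -
    have "c1 * sqrt (\<Sum>i<Suc 0. (norm (1::'k))\<^sup>2) \<le> C1 * sqrt (\<Sum>i<Suc 0. (norm (1::'k))\<^sup>2)"
      by (rule order_trans[OF low[where a = "\<lambda>_. 1" and n = "Suc 0"] up[where a = "\<lambda>_. 1" and n = "Suc 0"]])
    then show ?thesis using c1 by simp
  qed
  have ex: "\<exists>f. f \<in> K \<and> (\<lambda>n. N (part a n - f)) \<longlonglongrightarrow> 0" if a: "a \<in> l2_space" for a
  proof -
    have "\<exists>n0. \<forall>m\<ge>n0. \<forall>n\<ge>n0. N (part a m - part a n) < e" if e: "e > 0" for e
    proof -
      have "(e / (C1 + 1))\<^sup>2 > 0" using e C10 by simp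
      then obtain n0 where n0: "\<forall>m\<ge>n0. \<forall>n. norm (sum (\<lambda>i. (norm (a i))\<^sup>2) {m..<n}) < (e / (C1 + 1))\<^sup>2"
        using a unfolding l2_space_def mem_Collect_eq summable_Cauchy by blast
      have 1: "N (part a m - part a n) < e" if "n0 \<le> n" "n \<le> m" for m n
      proof -
        have "N (part a m - part a n) \<le> C1 * sqrt (\<Sum>i<m. (norm (if i < n then 0 else a i))\<^sup>2)"
          unfolding pdiff[OF that(2)] unfolding part_def by (rule up)
        also have "(\<Sum>i<m. (norm (if i < n then 0 else a i))\<^sup>2) = (\<Sum>i\<in>{n..<m}. (norm (a i))\<^sup>2)"
          by (rule sum.mono_neutral_cong_right) auto
        also have "sqrt \<dots> \<le> e / (C1 + 1)"
          using n0[rule_format, OF that(1), of m] e C10 by (intro real_le_lsqrt) (auto intro: sum_nonneg)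
        then have "C1 * sqrt (\<Sum>i\<in>{n..<m}. (norm (a i))\<^sup>2) \<le> C1 * (e / (C1 + 1))"
          using C10 by (intro mult_left_mono)
        also have "\<dots> < e" using e C10 by (simp add: field_simps)
        finally show ?thesis .
      qed
      have "N (part a m - part a n) < e" if "m \<ge> n0" "n \<ge> n0" for m n
        using 1[of n m] 1[of m n] that N_diff_commute[OF pK pK, of a m a n] by (cases "n \<le> m") auto
      then show ?thesis by blast
    qed
    then show ?thesis using complete[of "part a", OF pK] by blast
  qed
  define T where "T a = (SOME f. f \<in> K \<and> (\<lambda>n. N (part a n - f)) \<longlonglongrightarrow> 0)" for a
  have T: "T a \<in> K" "(\<lambda>n. N (part a n - T a)) \<longlonglongrightarrow> 0" if "a \<in> l2_space" for a
    using someI_ex[OF ex[OF that]] unfolding T_def by auto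
  note l2 = fun_vs.subspace_add[OF subspace_l2] fun_vs.subspace_scale[OF subspace_l2]
    fun_vs.subspace_diff[OF subspace_l2]
  have Tadd: "AE s in M. T (a + b) s = T a s + T b s" if ab: "a \<in> l2_space" "b \<in> l2_space" for a b
  proof -
    have "AE s in M. T (a + b) s = (T a + T b) s"
      by (rule N_limit_unique[of "part (a + b)", OF pK T(1)[OF l2(1)[OF ab]] K_add[OF T(1)[OF ab(1)] T(1)[OF ab(2)]]
            T(2)[OF l2(1)[OF ab]]])
        (unfold padd, rule N_limit_add[OF pK pK T(1)[OF ab(1)] T(1)[OF ab(2)] T(2)[OF ab(1)] T(2)[OF ab(2)]])
    then show ?thesis by simp
  qed
  have Tscale: "AE s in M. T (fscale c a) s = c * T a s" if a: "a \<in> l2_space" for a c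
  proof -
    have "AE s in M. T (fscale c a) s = fscale c (T a) s"
      by (rule N_limit_unique[of "part (fscale c a)", OF pK T(1)[OF l2(2)[OF a]] K_scale[OF T(1)[OF a]]
            T(2)[OF l2(2)[OF a]]])
        (unfold pscale, rule N_limit_scale[OF pK T(1)[OF a] T(2)[OF a]])
    then show ?thesis by simp
  qed
  have Tlow: "c1 * l2_norm a \<le> \<kappa> * N (T a)" if a: "a \<in> l2_space" for a
  proof (rule LIMSEQ_le)
    show "(\<lambda>n. c1 * sqrt (\<Sum>i<n. (norm (a i))\<^sup>2)) \<longlonglongrightarrow> c1 * l2_norm a"
      by (intro tendsto_mult tendsto_const l2_partial_tendsto a)
    show "(\<lambda>n. \<kappa> * (N (part a n - T a) + N (T a))) \<longlonglongrightarrow> \<kappa> * N (T a)"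
      using tendsto_mult[OF tendsto_const tendsto_add[OF T(2)[OF a] tendsto_const], of \<kappa> "N (T a)"] by simp
    have "c1 * sqrt (\<Sum>i<n. (norm (a i))\<^sup>2) \<le> \<kappa> * (N (part a n - T a) + N (T a))" for n
      using low[of a n] N_add_le[OF K_diff[OF pK T(1)[OF a]] T(1)[OF a], of a n] unfolding part_def by simp
    then show "\<exists>N'. \<forall>n\<ge>N'. c1 * sqrt (\<Sum>i<n. (norm (a i))\<^sup>2) \<le> \<kappa> * (N (part a n - T a) + N (T a))" by blast
  qed
  have Tup: "N (T a) \<le> \<kappa> * C1 * l2_norm a" if a: "a \<in> l2_space" for a
  proof (rule tendsto_lowerbound)
    show "(\<lambda>n. \<kappa> * (C1 * l2_norm a + N (part a n - T a))) \<longlonglongrightarrow> \<kappa> * C1 * l2_norm a"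
      using tendsto_mult[OF tendsto_const tendsto_add[OF tendsto_const T(2)[OF a]], of \<kappa> "C1 * l2_norm a"]
      by (simp add: mult.assoc)
    have "N (T a) \<le> \<kappa> * (C1 * l2_norm a + N (part a n - T a))" for n
    proof -
      have "N (part a n) \<le> C1 * sqrt (\<Sum>i<n. (norm (a i))\<^sup>2)" unfolding part_def by (rule up)
      also have "\<dots> \<le> C1 * l2_norm a" using l2_partial_le[OF a] C10 by (intro mult_left_mono)
      finally have "\<kappa> * (N (part a n) + N (part a n - T a)) \<le> \<kappa> * (C1 * l2_norm a + N (part a n - T a))"
        using \<kappa>0 by (intro mult_left_mono add_right_mono) auto
      moreover have "N (T a) \<le> \<kappa> * (N (part a n) + N (part a n - T a))"
        using N_diff_le[OF pK K_diff[OF pK T(1)[OF a]], of a n a n] by simp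
      ultimately show ?thesis by linarith
    qed
    then show "\<forall>\<^sub>F n in sequentially. N (T a) \<le> \<kappa> * (C1 * l2_norm a + N (part a n - T a))" by simp
  qed simp
  define H where "H = {y \<in> K. \<exists>a\<in>l2_space. AE s in M. T a s = y s}"
  have TH: "T a \<in> H" if "a \<in> l2_space" for a unfolding H_def using T(1)[OF that] that by auto
  have z: "0 \<in> l2_space" by (rule fun_vs.subspace_0[OF subspace_l2])
  have subH: "fun_vs.subspace H"
    unfolding fun_vs.subspace_def
  proof (intro conjI ballI allI)
    have "N (T 0) \<le> 0" using Tup[OF z] by (simp add: l2_norm_def)
    then have "N (T 0) = 0" using N_nonneg[OF T(1)[OF z]] by simp
    then have "AE s in M. T 0 s = 0" using N_eq_0_iff[OF T(1)[OF z]] by blast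
    then show "0 \<in> H" unfolding H_def using z K_zero by auto
  next
    fix x y assume "x \<in> H" "y \<in> H"
    then obtain a b where ab: "x \<in> K" "y \<in> K" "a \<in> l2_space" "b \<in> l2_space"
      "AE s in M. T a s = x s" "AE s in M. T b s = y s" unfolding H_def by blast
    have "AE s in M. T (a + b) s = (x + y) s"
      using Tadd[OF ab(3,4)] ab(5,6) by eventually_elim simp
    then show "x + y \<in> H" unfolding H_def using K_add[OF ab(1,2)] l2(1)[OF ab(3,4)] by blast
  next
    fix c x assume "x \<in> H"
    then obtain a where a: "x \<in> K" "a \<in> l2_space" "AE s in M. T a s = x s" unfolding H_def by blast
    have "AE s in M. T (fscale c a) s = fscale c x s"
      using Tscale[OF a(2)] a(3) by eventually_elim simp
    then show "fscale c x \<in> H" unfolding H_def using K_scale[OF a(1)] l2(2)[OF a(2)] by blast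
  qed
  have Tdiff: "AE s in M. T (a - b) s = T a s - T b s" if ab: "a \<in> l2_space" "b \<in> l2_space" for a b
  proof -
    have eq: "a - b = a + fscale (-1) b" by (auto simp: fun_eq_iff)
    show ?thesis unfolding eq
      using Tadd[OF ab(1) l2(2)[OF ab(2), of "-1"]] Tscale[OF ab(2), of "-1"] by eventually_elim simp
  qed
  have clH: "closed_subspace K N H"
    unfolding closed_subspace_def
  proof (intro conjI allI ballI impI)
    show "fun_vs.subspace H" by (rule subH)
    show "H \<subseteq> K" by (auto simp: H_def)
    fix X :: "nat \<Rightarrow> 'a \<Rightarrow> 'k" and x
    assume x: "x \<in> K" and "(\<forall>n. X n \<in> H) \<and> (\<lambda>n. N (X n - x)) \<longlonglongrightarrow> 0"
    then have XH: "\<forall>n. X n \<in> H" and lim: "(\<lambda>n. N (X n - x)) \<longlonglongrightarrow> 0" by auto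
    have "\<forall>n. \<exists>a. a \<in> l2_space \<and> (AE s in M. T a s = X n s)" using XH unfolding H_def by blast
    then obtain a where a: "\<And>n. a n \<in> l2_space" "\<And>n. AE s in M. T (a n) s = X n s" by metis
    have XK: "X n \<in> K" for n using XH by (auto simp: H_def)
    have NT: "N (T (a m - a n)) = N (X m - X n)" for m n
    proof (rule N_cong(2))
      show "T (a m - a n) \<in> borel_measurable M" by (intro K_measurable T l2 a)
      show "X m - X n \<in> K" by (intro K_diff XK)
      show "AE s in M. T (a m - a n) s = (X m - X n) s"
        using Tdiff[OF a(1)[of m] a(1)[of n]] a(2)[of m] a(2)[of n] by eventually_elim simp
    qed
    have "\<exists>b\<in>l2_space. (\<lambda>k. l2_norm (a k - b)) \<longlonglongrightarrow> 0"
    proof (rule l2_complete[OF a(1)])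
      fix e :: real assume e: "e > 0"
      define \<eta> where "\<eta> = c1 * e / (2 * \<kappa> * \<kappa>)"
      have \<eta>: "\<eta> > 0" using e c1 \<kappa>0 by (simp add: \<eta>_def)
      then obtain n0 where n0: "\<forall>n\<ge>n0. norm (N (X n - x) - 0) < \<eta>" using LIMSEQ_D[OF lim \<eta>] by blast
      have "l2_norm (a m - a n) < e" if mn: "m \<ge> n0" "n \<ge> n0" for m n
      proof -
        have "N (X m - x) < \<eta>" "N (X n - x) < \<eta>" using n0 mn by (auto simp: abs_if split: if_splits)
        then have lt: "\<kappa> * (N (X m - x) + N (X n - x)) < \<kappa> * (\<eta> + \<eta>)"
          using \<kappa>0 by (intro mult_strict_left_mono add_strict_mono) auto
        have "N (X m - X n) \<le> \<kappa> * (N (X m - x) + N (X n - x))"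
          using N_diff_le[OF K_diff[OF XK x] K_diff[OF XK x], of m n] by simp
        with lt have "\<kappa> * N (X m - X n) < \<kappa> * (\<kappa> * (\<eta> + \<eta>))"
          using \<kappa>0 by (intro mult_strict_left_mono) linarith+
        moreover have "\<kappa> * (\<kappa> * (\<eta> + \<eta>)) = c1 * e" using \<kappa>0 by (simp add: \<eta>_def)
        moreover have "c1 * l2_norm (a m - a n) \<le> \<kappa> * N (X m - X n)"
          using Tlow[OF l2(3)[OF a(1)[of m] a(1)[of n]]] NT by simp
        ultimately have "c1 * l2_norm (a m - a n) < c1 * e" by linarith
        then show ?thesis using c1 by simp
      qed
      then show "\<exists>n0. \<forall>m\<ge>n0. \<forall>n\<ge>n0. l2_norm (a m - a n) < e" by blast
    qed
    then obtain b where b: "b \<in> l2_space" "(\<lambda>k. l2_norm (a k - b)) \<longlonglongrightarrow> 0" by blast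
    have "(\<lambda>n. N (X n - T b)) \<longlonglongrightarrow> 0"
    proof (rule tendsto_sandwich[OF _ _ tendsto_const])
      show "(\<lambda>n. \<kappa> * C1 * l2_norm (a n - b)) \<longlonglongrightarrow> 0"
        using tendsto_mult[OF tendsto_const b(2), of "\<kappa> * C1"] by simp
      have "N (X n - T b) \<le> \<kappa> * C1 * l2_norm (a n - b)" for n
      proof -
        have "N (T (a n - b)) = N (X n - T b)"
        proof (rule N_cong(2))
          show "T (a n - b) \<in> borel_measurable M" by (intro K_measurable T l2 a b)
          show "X n - T b \<in> K" by (intro K_diff XK T b)
          show "AE s in M. T (a n - b) s = (X n - T b) s"
            using Tdiff[OF a(1)[of n] b(1)] a(2)[of n] by eventually_elim simp
        qed
        then show ?thesis using Tup[OF l2(3)[OF a(1)[of n] b(1)]] by simp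
      qed
      then show "\<forall>\<^sub>F n in sequentially. N (X n - T b) \<le> \<kappa> * C1 * l2_norm (a n - b)" by simp
      have "0 \<le> N (X n - T b)" for n by (intro N_nonneg K_diff XK T b)
      then show "\<forall>\<^sub>F n in sequentially. 0 \<le> N (X n - T b)" by simp
    qed
    from N_limit_unique[OF XK T(1)[OF b(1)] x this lim]
    show "x \<in> H" unfolding H_def using x b(1) by blast
  qed
  have iso: "isomorphic_onto M l2_space l2_norm H N"
    unfolding isomorphic_onto_def
  proof (intro exI[of _ T] conjI)
    show "linear_to_L0 M l2_space T"
      unfolding linear_to_L0_def using T(1) K_measurable Tadd Tscale by auto
    show "T ` l2_space \<subseteq> H" using TH by auto
    show "\<forall>y\<in>H. \<exists>x\<in>l2_space. AE s in M. T x s = y s" by (auto simp: H_def)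
    have "c1 / \<kappa> * l2_norm a \<le> N (T a) \<and> N (T a) \<le> \<kappa> * C1 * l2_norm a" if "a \<in> l2_space" for a
      using Tlow[OF that] Tup[OF that] \<kappa>0 by (simp add: field_simps)
    moreover have "c1 / \<kappa> > 0" using c1 \<kappa>0 by simp
    ultimately show "\<exists>c>0. \<exists>C. \<forall>x\<in>l2_space. c * l2_norm x \<le> N (T x) \<and> N (T x) \<le> C * l2_norm x" by blast
  qed
  have "\<not> finite_dim_ae M H"
  proof
    assume "finite_dim_ae M H"
    then obtain B where B: "finite B" "B \<subseteq> H" and sp: "\<forall>x\<in>H. \<exists>y\<in>fun_vs.span B. AE s in M. x s = y s"
      unfolding finite_dim_ae_def by blast
    have "r i \<in> H" for i
    proof -
      define u :: "nat \<Rightarrow> 'k" where "u j = (if j = i then 1 else 0)" for j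
      have ul: "u \<in> l2_space"
      proof (rule l2_bounded_partial(1)[of _ 1])
        show "(\<Sum>j<n. (norm (u j))\<^sup>2) \<le> 1\<^sup>2" for n
          unfolding u_def by (simp add: if_distrib[of "\<lambda>x. (norm x)\<^sup>2"] cong: if_cong)
      qed simp
      have pu: "part u n = r i" if "n > i" for n
      proof -
        have "part u n = (\<Sum>j<n. if j = i then r i else 0)"
          unfolding part_def by (rule sum.cong) (auto simp: u_def fun_eq_iff)
        then show ?thesis using that by simp
      qed
      have "(\<lambda>n. N (part u n - r i)) \<longlonglongrightarrow> 0"
      proof (rule tendsto_eventually)
        show "\<forall>\<^sub>F n in sequentially. N (part u n - r i) = 0"
          unfolding eventually_sequentially by (intro exI[of _ "Suc i"]) (auto simp: pu N_zero)
      qed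
      then have "AE s in M. T u s = r i s"
        by (intro N_limit_unique[of "part u", OF pK T(1)[OF ul] r T(2)[OF ul]])
      then show ?thesis unfolding H_def using r ul by blast
    qed
    then have "\<forall>i. \<exists>y. y \<in> fun_vs.span B \<and> (AE s in M. r i s = y s)" using sp by blast
    then obtain y where y: "\<And>i. y i \<in> fun_vs.span B" "\<And>i. AE s in M. r i s = y i s" by metis
    have zero: "a i = 0" if "(\<Sum>i<n. fscale (a i) (y i)) = 0" "i < n" for a n i
    proof -
      have ae: "AE s in M. \<forall>i. r i s = y i s" unfolding AE_all_countable using y(2) by blast
      have "AE s in M. part a n s = 0"
        using ae
      proof eventually_elim
        case (elim s)
        have "part a n s = (\<Sum>i<n. fscale (a i) (y i)) s"
          unfolding part_def sum_fun_apply using elim by simp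
        then show ?case using that(1) by simp
      qed
      then have "N (part a n) = 0" using N_eq_0_iff[OF pK] by blast
      then have "c1 * sqrt (\<Sum>i<n. (norm (a i))\<^sup>2) \<le> 0" using low[of a n] unfolding part_def by simp
      then have "(\<Sum>i<n. (norm (a i))\<^sup>2) \<le> 0" using c1 by (simp add: mult_le_0_iff)
      moreover have "(norm (a i))\<^sup>2 \<le> (\<Sum>i<n. (norm (a i))\<^sup>2)" using that(2) by (intro member_le_sum) auto
      ultimately have "(norm (a i))\<^sup>2 \<le> 0" by linarith
      then show ?thesis by simp
    qed
    have inj: "inj_on y {..<n}" for n
    proof (rule inj_onI, rule ccontr)
      fix i j assume ij: "i \<in> {..<n}" "j \<in> {..<n}" "y i = y j" "i \<noteq> j"
      define a :: "nat \<Rightarrow> 'k" where "a k = (if k = i then 1 else 0) - (if k = j then 1 else 0)" for k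
      have "(\<Sum>k<n. fscale (a k) (y k)) = (\<Sum>k<n. (if k = i then y i else 0) - (if k = j then y j else 0))"
        by (rule sum.cong) (auto simp: a_def fun_eq_iff)
      also have "\<dots> = 0" unfolding sum_subtractf using ij by simp
      finally have "a i = 0" using zero ij(1) by blast
      then show False using ij(4) by (simp add: a_def)
    qed
    define n where "n = Suc (card B)"
    have "fun_vs.independent (y ` {..<n})"
      unfolding fun_vs.independent_explicit_finite_subsets
    proof (intro allI impI ballI)
      fix S u v assume S: "S \<subseteq> y ` {..<n}" "finite S" "(\<Sum>v\<in>S. fscale (u v) v) = 0" "v \<in> S"
      define a where "a k = (if y k \<in> S then u (y k) else 0)" for k
      have "(\<Sum>v\<in>S. fscale (u v) v) = (\<Sum>v\<in>y ` {..<n}. fscale (if v \<in> S then u v else 0) v)"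
        using S(1) by (intro sum.mono_neutral_cong_left) (auto simp: fun_eq_iff)
      also have "\<dots> = (\<Sum>k<n. fscale (a k) (y k))"
        unfolding sum.reindex[OF inj] a_def by simp
      finally have z: "(\<Sum>k<n. fscale (a k) (y k)) = 0" using S(3) by simp
      obtain k where k: "k < n" "v = y k" using S by blast
      then have "a k = 0" using zero[OF z] by blast
      then show "u v = 0" using k S(4) by (simp add: a_def)
    qed
    then have "card (y ` {..<n}) \<le> card B"
      using fun_vs.independent_span_bound[OF B(1), of "y ` {..<n}"] y(1) by blast
    then show False using card_image[OF inj[of n]] by (simp add: n_def)
  qed
  with clH iso show ?thesis
  proof (rule that)
    show "\<exists>a\<in>l2_space. AE s in M. T a s = y s" if "y \<in> H" for y using that unfolding H_def by blast
    show "T a \<in> K" "c1 * l2_norm a \<le> \<kappa> * N (T a)" if "a \<in> l2_space" for a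
      using T(1)[OF that] Tlow[OF that] .
    show "(\<lambda>n. N ((\<Sum>i<n. fscale (a i) (r i)) - T a)) \<longlonglongrightarrow> 0" if "a \<in> l2_space" for a
      using T(2)[OF that] unfolding part_def .
  qed
qed

end

section \<open>A copy of l2 on which the centralizer is bounded\<close>

lemma le_mult_of_all_greater:
  fixes x r R :: real
  assumes "\<And>\<rho>. \<rho> > r \<Longrightarrow> x \<le> \<rho> * R" "0 \<le> R"
  shows "x \<le> r * R"
proof (rule field_le_epsilon)
  fix e :: real assume e: "e > 0"
  have "x \<le> (r + e / (R + 1)) * R" using assms e by (intro assms(1)) auto
  also have "\<dots> \<le> r * R + e"
  proof -
    have "e / (R + 1) * R \<le> e" using assms(2) e by (simp add: field_simps)
    then show ?thesis by (simp only: distrib_right)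
  qed
  finally show "x \<le> r * R + e" .
qed

lemma bounded_on_positive_subset:
  assumes A: "A \<in> sets M" "emeasure M A < \<infinity>" "0 < measure M A" and f: "f \<in> borel_measurable M"
  shows "\<exists>n::nat. {s \<in> A. f s \<le> real n} \<in> sets M \<and> 0 < measure M {s \<in> A. f s \<le> real n}"
proof -
  define B where "B n = {s \<in> A. f s \<le> real n}" for n :: nat
  have "B n = {s \<in> space M. f s \<le> real n} \<inter> A" for n
    unfolding B_def using sets.sets_into_space[OF A(1)] by auto
  then have Bm: "B n \<in> sets M" for n using f A(1) by auto
  have "\<exists>n. 0 < measure M (B n)"
  proof (rule ccontr)
    assume "\<not> ?thesis"
    then have z: "measure M (B n) = 0" for n by (simp add: zero_less_measure_iff)
    have "B n \<in> null_sets M" for n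
    proof -
      have "emeasure M (B n) \<le> emeasure M A" by (intro emeasure_mono A) (auto simp: B_def)
      then have "emeasure M (B n) = ennreal (measure M (B n))"
        using A(2) by (intro emeasure_eq_ennreal_measure) auto
      then show ?thesis using z Bm by (simp add: null_sets_def)
    qed
    then have "(\<Union>n. B n) \<in> null_sets M" by (rule null_sets_UN)
    moreover have "(\<Union>n. B n) = A"
    proof -
      have "\<exists>n. s \<in> B n" if "s \<in> A" for s using real_arch_simple[of "f s"] that by (auto simp: B_def)
      then show ?thesis by (auto simp: B_def)
    qed
    ultimately show False using A(3) by (simp add: measure_def null_sets_def)
  qed
  then show ?thesis using Bm unfolding B_def by blast
qed

lemma (in sigma_finite_measure) finite_positive_set:
  fixes h :: "'a \<Rightarrow> real"
  assumes h: "h \<in> borel_measurable M" "AE s in M. 0 < h s" and ne: "emeasure M (space M) \<noteq> 0"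
  shows "\<exists>A\<in>sets M. emeasure M A < \<infinity> \<and> 0 < measure M A \<and> (\<forall>s\<in>A. 0 < h s)"
proof -
  obtain F :: "nat \<Rightarrow> 'a set" where F: "range F \<subseteq> sets M" "(\<Union>i. F i) = space M" "\<And>i. emeasure M (F i) \<noteq> \<infinity>"
    using sigma_finite by blast
  define A where "A i = {s \<in> space M. 0 < h s} \<inter> F i" for i
  have Am: "A i \<in> sets M" for i unfolding A_def using h(1) F(1) by auto
  have fin: "emeasure M (A i) < \<infinity>" for i
  proof -
    have "emeasure M (A i) \<le> emeasure M (F i)" using F(1) by (intro emeasure_mono) (auto simp: A_def)
    then show ?thesis using F(3)[of i] by (auto simp: less_top top_unique)
  qed
  have "\<exists>i. 0 < measure M (A i)"
  proof (rule ccontr)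
    assume "\<not> ?thesis"
    then have z: "measure M (A i) = 0" for i by (simp add: zero_less_measure_iff)
    have "A i \<in> null_sets M" for i
    proof -
      have "emeasure M (A i) = ennreal (measure M (A i))" using fin[of i] by (intro emeasure_eq_ennreal_measure) auto
      then show ?thesis using z Am by (simp add: null_sets_def)
    qed
    then have "(\<Union>i. A i) \<in> null_sets M" by (rule null_sets_UN)
    then have "AE s in M. s \<notin> (\<Union>i. A i)" by (rule AE_not_in)
    with h(2) AE_space have "AE s in M. False"
    proof eventually_elim
      case (elim s)
      then obtain i where "s \<in> F i" using F(2) by blast
      then show ?case using elim by (auto simp: A_def)
    qed
    then have "ae_filter M = bot" by (simp add: trivial_limit_def)
    then show False using ne by (simp add: ae_filter_eq_bot_iff)
  qed
  then obtain i where "0 < measure M (A i)" by blast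
  then show ?thesis using Am fin by (intro bexI[of _ "A i"]) (auto simp: A_def)
qed

context koethe_centralizer
begin

text \<open>
  The set for the Rademacher functions is found in three steps. First the weight \<open>h\<close> is bounded below,
  so that norms dominate integrals; then \<open>\<Omega>\<close> at the indicator of this set is bounded on a subset
  \<open>A1\<close>, which bounds \<open>\<Omega>\<close> at all indicators of subsets of \<open>A1\<close>; finally \<open>regular_subset\<close> applies.
  Tails of infinite Rademacher sums are compared with those of their partial sums by Markov's
  inequality, at the price of doubling the height of the layers.
\<close>

lemma exists_bounded_l2_copy:
  assumes na: "nonatomic M" and ne: "emeasure M (space M) \<noteq> 0"
    and h: "h \<in> borel_measurable M" "AE s in M. 0 < (h s :: real)"
    and hN: "\<And>x. x \<in> K \<Longrightarrow> L1_norm M (\<lambda>s. of_real (h s) * x s) \<le> ennreal (N x)"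
    and ae: "respects_ae M K \<Omega>"
    and hom: "\<And>c x. x \<in> K \<Longrightarrow> AE s in M. \<Omega> (fscale c x) s = c * \<Omega> x s"
  obtains H where "closed_subspace K N H" "isomorphic_onto M l2_space l2_norm H N" "\<not> finite_dim_ae M H"
    "bounded_on K N \<Omega> H"
proof -
  have \<kappa>0: "\<kappa> > 0" using kappa by simp
  obtain A0 where A0: "A0 \<in> sets M" "emeasure M A0 < \<infinity>" "0 < measure M A0" "\<forall>s\<in>A0. 0 < h s"
    using finite_positive_set[OF h ne] by blast
  have "(\<lambda>s. 1 / h s) \<in> borel_measurable M" using h(1) by measurable
  then obtain n1 :: nat where n1: "{s \<in> A0. 1 / h s \<le> real n1} \<in> sets M" "0 < measure M {s \<in> A0. 1 / h s \<le> real n1}"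
    using bounded_on_positive_subset[OF A0(1-3)] by blast
  define A where "A = {s \<in> A0. 1 / h s \<le> real n1}"
  have A: "A \<in> sets M" "0 < measure M A" using n1 by (auto simp: A_def)
  have "emeasure M A \<le> emeasure M A0" by (intro emeasure_mono A0) (auto simp: A_def)
  then have Af: "emeasure M A < \<infinity>" using A0(2) by (rule le_less_trans)
  define \<delta> where "\<delta> = 1 / (real n1 + 1)"
  have \<delta>: "\<delta> > 0" by (simp add: \<delta>_def)
  have h\<delta>: "\<delta> \<le> h s" if "s \<in> A" for s
  proof -
    have "0 < h s" "1 / h s \<le> real n1" using that A0(4) by (auto simp: A_def)
    then have "1 \<le> h s * (real n1 + 1)" by (simp add: field_simps)
    then show ?thesis by (simp add: \<delta>_def field_simps)
  qed
  have L1: "ennreal \<delta> * (\<integral>\<^sup>+ s. ennreal (norm (x s)) * indicator A s \<partial>M) \<le> ennreal (N x)" if x: "x \<in> K" for x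
  proof -
    have [measurable]: "x \<in> borel_measurable M" "A \<in> sets M" by (rule K_measurable[OF x], rule A(1))
    have "ennreal \<delta> * (\<integral>\<^sup>+ s. ennreal (norm (x s)) * indicator A s \<partial>M)
        = (\<integral>\<^sup>+ s. ennreal \<delta> * (ennreal (norm (x s)) * indicator A s) \<partial>M)"
      by (rule nn_integral_cmult[symmetric]) measurable
    also have "\<dots> \<le> (\<integral>\<^sup>+ s. ennreal (norm (of_real (h s) * x s)) \<partial>M)"
    proof (intro nn_integral_mono)
      fix s
      show "ennreal \<delta> * (ennreal (norm (x s)) * indicator A s) \<le> ennreal (norm (of_real (h s) * x s))"
      proof (cases "s \<in> A")
        case True
        have "\<delta> * norm (x s) \<le> norm (of_real (h s) * x s)"
          using h\<delta>[OF True] \<delta> by (simp add: norm_mult mult_right_mono)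
        then show ?thesis using True \<delta> by (simp add: ennreal_mult[symmetric] ennreal_leI)
      qed simp
    qed
    also have "\<dots> \<le> ennreal (N x)" using hN[OF x] by (simp add: L1_norm_def)
    finally show ?thesis .
  qed
  have AK: "ind A \<in> K" by (rule indicator_mem[OF A(1) Af])
  have om: "\<Omega> (ind A) \<in> borel_measurable M" by (rule Omega_measurable[OF AK])
  obtain n2 :: nat where n2: "{s \<in> A. norm (\<Omega> (ind A) s) \<le> real n2} \<in> sets M"
    "0 < measure M {s \<in> A. norm (\<Omega> (ind A) s) \<le> real n2}"
    using bounded_on_positive_subset[OF A(1) Af A(2), of "\<lambda>s. norm (\<Omega> (ind A) s)"] om by auto
  define A1 where "A1 = {s \<in> A. norm (\<Omega> (ind A) s) \<le> real n2}"
  have A1: "A1 \<in> sets M" "0 < measure M A1" "A1 \<subseteq> A" using n2 by (auto simp: A1_def)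
  have A1f: "emeasure M A1 < \<infinity>" using emeasure_mono[OF A1(3) A(1)] Af by (rule le_less_trans)
  have indL1: "\<delta> * measure M E \<le> N (ind E)" if E: "E \<in> sets M" "E \<subseteq> A1" for E
  proof -
    have EA: "E \<subseteq> A" using E A1 by blast
    have EK: "ind E \<in> K" using ind_mono[OF E(1) EA AK] by blast
    have "(\<integral>\<^sup>+ s. ennreal (norm (indicator E s :: 'k)) * indicator A s \<partial>M) = (\<integral>\<^sup>+ s. indicator E s \<partial>M)"
      using EA by (intro nn_integral_cong) (auto simp: indicator_def)
    also have "\<dots> = emeasure M E" using E by simp
    also have "\<dots> = ennreal (measure M E)"
      using emeasure_mono[OF EA A(1)] Af by (intro emeasure_eq_ennreal_measure) auto
    finally have "ennreal \<delta> * ennreal (measure M E) \<le> ennreal (N (ind E))" using L1[OF EK] by simp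
    then show ?thesis using \<delta> N_nonneg[OF EK] by (simp add: ennreal_mult[symmetric])
  qed
  define C4 where "C4 = \<kappa> * (C * N (ind A) + real n2 * N (ind A))"
  have C4: "cut E (\<Omega> (ind E)) \<in> K \<and> N (cut E (\<Omega> (ind E))) \<le> C4" if E: "E \<in> sets M" "E \<subseteq> A1" for E
  proof -
    define u where "u = \<Omega> (cut E (ind A)) - cut E (\<Omega> (ind A))"
    define v where "v = cut E (\<Omega> (ind A))"
    have EA: "E \<subseteq> A" using E A1 by blast
    have cE: "cut E (ind A) = (ind E :: 'a \<Rightarrow> 'k)" using EA by (simp add: cut_ind Int_absorb2)
    have u: "u \<in> K" "N u \<le> C * N (ind A)" unfolding u_def by (rule Omega_cut[OF E(1) AK])+
    have vm: "v \<in> borel_measurable M" unfolding v_def by (intro cut_measurable om E)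
    have vdom: "norm (v s) \<le> real n2 * norm (ind A s :: 'k)" for s
      using E EA by (auto simp: v_def cut_apply A1_def)
    note v = dominated[OF vm AK vdom of_nat_0_le_iff]
    have cu: "cut E u \<in> K" "N (cut E u) \<le> N u" by (rule cut_mem[OF E(1) u(1)])+
    have eq: "cut E (\<Omega> (ind E)) = cut E u + v" by (auto simp: u_def v_def cE cut_apply fun_eq_iff)
    have "N (cut E (\<Omega> (ind E))) \<le> \<kappa> * (N (cut E u) + N v)" unfolding eq by (rule N_add_le[OF cu(1) v(1)])
    also have "\<dots> \<le> C4" unfolding C4_def using cu(2) u(2) v(2) \<kappa>0 by (intro mult_left_mono add_mono) auto
    finally show ?thesis unfolding eq using K_add[OF cu(1) v(1)] by simp
  qed
  obtain B \<sigma> \<Gamma> q where B: "B \<in> sets M" "B \<subseteq> A1" "0 < measure M B" "measure M B \<le> \<sigma>" and \<Gamma>: "0 < \<Gamma>" and q: "0 < q" "q < 1"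
    and est: "\<And>E j. E \<in> sets M \<Longrightarrow> E \<subseteq> B \<Longrightarrow> measure M E \<le> \<sigma> * (1 / (4 * d)) ^ j \<Longrightarrow>
      N (ind E) \<le> \<Gamma> * q ^ j \<and> N (cut E (\<Omega> (ind E))) \<le> \<Gamma> * q ^ j"
    using regular_subset[OF na A1(1) A1f A1(2) \<delta> indL1 C4] by blast
  have Bf: "emeasure M B < \<infinity>" using emeasure_mono[OF B(2) A1(1)] A1f by (rule le_less_trans)
  have BA: "B \<subseteq> A" using B(2) A1(3) by blast
  have BK: "ind B \<in> K" using indicator_mem[OF B(1) Bf] .
  have "\<exists>D. E \<in> sets M \<longrightarrow> E \<subseteq> B \<longrightarrow> D \<in> sets M \<and> D \<subseteq> E \<and> measure M D = measure M E / 2" for E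
  proof (cases "E \<in> sets M \<and> E \<subseteq> B")
    case True
    then have "emeasure M E < \<infinity>" using emeasure_mono[of E B M] B(1) Bf by (auto intro: le_less_trans)
    then show ?thesis using nonatomic_intermediate_value[OF na, of E "measure M E / 2"] True by auto
  qed blast
  then obtain hf where hf: "\<And>E. E \<in> sets M \<Longrightarrow> E \<subseteq> B \<Longrightarrow> hf E \<in> sets M \<and> hf E \<subseteq> E \<and> measure M (hf E) = measure M E / 2"
    by metis
  interpret dp: dyadic_partition M B hf by unfold_locales (use B Bf hf in auto)
  define r :: "nat \<Rightarrow> 'a \<Rightarrow> 'k" where "r = dp.rad"
  have r0: "r i s = 0" if "s \<notin> B" for i s using that by (simp add: r_def dp.rad_def)
  have rK: "r i \<in> K" for i
  proof (rule dominated(1)[OF _ BK])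
    show "r i \<in> borel_measurable M" unfolding r_def by (rule dp.rad_measurable)
    show "norm (r i s) \<le> 1 * norm (ind B s :: 'k)" for s by (simp add: r_def dp.rad_def)
  qed simp
  define part where "part a n = (\<Sum>i<n. fscale (a i) (r i))" for a n
  have part_apply: "part a n s = (\<Sum>i<n. a i * r i s)" for a n s
    unfolding part_def sum_fun_apply by simp
  have pK: "part a n \<in> K" for a n unfolding part_def by (intro K_sum K_scale rK)
  have p0: "part a n s = 0" if "s \<notin> B" for a n s unfolding part_apply using r0[OF that] by simp
  have pscale: "part (fscale c a) n = fscale c (part a n)" for c a n
    unfolding part_def fun_vs.scale_sum_right by (rule sum.cong) (auto simp: fun_eq_iff)
  define D where "D = real DIM('k)"
  define G where "G = real (2 * DIM('k)) * exp 1"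
  have D1: "D \<ge> 1" by (simp add: D_def Suc_leI)
  have G1: "G \<ge> 1"
  proof -
    have "1 * 1 \<le> (2 * D) * exp 1" using D1 by (intro mult_mono) auto
    then show ?thesis by (simp add: G_def D_def)
  qed
  have d0: "real d \<ge> 2" using d by simp
  define Y where "Y = 4 * real d * G"
  have Y1: "Y > 1"
  proof -
    have "8 * 1 \<le> (4 * real d) * G" using d0 G1 by (intro mult_mono) auto
    then show ?thesis unfolding Y_def by linarith
  qed
  \<comment> \<open>makes the exponential tail at height \<open>k * L\<close> equal to the power \<open>- k\<close> of \<open>Y\<close>\<close>
  define L where "L = D * ln Y"
  have L: "L > 0" using D1 Y1 by (simp add: L_def)
  have ptail: "measure M {s \<in> B. real k * L < norm (part a n s)} \<le> \<sigma> * (1 / (4 * d)) ^ k"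
    if a: "(\<Sum>i<n. (norm (a i))\<^sup>2) \<le> 1" and k: "k > 0" for a n k
  proof -
    have "measure M {s \<in> B. real k * L < norm (part a n s)} \<le> measure M B * G * exp (- (real k * L) / D)"
      using dp.rad_sum_tail[OF a, of "real k * L"] unfolding part_apply r_def G_def D_def .
    also have "exp (- (real k * L) / D) = (1 / Y) ^ k"
    proof -
      have "- (real k * L) / D = real k * (- ln Y)" using D1 by (simp add: L_def)
      then have "exp (- (real k * L) / D) = exp (- ln Y) ^ k" by (simp only: exp_of_nat_mult)
      also have "exp (- ln Y) = 1 / Y" using Y1 by (simp add: exp_minus divide_inverse)
      finally show ?thesis .
    qed
    also have "(1 / Y) ^ k = (1 / (4 * d)) ^ k * (1 / G) ^ k"
      unfolding power_mult_distrib[symmetric] by (simp add: Y_def)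
    also have "measure M B * G * ((1 / (4 * d)) ^ k * (1 / G) ^ k)
        = measure M B * ((1 / (4 * d)) ^ k * (G * (1 / G) ^ k))" by (simp add: mult_ac)
    also have "\<dots> \<le> \<sigma> * ((1 / (4 * d)) ^ k * 1)"
    proof (intro mult_mono mult_left_mono B(4))
      have "(1 / G) ^ k \<le> (1 / G) ^ 1" using G1 k by (intro power_decreasing) auto
      then have "G * (1 / G) ^ k \<le> G * (1 / G) ^ 1" using G1 by (intro mult_left_mono) auto
      then show "G * (1 / G) ^ k \<le> 1" using G1 by simp
    qed (use G1 B in \<open>auto intro: order_trans[OF measure_nonneg]\<close>)
    finally show ?thesis by simp
  qed
  have markov: "measure M {s \<in> B. t < norm (g s)} \<le> N g / (\<delta> * t)" if g: "g \<in> K" and t: "t > 0" for g t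
  proof -
    define E where "E = {s \<in> B. t < norm (g s)}"
    have "E = {s \<in> space M. t < norm (g s)} \<inter> B"
      unfolding E_def using sets.sets_into_space[OF B(1)] by auto
    then have E: "E \<in> sets M" "E \<subseteq> A1" using K_measurable[OF g] B by (auto simp: E_def)
    have "N (ind E) \<le> (1 / t) * N g"
    proof (rule dominated(2)[OF _ g])
      show "norm (ind E s :: 'k) \<le> (1 / t) * norm (g s)" for s
        using t by (auto simp: E_def indicator_def field_simps)
    qed (use E t in auto)
    then have "\<delta> * measure M E \<le> (1 / t) * N g" using indL1[OF E] by linarith
    then show ?thesis unfolding E_def[symmetric] using \<delta> t by (simp add: field_simps)
  qed
  have tail: "measure M {s \<in> B. real k * (2 * L) < norm (f s)} \<le> \<sigma> * (1 / (4 * d)) ^ k"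
    if a: "\<And>n. (\<Sum>i<n. (norm (a i))\<^sup>2) \<le> 1" and f: "f \<in> K" and lim: "(\<lambda>n. N (part a n - f)) \<longlonglongrightarrow> 0" for a f k
  proof (cases "k = 0")
    case True
    have "measure M {s \<in> B. real k * (2 * L) < norm (f s)} \<le> measure M B"
      using B(1) Bf K_measurable[OF f] by (intro measure_mono_fmeasurable) (auto simp: fmeasurable_def)
    then show ?thesis using True B(4) by simp
  next
    case False
    define t where "t = real k * L"
    have t: "t > 0" using False L by (simp add: t_def)
    have ms: "{s \<in> B. t < norm (g s)} \<in> fmeasurable M" if "g \<in> K" for g
    proof -
      have "{s \<in> B. t < norm (g s)} = {s \<in> space M. t < norm (g s)} \<inter> B"
        using sets.sets_into_space[OF B(1)] by auto
      then have "{s \<in> B. t < norm (g s)} \<in> sets M" using K_measurable[OF that] B(1) by auto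
      moreover have "emeasure M {s \<in> B. t < norm (g s)} \<le> emeasure M B" by (intro emeasure_mono B) auto
      ultimately show ?thesis using Bf by (auto simp: fmeasurable_def intro: le_less_trans)
    qed
    have step: "measure M {s \<in> B. real k * (2 * L) < norm (f s)} \<le> \<sigma> * (1 / (4 * d)) ^ k + N (part a n - f) / (\<delta> * t)" for n
    proof -
      have PD: "part a n - f \<in> K" by (intro K_diff pK f)
      have sub: "{s \<in> B. real k * (2 * L) < norm (f s)}
          \<subseteq> {s \<in> B. t < norm (part a n s)} \<union> {s \<in> B. t < norm ((part a n - f) s)}"
      proof
        fix s assume s: "s \<in> {s \<in> B. real k * (2 * L) < norm (f s)}"
        have "norm (f s) \<le> norm (part a n s) + norm ((part a n - f) s)"
          using norm_triangle_ineq4[of "part a n s" "(part a n - f) s"] by simp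
        moreover have "2 * t < norm (f s)" using s by (simp add: t_def)
        ultimately have "t < norm (part a n s) \<or> t < norm ((part a n - f) s)" by linarith
        then show "s \<in> {s \<in> B. t < norm (part a n s)} \<union> {s \<in> B. t < norm ((part a n - f) s)}"
          using s by blast
      qed
      have fm: "{s \<in> B. real k * (2 * L) < norm (f s)} \<in> sets M"
      proof -
        have "{s \<in> B. real k * (2 * L) < norm (f s)} = {s \<in> space M. real k * (2 * L) < norm (f s)} \<inter> B"
          using sets.sets_into_space[OF B(1)] by auto
        then show ?thesis using K_measurable[OF f] B(1) by auto
      qed
      have "measure M {s \<in> B. real k * (2 * L) < norm (f s)}
          \<le> measure M ({s \<in> B. t < norm (part a n s)} \<union> {s \<in> B. t < norm ((part a n - f) s)})"
        by (rule measure_mono_fmeasurable[OF sub fm]) (intro fmeasurable.Un ms pK PD)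
      also have "\<dots> \<le> measure M {s \<in> B. t < norm (part a n s)} + measure M {s \<in> B. t < norm ((part a n - f) s)}"
        by (intro measure_Un_le fmeasurableD ms pK PD)
      also have "\<dots> \<le> \<sigma> * (1 / (4 * d)) ^ k + N (part a n - f) / (\<delta> * t)"
        using ptail[OF a, of k n] False markov[OF PD t] unfolding t_def by (intro add_mono) auto
      finally show ?thesis .
    qed
    have "(\<lambda>n. \<sigma> * (1 / (4 * d)) ^ k + N (part a n - f) / (\<delta> * t)) \<longlonglongrightarrow> \<sigma> * (1 / (4 * d)) ^ k + 0 / (\<delta> * t)"
      by (intro tendsto_add tendsto_const tendsto_divide lim) (use \<delta> t in auto)
    then show ?thesis using step LIMSEQ_le_const by force
  qed
  obtain R0 where R0: "\<forall>x\<in>borel_measurable M. (\<forall>s. s \<notin> B \<longrightarrow> x s = 0) \<longrightarrow>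
    (\<forall>k. measure M {s \<in> B. real k * (2 * L) < norm (x s)} \<le> \<sigma> * (1 / (4 * d)) ^ k) \<longrightarrow>
    x \<in> K \<and> N x \<le> R0 \<and> \<Omega> x \<in> K \<and> N (\<Omega> x) \<le> R0"
  proof -
    have CK: "cut E (\<Omega> (ind E)) \<in> K" if "E \<in> sets M" "E \<subseteq> B" for E using C4[OF that(1)] that(2) B(2) by blast
    have "2 * L > 0" using L by simp
    from thin_tails_bounded[OF B(1) Bf \<Gamma> q this est CK] show ?thesis using that by blast
  qed
  define R where "R = \<bar>R0\<bar>"
  have R: "R \<ge> 0" by (simp add: R_def)
  have unit: "N f \<le> R \<and> \<Omega> f \<in> K \<and> N (\<Omega> f) \<le> R"
    if a: "\<And>n. (\<Sum>i<n. (norm (a i))\<^sup>2) \<le> 1" and f: "f \<in> K" "\<And>s. s \<notin> B \<Longrightarrow> f s = 0"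
      and lim: "(\<lambda>n. N (part a n - f)) \<longlonglongrightarrow> 0" for a f
  proof -
    have "f \<in> borel_measurable M" by (rule K_measurable[OF f(1)])
    then have "f \<in> K \<and> N f \<le> R0 \<and> \<Omega> f \<in> K \<and> N (\<Omega> f) \<le> R0" using R0 f(2) tail[OF a f(1) lim] by blast
    then show ?thesis unfolding R_def by linarith
  qed
  have scaled: "N f \<le> \<rho> * R \<and> \<Omega> f \<in> K \<and> N (\<Omega> f) \<le> \<rho> * R"
    if \<rho>: "\<rho> > 0" and a: "\<And>n. (\<Sum>i<n. (norm (a i))\<^sup>2) \<le> \<rho>\<^sup>2" and f: "f \<in> K" "\<And>s. s \<notin> B \<Longrightarrow> f s = 0"
      and lim: "(\<lambda>n. N (part a n - f)) \<longlonglongrightarrow> 0" for a f \<rho>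
  proof -
    define c :: 'k where "c = of_real (1 / \<rho>)"
    have nc: "norm c = 1 / \<rho>" using \<rho> unfolding c_def norm_of_real by simp
    have c0: "c \<noteq> 0" using nc \<rho> by auto
    have u: "N (fscale c f) \<le> R \<and> \<Omega> (fscale c f) \<in> K \<and> N (\<Omega> (fscale c f)) \<le> R"
    proof (rule unit[of "fscale c a"])
      show "(\<Sum>i<n. (norm (fscale c a i))\<^sup>2) \<le> 1" for n
      proof -
        have "(\<Sum>i<n. (norm (fscale c a i))\<^sup>2) = (\<Sum>i<n. (norm (a i))\<^sup>2) / \<rho>\<^sup>2"
          unfolding sum_divide_distrib by (rule sum.cong) (auto simp: norm_mult nc power_mult_distrib power_divide)
        then show ?thesis using a[of n] \<rho> by simp
      qed
      show "(\<lambda>n. N (part (fscale c a) n - fscale c f)) \<longlonglongrightarrow> 0"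
        unfolding pscale by (rule N_limit_scale[OF pK f(1) lim])
    qed (use f K_scale in auto)
    have inv: "\<rho> * (1 / \<rho>) = 1" using \<rho> by simp
    have "1 / \<rho> * N f \<le> R" using u N_scale[OF f(1), of c] nc by simp
    then have 1: "N f \<le> \<rho> * R" using \<rho> by (simp add: field_simps)
    have ae1: "AE s in M. \<Omega> f s = fscale (1 / c) (\<Omega> (fscale c f)) s"
      using hom[OF f(1), of c] by eventually_elim (use c0 in simp)
    have cK: "fscale (1 / c) (\<Omega> (fscale c f)) \<in> K" using u by (intro K_scale) auto
    note nn = N_cong[OF Omega_measurable[OF f(1)] cK ae1]
    have "N (fscale (1 / c) (\<Omega> (fscale c f))) = \<rho> * N (\<Omega> (fscale c f))"
      using N_scale[of "\<Omega> (fscale c f)" "1 / c"] u nc by (simp add: norm_divide)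
    also have "\<dots> \<le> \<rho> * R" using u \<rho> by (intro mult_left_mono) auto
    finally have "N (\<Omega> f) \<le> \<rho> * R" unfolding nn(2) .
    then show ?thesis using 1 nn(1) by blast
  qed
  have up: "N (part a n) \<le> R * sqrt (\<Sum>i<n. (norm (a i))\<^sup>2)" for a n
  proof -
    define b where "b i = (if i < n then a i else 0)" for i
    have eqn: "part b m = part a n" if "m \<ge> n" for m
      unfolding part_def using that by (intro sum.mono_neutral_cong_right) (auto simp: b_def fun_eq_iff)
    have lim: "(\<lambda>m. N (part b m - part a n)) \<longlonglongrightarrow> 0"
    proof (rule tendsto_eventually)
      show "\<forall>\<^sub>F m in sequentially. N (part b m - part a n) = 0"
        unfolding eventually_sequentially by (intro exI[of _ n]) (auto simp: eqn N_zero)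
    qed
    \<comment> \<open>approaching the norm of \<open>a\<close> from above includes the case of vanishing coefficients\<close>
    have "N (part a n) \<le> sqrt (\<Sum>i<n. (norm (a i))\<^sup>2) * R"
    proof (rule le_mult_of_all_greater[OF _ R])
      fix \<rho> assume \<rho>: "\<rho> > sqrt (\<Sum>i<n. (norm (a i))\<^sup>2)"
      have "0 \<le> sqrt (\<Sum>i<n. (norm (a i))\<^sup>2)" by (intro real_sqrt_ge_zero sum_nonneg) auto
      then have \<rho>0: "\<rho> > 0" using \<rho> by linarith
      have "(\<Sum>i<m. (norm (b i))\<^sup>2) \<le> \<rho>\<^sup>2" for m
      proof -
        have "(\<Sum>i<m. (norm (b i))\<^sup>2) \<le> (\<Sum>i<m + n. (norm (b i))\<^sup>2)" by (intro sum_mono2) auto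
        also have "\<dots> = (\<Sum>i<n. (norm (a i))\<^sup>2)"
          by (intro sum.mono_neutral_cong_right) (auto simp: b_def)
        also have "\<dots> \<le> \<rho>\<^sup>2" using \<rho> by (intro sqrt_le_D less_imp_le)
        finally show ?thesis .
      qed
      from scaled[OF \<rho>0 this pK p0 lim] show "N (part a n) \<le> \<rho> * R" by blast
    qed
    then show ?thesis by (simp only: mult.commute)
  qed
  obtain c where c: "c > 0" and kh: "\<forall>n (a :: nat \<Rightarrow> 'k).
    2 ^ n * (c * sqrt (\<Sum>i<n. (norm (a i))\<^sup>2)) \<le> (\<Sum>j<2 ^ n. norm (signed_sum a n j))"
    using signed_sum_first_moment by blast
  define c1 where "c1 = \<delta> * measure M B * c"
  have c1: "c1 > 0" using \<delta> B(3) c by (simp add: c1_def)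
  have low: "c1 * sqrt (\<Sum>i<n. (norm (a i))\<^sup>2) \<le> N (part a n)" for a n
  proof -
    let ?S = "\<Sum>j<2 ^ n. norm (signed_sum a n j)"
    have S0: "0 \<le> ?S" by (intro sum_nonneg) auto
    have "(\<integral>\<^sup>+ s. ennreal (norm (part a n s)) * indicator A s \<partial>M) = (\<integral>\<^sup>+ s. ennreal (norm (\<Sum>i<n. a i * dp.rad i s)) \<partial>M)"
    proof (intro nn_integral_cong)
      fix s
      show "ennreal (norm (part a n s)) * indicator A s = ennreal (norm (\<Sum>i<n. a i * dp.rad i s))"
        using p0[of s a n] BA by (cases "s \<in> B") (auto simp: part_apply r_def)
    qed
    also have "\<dots> = ennreal (measure M B / 2 ^ n * ?S)" by (rule dp.rad_sum_integral)
    finally have "ennreal \<delta> * ennreal (measure M B / 2 ^ n * ?S) \<le> ennreal (N (part a n))" using L1[OF pK, of a n] by simp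
    then have "\<delta> * (measure M B / 2 ^ n * ?S) \<le> N (part a n)"
      using \<delta> S0 N_nonneg[OF pK, of a n] by (simp add: ennreal_mult[symmetric])
    moreover have "c1 * sqrt (\<Sum>i<n. (norm (a i))\<^sup>2) \<le> \<delta> * (measure M B / 2 ^ n * ?S)"
    proof -
      have "c1 * sqrt (\<Sum>i<n. (norm (a i))\<^sup>2) = \<delta> * (measure M B / 2 ^ n * (2 ^ n * (c * sqrt (\<Sum>i<n. (norm (a i))\<^sup>2))))"
        by (simp add: c1_def)
      also have "\<dots> \<le> \<delta> * (measure M B / 2 ^ n * ?S)"
        using kh \<delta> by (intro mult_left_mono) auto
      finally show ?thesis .
    qed
    ultimately show ?thesis by linarith
  qed
  obtain H T where H: "closed_subspace K N H" "isomorphic_onto M l2_space l2_norm H N" "\<not> finite_dim_ae M H"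
    and HT: "\<And>y. y \<in> H \<Longrightarrow> \<exists>a\<in>l2_space. AE s in M. T a s = y s"
    and T: "\<And>a. a \<in> l2_space \<Longrightarrow> T a \<in> K"
      "\<And>a. a \<in> l2_space \<Longrightarrow> (\<lambda>n. N (part a n - T a)) \<longlonglongrightarrow> 0"
      "\<And>a. a \<in> l2_space \<Longrightarrow> c1 * l2_norm a \<le> \<kappa> * N (T a)"
    using l2_basis_spans_l2[of r c1 R, OF rK c1 low[unfolded part_def] up[unfolded part_def]]
    unfolding part_def by blast
  have "bounded_on K N \<Omega> H"
    unfolding bounded_on_def
  proof (intro exI[of _ "\<kappa> / c1 * R"] ballI)
    fix y assume y: "y \<in> H"
    have yK: "y \<in> K" using y H(1) unfolding closed_subspace_def by blast
    obtain a where a: "a \<in> l2_space" and Ty: "AE s in M. T a s = y s" using HT[OF y] by blast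
    define f where "f = cut B (T a)"
    have fK: "f \<in> K" unfolding f_def by (rule cut_mem(1)[OF B(1) T(1)[OF a]])
    have f0: "f s = 0" if "s \<notin> B" for s using that by (simp add: f_def cut_apply)
    have lim: "(\<lambda>n. N (part a n - f)) \<longlonglongrightarrow> 0"
    proof (rule tendsto_sandwich[OF _ _ tendsto_const T(2)[OF a]])
      have PD: "part a n - T a \<in> K" for n by (intro K_diff pK T a)
      have "part a n - f = cut B (part a n - T a)" for n
        using p0 by (auto simp: f_def cut_apply fun_eq_iff)
      then have "N (part a n - f) \<le> N (part a n - T a)" for n using cut_mem(2)[OF B(1) PD, of n] by simp
      then show "\<forall>\<^sub>F n in sequentially. N (part a n - f) \<le> N (part a n - T a)" by simp
      have "0 \<le> N (part a n - f)" for n by (intro N_nonneg K_diff pK fK)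
      then show "\<forall>\<^sub>F n in sequentially. 0 \<le> N (part a n - f)" by simp
    qed
    have "AE s in M. f s = T a s" by (rule N_limit_unique[of "part a", OF pK fK T(1)[OF a] lim T(2)[OF a]])
    with Ty have fy: "AE s in M. f s = y s" by eventually_elim simp
    have ln: "l2_norm a \<ge> 0" using norm_le_l2_norm[OF a, of 0] norm_ge_zero order_trans by blast
    have bd: "\<Omega> f \<in> K \<and> N (\<Omega> f) \<le> \<rho> * R" if \<rho>: "\<rho> > l2_norm a" for \<rho>
    proof -
      have "(\<Sum>i<n. (norm (a i))\<^sup>2) \<le> \<rho>\<^sup>2" for n
        using l2_partial_le[OF a, of n] \<rho> by (intro sqrt_le_D) linarith
      moreover have "\<rho> > 0" using \<rho> ln by linarith
      ultimately show ?thesis using scaled[OF _ _ fK f0 lim] by blast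
    qed
    have OfK: "\<Omega> f \<in> K" using bd[of "l2_norm a + 1"] by simp
    have "N (\<Omega> f) \<le> l2_norm a * R" by (rule le_mult_of_all_greater[OF _ R]) (use bd in blast)
    also have "\<dots> \<le> \<kappa> / c1 * N y * R"
    proof (intro mult_right_mono R)
      have "N (T a) = N y" by (rule N_cong(2)[OF K_measurable[OF T(1)[OF a]] yK Ty])
      then show "l2_norm a \<le> \<kappa> / c1 * N y" using T(3)[OF a] c1 by (simp add: field_simps)
    qed
    finally have Of: "N (\<Omega> f) \<le> \<kappa> / c1 * R * N y" by (simp add: mult_ac)
    have "AE s in M. \<Omega> y s = \<Omega> f s"
    proof -
      have "AE s in M. y s = f s" using fy by eventually_elim simp
      then show ?thesis using ae yK fK unfolding respects_ae_def by blast
    qed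
    from N_cong[OF Omega_measurable[OF yK] OfK this]
    show "\<Omega> y \<in> K \<and> N (\<Omega> y) \<le> \<kappa> / c1 * R * N y" using Of by simp
  qed
  with H show ?thesis by (rule that)
qed

end

theorem proposition2p3:
  fixes M :: "'a measure"
    and K :: "('a \<Rightarrow> 'k::{real_normed_field, euclidean_space}) set"
    and N :: "('a \<Rightarrow> 'k) \<Rightarrow> real"
    and \<Omega> :: "('a \<Rightarrow> 'k) \<Rightarrow> 'a \<Rightarrow> 'k"
  assumes "koethe_space M K N"
    and "nonatomic M"
    and "emeasure M (space M) \<noteq> 0"
    and "admissible M K N"
    and "superreflexive M K N"
    and "centralizer M K N \<Omega>"
  shows "\<not> singular M K N \<Omega> \<and>
    (\<exists>H. closed_subspace K N H \<and>
         isomorphic_onto M l2_space l2_norm H N \<and>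
         bounded_on K N \<Omega> H)"
proof -
  obtain \<kappa> c0 d where le: "koethe_lower_estimate M K N \<kappa> c0 d"
    using superreflexive_imp_lower_estimate[OF assms(1,5)] .
  interpret koethe_lower_estimate M K N \<kappa> c0 d by (rule le)
  note cz = assms(6)[unfolded centralizer_def]
  obtain C where C: "\<forall>f\<in>Linf_space M. \<forall>x\<in>K. \<Omega> (f * x) - f * \<Omega> x \<in> K \<and>
      N (\<Omega> (f * x) - f * \<Omega> x) \<le> C * enn2real (Linf_norm M f) * N x"
    using cz by blast
  have "koethe_centralizer M K N \<kappa> c0 d \<Omega> (max C 0)"
  proof
    show "0 \<le> max C 0" by simp
    show "\<Omega> x \<in> borel_measurable M" if "x \<in> K" for x using cz that by blast
    show "\<Omega> (f * x) - f * \<Omega> x \<in> K \<and>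
      N (\<Omega> (f * x) - f * \<Omega> x) \<le> max C 0 * enn2real (Linf_norm M f) * N x"
      if "f \<in> Linf_space M" "x \<in> K" for f x
    proof -
      have "C * enn2real (Linf_norm M f) * N x \<le> max C 0 * enn2real (Linf_norm M f) * N x"
        using N_nonneg[OF that(2)] by (intro mult_right_mono) auto
      then show ?thesis using C that by (meson order_trans)
    qed
  qed
  then interpret koethe_centralizer M K N \<kappa> c0 d \<Omega> "max C 0" .
  obtain h where h: "h \<in> borel_measurable M" "AE s in M. 0 < (h s :: real)"
    and hN: "\<And>x. x \<in> K \<Longrightarrow> L1_norm M (\<lambda>s. of_real (h s) * x s) \<le> ennreal (N x)"
    using assms(4) unfolding admissible_def by blast
  have ra: "respects_ae M K \<Omega>" and hom: "\<And>c x. x \<in> K \<Longrightarrow> AE s in M. \<Omega> (fscale c x) s = c * \<Omega> x s"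
    using cz by blast+
  obtain H where H: "closed_subspace K N H" "isomorphic_onto M l2_space l2_norm H N" "\<not> finite_dim_ae M H"
    "bounded_on K N \<Omega> H"
    using exists_bounded_l2_copy[OF assms(2,3) h hN ra hom] .
  obtain R where R: "\<And>x. x \<in> H \<Longrightarrow> \<Omega> x \<in> K \<and> N (\<Omega> x) \<le> R * N x"
    using H(4) unfolding bounded_on_def by blast
  have HK: "x \<in> K" if "x \<in> H" for x using H(1) that unfolding closed_subspace_def by blast
  have z: "\<Omega> x - 0 = \<Omega> x" for x by simp
  have "trivial_on M K N \<Omega> H"
    unfolding trivial_on_def
  proof (intro exI[of _ "\<lambda>_. 0"] conjI ballI)
    show "linear_to_L0 M H (\<lambda>_. 0)" by (auto simp: linear_to_L0_def zero_fun_def)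
    show "respects_ae M H (\<lambda>_. 0)" by (auto simp: respects_ae_def)
    show "\<Omega> x - 0 \<in> K" if "x \<in> H" for x unfolding z using R[OF that] by blast
    show "bdd_above ((\<lambda>x. N (\<Omega> x - 0)) ` {x \<in> H. N x \<le> 1})"
      unfolding z
    proof (rule bdd_aboveI2)
      fix x assume x: "x \<in> {x \<in> H. N x \<le> 1}"
      then have x01: "0 \<le> N x" "N x \<le> 1" using N_nonneg HK by auto
      have "N (\<Omega> x) \<le> R * N x" using R x by blast
      also have "\<dots> \<le> \<bar>R\<bar> * 1" using x01 by (intro mult_mono) auto
      finally show "N (\<Omega> x) \<le> \<bar>R\<bar>" by simp
    qed
  qed
  then have "\<not> singular M K N \<Omega>" unfolding singular_def using H(1,3) by blast
  with H show ?thesis by blast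
qed

end
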